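(* Let $1\leq p<\infty$ and $\mathbf{w}\in\mathbb{W}$. Then there exists an increasing sequence $(N_k)_{k=1}^\infty$ of positive integers such that the block sequence $((d_i^{(k)})_{i=1}^{N_k})_{k=1}^\infty$ (that is, for $k=1,2,3,\dots$ successively, $N_k$ consecutive normalized constant-coefficient blocks of length $k$ of the unit vector basis $(d_n)_{n=1}^\infty$) spans a 1-complemented subspace $Y$ of $d(\mathbf{w},p)$ which contains no isomorph of $d(\mathbf{w},p)$ and which is not isomorphic to $\ell_p$.
   Context: Scalars are $\mathbb{K}\in\{\mathbb{R},\mathbb{C}\}$. $\mathbb{W}$ is the set of all real sequences $\mathbf{w}=(w_n)_{n=1}^\infty\in c_0\setminus\ell_1$ with $1=w_1\geq w_2\geq w_3\geq\cdots>0$. For $1\leq p<\infty$ and $\mathbf{w}\in\mathbb{W}$, the Lorentz sequence space $d(\mathbf{w},p)$ is the space of all scalar sequences $(a_n)_{n=1}^\infty$ with $$\|(a_n)\|_{d(\mathbf{w},p)}:=\sup_{\pi}\Big(\sum_{n=1}^\infty|a_{\pi(n)}|^pw_n\Big)^{1/p}<\infty,$$ the supremum being over all permutations $\pi$ of $\mathbb{N}$; $(d_n)_{n=1}^\infty$ denotes its unit vector basis. Put $W_k:=\sum_{n=1}^kw_n$. The sequence $((d_i^{(k)})_{i=1}^{N_k})_{k=1}^\infty$ denotes the following successive blocks: with $M_0=0$ and $M_k=\sum_{m=1}^k mN_m$, $$d_i^{(k)}=\frac{1}{W_k^{1/p}}\sum_{n=M_{k-1}+(i-1)k+1}^{M_{k-1}+ik}d_n,\qquad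 1\leq i\leq N_k,\ k\in\mathbb{N}.$$ The subspace spanned by a sequence is its closed linear span. A subspace is 1-complemented if it is the range of a linear projection of norm $1$. "Contains no isomorph of $Z$" means that no closed subspace is linearly homeomorphic to $Z$. *)

theory Defs
  imports "HOL-Analysis.Analysis" "HOL-Library.Function_Algebras"
begin

text \<open>
  A scalar sequence \<open>(a\<^sub>n)\<close>, \<open>n \<ge> 1\<close>, is a function \<open>a :: nat \<Rightarrow> 'a\<close> whose value \<open>a n\<close> is
  the entry with number \<open>n + 1\<close>; thus \<open>w 0\<close> is the first weight and \<open>unit_seq 0\<close> the first
  unit vector.  Block lengths \<open>k\<close> and the numbers \<open>i\<close> of the blocks of length \<open>k\<close> start at 1.

  As the norm of \<open>d(w,p)\<close> depends on \<open>w\<close> and \<open>p\<close>, a normed space is given as a linear subspace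
  \<open>V\<close> of \<open>nat \<Rightarrow> 'a\<close> together with a function \<open>nrm\<close> that is a norm on \<open>V\<close>.
\<close>

definition seq_scale :: "'a::field \<Rightarrow> (nat \<Rightarrow> 'a) \<Rightarrow> nat \<Rightarrow> 'a" where
  "seq_scale c x = (\<lambda>n. c * x n)"

interpretation seq: vector_space seq_scale
  by unfold_locales (auto simp: seq_scale_def fun_eq_iff algebra_simps)

definition linear_on :: "(nat \<Rightarrow> 'a::field) set \<Rightarrow> ((nat \<Rightarrow> 'a) \<Rightarrow> nat \<Rightarrow> 'a) \<Rightarrow> bool" where
  "linear_on V T \<longleftrightarrow>
     (\<forall>x\<in>V. \<forall>y\<in>V. T (x + y) = T x + T y) \<and>
     (\<forall>c. \<forall>x\<in>V. T (seq_scale c x) = seq_scale c (T x))"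

definition norm_topology ::
    "(nat \<Rightarrow> 'a::real_normed_field) set \<Rightarrow> ((nat \<Rightarrow> 'a) \<Rightarrow> real) \<Rightarrow> (nat \<Rightarrow> 'a) topology" where
  "norm_topology V nrm = Metric_space.mtopology V (\<lambda>x y. nrm (x - y))"

definition linearly_homeomorphic ::
    "(nat \<Rightarrow> 'a::real_normed_field) set \<Rightarrow> ((nat \<Rightarrow> 'a) \<Rightarrow> real) \<Rightarrow>
     (nat \<Rightarrow> 'a) set \<Rightarrow> ((nat \<Rightarrow> 'a) \<Rightarrow> real) \<Rightarrow> bool" where
  "linearly_homeomorphic V nrmV W nrmW \<longleftrightarrow>
     (\<exists>T. linear_on V T \<and> homeomorphic_map (norm_topology V nrmV) (norm_topology W nrmW) T)"

definition contains_isomorph ::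
    "(nat \<Rightarrow> 'a::real_normed_field) set \<Rightarrow> ((nat \<Rightarrow> 'a) \<Rightarrow> real) \<Rightarrow>
     (nat \<Rightarrow> 'a) set \<Rightarrow> ((nat \<Rightarrow> 'a) \<Rightarrow> real) \<Rightarrow> bool" where
  "contains_isomorph V nrmV W nrmW \<longleftrightarrow>
     (\<exists>Z\<subseteq>V. seq.subspace Z \<and> closedin (norm_topology V nrmV) Z \<and>
            linearly_homeomorphic Z nrmV W nrmW)"

definition bounded_on ::
    "(nat \<Rightarrow> 'a::real_normed_field) set \<Rightarrow> ((nat \<Rightarrow> 'a) \<Rightarrow> real) \<Rightarrow>
     ((nat \<Rightarrow> 'a) \<Rightarrow> nat \<Rightarrow> 'a) \<Rightarrow> bool" where
  "bounded_on V nrm T \<longleftrightarrow> (\<exists>C. \<forall>x\<in>V. nrm (T x) \<le> C * nrm x)"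

text \<open>Only meaningful for maps that are \<^const>\<open>bounded_on\<close>, as \<open>SUP\<close> is a real supremum.\<close>

definition op_norm_on ::
    "(nat \<Rightarrow> 'a::real_normed_field) set \<Rightarrow> ((nat \<Rightarrow> 'a) \<Rightarrow> real) \<Rightarrow>
     ((nat \<Rightarrow> 'a) \<Rightarrow> nat \<Rightarrow> 'a) \<Rightarrow> real" where
  "op_norm_on V nrm T = (SUP x\<in>{x\<in>V. nrm x \<le> 1}. nrm (T x))"

definition one_complemented ::
    "(nat \<Rightarrow> 'a::real_normed_field) set \<Rightarrow> ((nat \<Rightarrow> 'a) \<Rightarrow> real) \<Rightarrow> (nat \<Rightarrow> 'a) set \<Rightarrow> bool" where
  "one_complemented V nrm Y \<longleftrightarrow>
     (\<exists>P. linear_on V P \<and> P \<in> V \<rightarrow> V \<and> (\<forall>x\<in>V. P (P x) = P x) \<and> P ` V = Y \<and>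
          bounded_on V nrm P \<and> op_norm_on V nrm P = 1)"

definition ell_space :: "real \<Rightarrow> (nat \<Rightarrow> 'a::real_normed_field) set" where
  "ell_space p = {a. summable (\<lambda>n. norm (a n) powr p)}"

definition ell_norm :: "real \<Rightarrow> (nat \<Rightarrow> 'a::real_normed_field) \<Rightarrow> real" where
  "ell_norm p a = (\<Sum>n. norm (a n) powr p) powr (1 / p)"

definition weights :: "(nat \<Rightarrow> real) set" where
  "weights = {w. w \<longlonglongrightarrow> 0 \<and> \<not> summable (\<lambda>n. \<bar>w n\<bar>) \<and> w 0 = 1 \<and> decseq w \<and> (\<forall>n. w n > 0)}"

text \<open>The sum and the supremum are taken in \<open>[0,\<infinity>]\<close>.\<close>

definition lorentz_sup :: "(nat \<Rightarrow> real) \<Rightarrow> real \<Rightarrow> (nat \<Rightarrow> 'a::real_normed_field) \<Rightarrow> ennreal" where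
  "lorentz_sup w p a = (SUP \<pi>\<in>{\<pi>. bij \<pi>}. \<Sum>n. ennreal (norm (a (\<pi> n)) powr p * w n))"

definition lorentz_space :: "(nat \<Rightarrow> real) \<Rightarrow> real \<Rightarrow> (nat \<Rightarrow> 'a::real_normed_field) set" where
  "lorentz_space w p = {a. lorentz_sup w p a < \<infinity>}"

definition lorentz_norm :: "(nat \<Rightarrow> real) \<Rightarrow> real \<Rightarrow> (nat \<Rightarrow> 'a::real_normed_field) \<Rightarrow> real" where
  "lorentz_norm w p a = enn2real (lorentz_sup w p a) powr (1 / p)"

definition unit_seq :: "nat \<Rightarrow> nat \<Rightarrow> 'a::real_normed_field" where
  "unit_seq n = (\<lambda>m. of_bool (m = n))"

definition W_sum :: "(nat \<Rightarrow> real) \<Rightarrow> nat \<Rightarrow> real" where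
  "W_sum w k = (\<Sum>n<k. w n)"

definition M_sum :: "(nat \<Rightarrow> nat) \<Rightarrow> nat \<Rightarrow> nat" where
  "M_sum N k = (\<Sum>m=1..k. m * N m)"

text \<open>
  The \<open>i\<close>-th block of length \<open>k\<close>, for \<open>k \<ge> 1\<close> and \<open>1 \<le> i \<le> N k\<close>.  The entries numbered
  \<open>M\<^sub>k\<^sub>-\<^sub>1 + (i - 1) k + 1, \<dots>, M\<^sub>k\<^sub>-\<^sub>1 + i k\<close> are the indices below, shifted by one.
\<close>

definition block ::
    "(nat \<Rightarrow> real) \<Rightarrow> real \<Rightarrow> (nat \<Rightarrow> nat) \<Rightarrow> nat \<Rightarrow> nat \<Rightarrow> nat \<Rightarrow> 'a::real_normed_field" where
  "block w p N k i =
     seq_scale (of_real (1 / W_sum w k powr (1 / p)))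
       (\<Sum>n\<in>{M_sum N (k - 1) + (i - 1) * k ..< M_sum N (k - 1) + i * k}. unit_seq n)"

definition block_subspace ::
    "(nat \<Rightarrow> real) \<Rightarrow> real \<Rightarrow> (nat \<Rightarrow> nat) \<Rightarrow> (nat \<Rightarrow> 'a::real_normed_field) set" where
  "block_subspace w p N =
     norm_topology (lorentz_space w p) (lorentz_norm w p) closure_of
       seq.span {block w p N k i | k i. 1 \<le> k \<and> 1 \<le> i \<and> i \<le> N k}"

end

theory Submission
  imports Defs
begin

text \<open>
  The scalars range over any type of class \<open>real_normed_field\<close> and \<open>real_inner\<close>, which covers the
  real and the complex numbers at once.  Every estimate of the Lorentz norm goes through finite
  partial rearrangements: \<open>\<parallel>a\<parallel>\<^sup>p\<close> is the supremum of \<open>\<Sum>\<^bsub>n\<in>D\<^esub> \<bar>a(F n)\<bar>\<^sup>p w\<^sub>n\<close> over finite \<open>D\<close> and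
  injective \<open>F\<close> (\<open>rearranged_sum_le\<close>, \<open>lorentzI\<close>).

  \<^emph>\<open>Complementation.\<close>  Averaging over the blocks is the projection.  It has norm 1 because
  averages over a block are averages over its cyclic shifts, and rearrangements preserve the norm
  (\<open>average_contraction\<close>).  Its range is the closed span \<open>Y\<close> of the blocks because tails of elements
  of \<open>d(w,p)\<close> tend to \<open>0\<close> (\<open>tail_small\<close>, \<open>block_subspace_eq_Y\<close>).

  \<^emph>\<open>No isomorph of \<open>d(w,p)\<close>.\<close>  Let \<open>y\<^sub>n \<in> Y\<close> be the images of the unit vectors.  Their coordinates tend
  to \<open>0\<close>, so far out they are disjoint up to small errors.  As far out all blocks are long, entries
  of bounded vectors of \<open>Y\<close> are uniformly small there, so a new vector loses almost nothing if it may
  not use the first places of a rearrangement.  Hence sums of \<open>m\<close> well-chosen \<open>y\<^sub>n\<close> have norm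
  of order at least \<open>m\<^bsup>1/p\<^esup>\<close> (\<open>disjoint_humps\<close>).  But they should have norm of order
  \<open>W\<^sub>m\<^bsup>1/p\<^esup> = o(m\<^bsup>1/p\<^esup>)\<close>.

  \<^emph>\<open>Not isomorphic to \<open>\<ell>\<^sub>p\<close>.\<close>  The blocks of length \<open>k\<close> span the Lorentz space of dimension \<open>N\<^sub>k\<close> with the
  weights \<open>v\<^sub>i = (W\<^bsub>k(i+1)\<^esub> - W\<^bsub>ki\<^esub>)/W\<^sub>k\<close>, 1-complemented in \<open>Y\<close>.  It suffices that for
  fixed \<open>k\<close> and \<open>C\<close> such spaces of large dimension are not \<open>C\<close>-isomorphic to \<open>C\<close>-complemented subspaces of
  \<open>\<ell>\<^sub>p\<close> (\<open>no_large_systems\<close>); then \<open>N\<^sub>k\<close> is chosen for \<open>C = k\<close>.  Put \<open>V\<^sub>n = v\<^sub>0 + \<dots> + v\<^bsub>n-1\<^esub>\<close> and note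
  that \<open>V\<^sub>n = o(n)\<close>.  For \<open>p \<ge> 2\<close>, cotype \<open>p\<close> of \<open>\<ell>\<^sub>p\<close> forces \<open>V\<^sub>n \<ge> c n\<close> (\<open>count_le_weights\<close>).

  For \<open>p < 2\<close> the space \<open>\<ell>\<^sub>p\<close> has only cotype 2, and for \<open>1 < p < 2\<close> it even has well-complemented
  Hilbert subspaces of every finite dimension, so more is needed.  As \<open>V\<^sub>n = o(n)\<close>, the images \<open>u\<^sub>i\<close> of
  the basis vectors are equi-integrable: their large parts are almost disjoint on random sets of \<open>n\<close>
  indices, here on lines in a grid, which would give \<open>V\<^sub>n \<ge> c n\<close> if these parts had noticeable norm
  (\<open>mass_of_large_parts\<close>).  Once they are removed, all \<open>\<bar>u\<^sub>i\<bar>\<close> lie below one function of \<open>\<ell>\<^sub>p\<close>, and the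
  basis satisfies an upper \<open>\<ell>\<^sub>2\<close> estimate (\<open>upper_square_estimate\<close>) with a constant that does not depend
  on the dimension.  By cotype 2, \<open>V\<^sub>n \<ge> c n\<^bsup>p/2\<^esup>\<close> (\<open>square_root_growth\<close>).  The upper estimate yields
  \<open>v \<in> \<ell>\<^sub>r\<close> with \<open>r = 2/(2-p)\<close>, whence \<open>V\<^sub>n = o(n\<^bsup>p/2\<^esup>)\<close>, a contradiction
  (\<open>square_estimates_contradict\<close>).
\<close>

section \<open>Convexity of powers\<close>

lemma convex_on_powr:
  fixes p :: real
  assumes "1 \<le> p"
  shows "convex_on {0..} (\<lambda>x. x powr p)"
proof
  fix t x y :: real
  assume t: "0 < t" "t < 1" and xy: "x \<in> {0..}" "y \<in> {0..}"
  have small: "s powr p \<le> s" if "0 \<le> s" "s \<le> 1" for s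
    using powr_mono'[of 1 p s] assms that by simp
  show "((1 - t) *\<^sub>R x + t *\<^sub>R y) powr p \<le> (1 - t) * x powr p + t * y powr p"
  proof (cases "x = 0 \<or> y = 0")
    case True
    then show ?thesis
      using small[of t] small[of "1 - t"] t xy assms
      by (auto simp: powr_mult intro!: mult_right_mono)
  next
    case False
    then show ?thesis
      using convex_onD[OF powr_convex[OF assms], of t x y] t xy by simp
  qed
qed (rule convex_real_interval)

lemma mean_powr_le:
  fixes f :: "'b \<Rightarrow> real"
  assumes "finite A" "A \<noteq> {}" "1 \<le> p" and f: "\<And>x. x \<in> A \<Longrightarrow> 0 \<le> f x"
  shows "(sum f A / card A) powr p \<le> (\<Sum>x\<in>A. f x powr p) / card A"
proof -
  have "(\<Sum>i\<in>A. (1 / card A) *\<^sub>R f i) powr p \<le> (\<Sum>i\<in>A. (1 / card A) * f i powr p)"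
    by (rule convex_on_sum[OF assms(1,2) convex_on_powr[OF \<open>1 \<le> p\<close>]]) (use assms in auto)
  then show ?thesis
    by (simp flip: sum_divide_distrib)
qed

lemma mean_powr_ge:
  fixes f :: "'b \<Rightarrow> real"
  assumes "finite A" "A \<noteq> {}" "0 < r" "r \<le> 1" and f: "\<And>x. x \<in> A \<Longrightarrow> 0 \<le> f x"
  shows "(\<Sum>x\<in>A. f x powr r) / card A \<le> (sum f A / card A) powr r"
proof -
  have "((\<Sum>x\<in>A. f x powr r) / card A) powr (1 / r) \<le> (\<Sum>x\<in>A. (f x powr r) powr (1 / r)) / card A"
    by (rule mean_powr_le) (use assms in auto)
  also have "\<dots> = sum f A / card A"
    using assms by (simp add: powr_powr)
  finally have "(((\<Sum>x\<in>A. f x powr r) / card A) powr (1 / r)) powr r \<le> (sum f A / card A) powr r"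
    using assms by (intro powr_mono2) auto
  then show ?thesis
    using assms by (simp add: powr_powr sum_nonneg)
qed

text \<open>Convexity of \<open>t\<^sup>p\<close> at the point \<open>a/(a+b) \<cdot> (s/a) + b/(a+b) \<cdot> (t/b)\<close>.  Summed over the
  coordinates with \<open>a\<close> and \<open>b\<close> close to the two norms it is the triangle inequality, and it
  serves for \<open>\<ell>\<^sub>p\<close> and for \<open>d(w,p)\<close> alike.\<close>

lemma powr_add_le_weighted:
  fixes s t a b p :: real
  assumes "1 \<le> p" "0 \<le> s" "0 \<le> t" "0 < a" "0 < b"
  shows "(s + t) powr p
    \<le> (a + b) powr p * (a / (a + b) * (s powr p / a powr p) + b / (a + b) * (t powr p / b powr p))"
proof -
  have e: "1 - b / (a + b) = a / (a + b)"
    using assms by (simp add: field_simps)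
  have "((1 - b / (a + b)) *\<^sub>R (s / a) + (b / (a + b)) *\<^sub>R (t / b)) powr p
     \<le> (1 - b / (a + b)) * (s / a) powr p + (b / (a + b)) * (t / b) powr p"
    by (rule convex_onD[OF convex_on_powr]) (use assms in auto)
  moreover have "(1 - b / (a + b)) *\<^sub>R (s / a) + (b / (a + b)) *\<^sub>R (t / b) = (s + t) / (a + b)"
    unfolding e using assms by (simp add: add_divide_distrib)
  ultimately have "((s + t) / (a + b)) powr p \<le> a / (a + b) * (s powr p / a powr p) + b / (a + b) * (t powr p / b powr p)"
    unfolding e using assms by (simp add: powr_divide)
  then have "(a + b) powr p * ((s + t) / (a + b)) powr p \<le> (a + b) powr p * (a / (a + b) * (s powr p / a powr p) + b / (a + b) * (t powr p / b powr p))"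
    by (intro mult_left_mono) auto
  moreover have "(a + b) powr p * ((s + t) / (a + b)) powr p = (s + t) powr p"
    using assms by (simp flip: powr_mult)
  ultimately show ?thesis by simp
qed

lemma powr_le_powr_imp_le:
  fixes x y p :: real
  assumes "x powr p \<le> y powr p" "0 < p" "0 \<le> y"
  shows "x \<le> y"
proof (rule ccontr)
  assume "\<not> x \<le> y"
  then have "y powr p < x powr p"
    using assms by (intro powr_less_mono2) auto
  then show False using assms by simp
qed

section \<open>The Lorentz norm through finite partial rearrangements\<close>

lemma inj_on_finite_extends_to_bij:
  fixes F :: "nat \<Rightarrow> nat"
  assumes "finite D" "inj_on F D"
  obtains \<pi> where "bij \<pi>" "\<And>n. n \<in> D \<Longrightarrow> \<pi> n = F n"
proof -
  have "infinite (- D)" "infinite (- F ` D)"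
    using assms by (simp_all add: Compl_eq_Diff_UNIV)
  then have "bij_betw (to_nat_on (- D)) (- D) UNIV" "bij_betw (from_nat_into (- F ` D)) UNIV (- F ` D)"
    by (auto intro: to_nat_on_infinite bij_betw_from_nat_into)
  then have g: "bij_betw (from_nat_into (- F ` D) \<circ> to_nat_on (- D)) (- D) (- F ` D)"
    by (rule bij_betw_trans)
  define \<pi> where "\<pi> n = (if n \<in> D then F n else (from_nat_into (- F ` D) \<circ> to_nat_on (- D)) n)" for n
  have "bij_betw \<pi> D (F ` D)"
    using assms by (auto simp: bij_betw_def \<pi>_def inj_on_def)
  moreover have "bij_betw \<pi> (- D) (- F ` D)"
    using g by (rule bij_betw_cong[THEN iffD1, rotated]) (auto simp: \<pi>_def)
  ultimately have "bij_betw \<pi> (D \<union> - D) (F ` D \<union> - F ` D)"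
    by (rule bij_betw_combine) auto
  then show ?thesis
    by (intro that[of \<pi>]) (auto simp: \<pi>_def)
qed

locale lorentz =
  fixes w :: "nat \<Rightarrow> real" and p :: real
  assumes p: "1 \<le> p" and w: "w \<in> weights"
begin

lemma w_pos: "0 < w n"
  using w by (auto simp: weights_def)

lemma w_nonneg: "0 \<le> w n"
  using w_pos[of n] by simp

lemma w_0: "w 0 = 1"
  using w by (auto simp: weights_def)

lemma w_antimono: "m \<le> n \<Longrightarrow> w n \<le> w m"
  using w by (auto simp: weights_def decseq_def)

lemma w_le_1: "w n \<le> 1"
  using w_antimono[of 0 n] w_0 by simp

lemma p_pos: "0 < p"
  using p by simp

abbreviation X :: "(nat \<Rightarrow> 'a::{real_normed_field,real_inner}) set" where
  "X \<equiv> lorentz_space w p"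

abbreviation nm :: "(nat \<Rightarrow> 'a::{real_normed_field,real_inner}) \<Rightarrow> real" where
  "nm \<equiv> lorentz_norm w p"

lemma nm_nonneg: "0 \<le> nm a"
  by (simp add: lorentz_norm_def)

lemma nm_powr: "nm a powr p = enn2real (lorentz_sup w p a)"
  using p_pos by (simp add: lorentz_norm_def powr_powr)

lemma rearranged_sum_le:
  fixes a :: "nat \<Rightarrow> 'a::{real_normed_field,real_inner}"
  assumes a: "a \<in> X" and D: "finite D" "inj_on F D"
  shows "(\<Sum>n\<in>D. norm (a (F n)) powr p * w n) \<le> nm a powr p"
proof -
  obtain \<pi> where \<pi>: "bij \<pi>" "\<And>n. n \<in> D \<Longrightarrow> \<pi> n = F n"
    using inj_on_finite_extends_to_bij[OF D] by blast
  have "ennreal (\<Sum>n\<in>D. norm (a (F n)) powr p * w n) = (\<Sum>n\<in>D. ennreal (norm (a (\<pi> n)) powr p * w n))"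
    using \<pi> by (simp add: sum_ennreal w_nonneg)
  also have "\<dots> \<le> (\<Sum>n. ennreal (norm (a (\<pi> n)) powr p * w n))"
    by (rule sum_le_suminf) (use D in auto)
  also have "\<dots> \<le> lorentz_sup w p a"
    unfolding lorentz_sup_def by (rule SUP_upper) (use \<pi> in auto)
  finally have "enn2real (ennreal (\<Sum>n\<in>D. norm (a (F n)) powr p * w n)) \<le> enn2real (lorentz_sup w p a)"
    by (rule enn2real_mono) (use a in \<open>simp add: lorentz_space_def\<close>)
  then show ?thesis
    by (simp add: nm_powr sum_nonneg w_nonneg)
qed

lemma lorentzI:
  fixes a :: "nat \<Rightarrow> 'a::{real_normed_field,real_inner}"
  assumes le: "\<And>q F. inj_on F {..<q} \<Longrightarrow> (\<Sum>n<q. norm (a (F n)) powr p * w n) \<le> C powr p" and "0 \<le> C"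
  shows "a \<in> X" "nm a \<le> C"
proof -
  have "lorentz_sup w p a \<le> ennreal (C powr p)"
    unfolding lorentz_sup_def
  proof (rule SUP_least)
    fix \<pi> :: "nat \<Rightarrow> nat" assume "\<pi> \<in> {\<pi>. bij \<pi>}"
    then have "inj_on \<pi> {..<q}" for q
      using bij_is_inj inj_on_subset by blast
    then have "(\<Sum>n<q. norm (a (\<pi> n)) powr p * w n) \<le> C powr p" for q
      by (rule le)
    then have "(\<Sum>n<q. ennreal (norm (a (\<pi> n)) powr p * w n)) \<le> ennreal (C powr p)" for q
      by (simp add: sum_ennreal w_nonneg)
    then show "(\<Sum>n. ennreal (norm (a (\<pi> n)) powr p * w n)) \<le> ennreal (C powr p)"
      by (intro suminf_le_const) auto
  qed
  moreover from this show "a \<in> X"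
    by (simp add: lorentz_space_def) (metis ennreal_less_top le_less_trans)
  ultimately have "nm a powr p \<le> C powr p"
    by (simp add: nm_powr enn2real_leI)
  then show "nm a \<le> C"
    using powr_le_cancel_iff p_pos assms(2) nm_nonneg[of a]
    by (meson not_le powr_less_mono2)
qed

lemma rearranged_sum_approx:
  fixes a :: "nat \<Rightarrow> 'a::{real_normed_field,real_inner}"
  assumes "0 \<le> C" "C < nm a"
  obtains q F where "inj_on F {..<q}" "C powr p < (\<Sum>n<q. norm (a (F n)) powr p * w n)"
  using lorentzI(2)[of a C] assms by (meson not_le)

lemma norm_le_nm:
  fixes a :: "nat \<Rightarrow> 'a::{real_normed_field,real_inner}"
  assumes "a \<in> X"
  shows "norm (a j) \<le> nm a"
proof -
  have "norm (a j) powr p \<le> nm a powr p"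
    using rearranged_sum_le[OF assms, of "{0}" "\<lambda>_. j"] by (simp add: w_0)
  then show ?thesis
    using p_pos nm_nonneg[of a] by (meson not_le powr_less_mono2 norm_ge_zero)
qed

lemma lorentz_mono:
  fixes a b :: "nat \<Rightarrow> 'a::{real_normed_field,real_inner}"
  assumes b: "b \<in> X" and le: "\<And>n. norm (a n) \<le> norm (b n)"
  shows "a \<in> X" "nm a \<le> nm b"
proof -
  have "(\<Sum>n<q. norm (a (F n)) powr p * w n) \<le> nm b powr p" if "inj_on F {..<q}" for q F
  proof -
    have "(\<Sum>n<q. norm (a (F n)) powr p * w n) \<le> (\<Sum>n<q. norm (b (F n)) powr p * w n)"
      using p_pos by (intro sum_mono mult_right_mono powr_mono2 le) (auto simp: w_nonneg)
    also have "\<dots> \<le> nm b powr p"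
      by (rule rearranged_sum_le[OF b _ that]) simp
    finally show ?thesis .
  qed
  then show "a \<in> X" "nm a \<le> nm b"
    using lorentzI[of a "nm b"] nm_nonneg by blast+
qed

lemma zero_in_X: "(0 :: nat \<Rightarrow> 'a::{real_normed_field,real_inner}) \<in> X" and nm_zero: "nm (0 :: nat \<Rightarrow> 'a) = 0"
  using lorentzI[of "0 :: nat \<Rightarrow> 'a" 0] nm_nonneg[of "0 :: nat \<Rightarrow> 'a"] p_pos by auto

lemma nm_eq_0:
  fixes a :: "nat \<Rightarrow> 'a::{real_normed_field,real_inner}"
  assumes "a \<in> X" "nm a = 0"
  shows "a = 0"
  using norm_le_nm[OF assms(1)] assms(2) by (auto simp: fun_eq_iff)

lemma add_in_X:
  fixes a b :: "nat \<Rightarrow> 'a::{real_normed_field,real_inner}"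
  assumes "a \<in> X" "b \<in> X"
  shows "a + b \<in> X" "nm (a + b) \<le> nm a + nm b"
proof -
  have *: "a + b \<in> X \<and> nm (a + b) \<le> (nm a + e) + (nm b + e)" if e: "0 < e" for e
  proof -
    define s where "s = nm a + e"
    define t where "t = nm b + e"
    have st: "0 < s" "0 < t" "nm a \<le> s" "nm b \<le> t"
      using e nm_nonneg[of a] nm_nonneg[of b] by (auto simp: s_def t_def)
    have "(\<Sum>n<q. norm ((a + b) (F n)) powr p * w n) \<le> (s + t) powr p" if F: "inj_on F {..<q}" for q F
    proof -
      let ?a = "\<lambda>n. norm (a (F n)) powr p" and ?b = "\<lambda>n. norm (b (F n)) powr p"
      have "norm ((a + b) (F n)) powr p \<le> (s + t) powr p * (s / (s + t) * (?a n / s powr p) + t / (s + t) * (?b n / t powr p))" for n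
      proof -
        have "norm ((a + b) (F n)) powr p \<le> (norm (a (F n)) + norm (b (F n))) powr p"
          using p_pos by (intro powr_mono2) (auto intro: norm_triangle_ineq)
        also have "\<dots> \<le> (s + t) powr p * (s / (s + t) * (?a n / s powr p) + t / (s + t) * (?b n / t powr p))"
          by (rule powr_add_le_weighted[OF p]) (use st in auto)
        finally show ?thesis .
      qed
      then have "(\<Sum>n<q. norm ((a + b) (F n)) powr p * w n)
         \<le> (\<Sum>n<q. ((s + t) powr p * (s / (s + t) * (?a n / s powr p) + t / (s + t) * (?b n / t powr p))) * w n)"
        by (intro sum_mono mult_right_mono) (auto simp: w_nonneg)
      also have "\<dots> = (s + t) powr p * (s / (s + t) * ((\<Sum>n<q. ?a n * w n) / s powr p) + t / (s + t) * ((\<Sum>n<q. ?b n * w n) / t powr p))"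
        by (simp add: sum_distrib_left sum_divide_distrib sum.distrib algebra_simps)
      also have "\<dots> \<le> (s + t) powr p * (s / (s + t) * 1 + t / (s + t) * 1)"
      proof (intro mult_left_mono add_mono)
        have "(\<Sum>n<q. ?a n * w n) \<le> s powr p"
          using rearranged_sum_le[OF assms(1) _ F] powr_mono2[OF _ _ st(3), of p] p_pos nm_nonneg[of a] by auto
        then show "(\<Sum>n<q. ?a n * w n) / s powr p \<le> 1"
          using st by simp
        have "(\<Sum>n<q. ?b n * w n) \<le> t powr p"
          using rearranged_sum_le[OF assms(2) _ F] powr_mono2[OF _ _ st(4), of p] p_pos nm_nonneg[of b] by auto
        then show "(\<Sum>n<q. ?b n * w n) / t powr p \<le> 1"
          using st by simp
      qed (use st in auto)
      also have "\<dots> = (s + t) powr p"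
        using st by (simp flip: add_divide_distrib)
      finally show ?thesis .
    qed
    then show ?thesis
      using lorentzI[of "a + b" "s + t"] st by (auto simp: s_def t_def)
  qed
  from *[of 1] show "a + b \<in> X" by simp
  show "nm (a + b) \<le> nm a + nm b"
  proof (rule field_le_epsilon)
    fix e :: real assume "0 < e"
    then show "nm (a + b) \<le> nm a + nm b + e"
      using *[of "e / 2"] by simp
  qed
qed

lemma scale_in_X:
  fixes a :: "nat \<Rightarrow> 'a::{real_normed_field,real_inner}"
  assumes "a \<in> X"
  shows "seq_scale c a \<in> X" "nm (seq_scale c a) = norm c * nm a"
proof -
  have *: "seq_scale c a \<in> X \<and> nm (seq_scale c a) \<le> norm c * nm a" if "a \<in> X" for c and a :: "nat \<Rightarrow> 'a"
  proof -
    have "(\<Sum>n<q. norm (seq_scale c a (F n)) powr p * w n) \<le> (norm c * nm a) powr p" if F: "inj_on F {..<q}" for q F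
    proof -
      have "(\<Sum>n<q. norm (seq_scale c a (F n)) powr p * w n) = norm c powr p * (\<Sum>n<q. norm (a (F n)) powr p * w n)"
        by (simp add: seq_scale_def norm_mult powr_mult sum_distrib_left mult_ac)
      also have "\<dots> \<le> norm c powr p * nm a powr p"
        by (intro mult_left_mono rearranged_sum_le[OF \<open>a \<in> X\<close> _ F]) auto
      finally show ?thesis
        by (simp add: powr_mult nm_nonneg)
    qed
    then show ?thesis
      using lorentzI[of "seq_scale c a" "norm c * nm a"] nm_nonneg[of a] by auto
  qed
  then show 1: "seq_scale c a \<in> X" using assms by blast
  have "norm c * nm a \<le> nm (seq_scale c a)"
  proof (cases "c = 0")
    case False
    have "seq_scale (inverse c) (seq_scale c a) = a"
      using False by (simp add: seq_scale_def fun_eq_iff)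
    then have "nm a \<le> inverse (norm c) * nm (seq_scale c a)"
      using *[OF 1, of "inverse c"] by (simp add: norm_inverse)
    then show ?thesis
      using False by (simp add: field_simps)
  qed (simp add: nm_nonneg)
  then show "nm (seq_scale c a) = norm c * nm a"
    using *[OF assms, of c] by simp
qed

lemma subspace_X: "seq.subspace (X :: (nat \<Rightarrow> 'a::{real_normed_field,real_inner}) set)"
  unfolding seq.subspace_def using zero_in_X add_in_X scale_in_X by blast

lemma nm_minus:
  fixes a :: "nat \<Rightarrow> 'a::{real_normed_field,real_inner}"
  shows "nm (- a) = nm a"
  by (simp add: lorentz_norm_def lorentz_sup_def)

lemma diff_in_X:
  fixes a b :: "nat \<Rightarrow> 'a::{real_normed_field,real_inner}"
  assumes "a \<in> X" "b \<in> X"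
  shows "a - b \<in> X" "nm (a - b) \<le> nm a + nm b"
proof -
  have "- b \<in> X" using assms(2) lorentz_mono(1)[of b "- b"] by simp
  then show "a - b \<in> X" "nm (a - b) \<le> nm a + nm b"
    using add_in_X[OF assms(1), of "- b"] by (simp_all add: nm_minus)
qed

end

section \<open>Partial sums of the weights\<close>

context lorentz
begin

lemma W_mono: "m \<le> n \<Longrightarrow> W_sum w m \<le> W_sum w n"
  unfolding W_sum_def by (intro sum_mono2) (auto simp: w_nonneg)

lemma W_nonneg: "0 \<le> W_sum w n"
  unfolding W_sum_def by (intro sum_nonneg) (auto simp: w_nonneg)

lemma W_1: "W_sum w 1 = 1"
  by (simp add: W_sum_def w_0)

lemma W_ge_1: "1 \<le> n \<Longrightarrow> 1 \<le> W_sum w n"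
  using W_mono[of 1 n] W_1 by simp

lemma W_pos: "1 \<le> n \<Longrightarrow> 0 < W_sum w n"
  using W_ge_1[of n] by simp

lemma W_unbounded: "\<exists>k. \<forall>n\<ge>k. C < W_sum w n"
proof (rule ccontr)
  assume "\<not> ?thesis"
  then have "W_sum w k \<le> C" for k
    using W_mono by (meson le_less_trans not_le)
  then have "summable w"
    by (intro summableI_nonneg_bounded[of w C]) (auto simp: w_nonneg W_sum_def)
  then show False
    using w by (simp add: weights_def w_nonneg)
qed

lemma sum_w_le_W:
  assumes "finite D"
  shows "(\<Sum>n\<in>D. w n) \<le> W_sum w (card D)"
  using assms
proof (induction D rule: finite_linorder_max_induct)
  case (insert b A)
  then have "A \<subseteq> {..<b}" by auto
  then have "card A \<le> b"
    using card_mono[of "{..<b}" A] by simp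
  then have "w b \<le> w (card A)"
    by (rule w_antimono)
  moreover have "b \<notin> A" using insert by auto
  ultimately show ?case
    using insert by (simp add: W_sum_def)
qed (simp add: W_sum_def)

end

lemma mean_of_null_sequence_small:
  fixes v :: "nat \<Rightarrow> real" and e :: real
  assumes v: "v \<longlonglongrightarrow> 0" and "0 < e"
  shows "\<exists>n0. \<forall>n\<ge>n0. (\<Sum>i<n. v i) \<le> e * n"
proof -
  obtain m where m: "\<And>i. m \<le> i \<Longrightarrow> norm (v i) < e / 2"
    using LIMSEQ_D[OF v, of "e / 2"] \<open>0 < e\<close> by auto
  define A where "A = \<bar>\<Sum>i<m. v i\<bar>"
  obtain n1 where n1: "2 * A / e \<le> real n1"
    using real_arch_simple by blast
  show ?thesis
  proof (intro exI allI impI)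
    fix n assume n: "m + n1 \<le> n"
    have "(\<Sum>i<n. v i) = (\<Sum>i<m. v i) + (\<Sum>i\<in>{m..<n}. v i)"
      using n by (simp add: lessThan_atLeast0 sum.atLeastLessThan_concat)
    also have "(\<Sum>i\<in>{m..<n}. v i) \<le> (\<Sum>i\<in>{m..<n}. e / 2)"
      by (intro sum_mono) (use m in force)
    also have "\<dots> \<le> e / 2 * n"
      using \<open>0 < e\<close> by (simp add: mult_left_mono)
    also have "(\<Sum>i<m. v i) \<le> A"
      by (simp add: A_def)
    also have "A \<le> e / 2 * n"
    proof -
      have "2 * A / e \<le> real n" using n1 n by linarith
      then show ?thesis using \<open>0 < e\<close> by (simp add: field_simps)
    qed
    finally show "(\<Sum>i<n. v i) \<le> e * n"
      by (simp add: algebra_simps)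
  qed
qed

section \<open>Indicators and tails\<close>

context lorentz
begin

lemma flat_in_X:
  fixes a :: "nat \<Rightarrow> 'a::{real_normed_field,real_inner}"
  assumes S: "finite S" and "0 \<le> \<alpha>" and le: "\<And>j. norm (a j) \<le> (if j \<in> S then \<alpha> else 0)"
  shows "a \<in> X" "nm a powr p \<le> \<alpha> powr p * W_sum w (card S)"
proof -
  define C where "C = (\<alpha> powr p * W_sum w (card S)) powr (1 / p)"
  have C: "C powr p = \<alpha> powr p * W_sum w (card S)" "0 \<le> C"
    using p_pos W_nonneg by (auto simp: C_def powr_powr)
  have "(\<Sum>n<q. norm (a (F n)) powr p * w n) \<le> C powr p" if F: "inj_on F {..<q}" for q F
  proof -
    let ?D = "{n\<in>{..<q}. F n \<in> S}"
    have zero: "norm (a j) = 0" if "j \<notin> S" for j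
      using le[of j] that by simp
    have "(\<Sum>n<q. norm (a (F n)) powr p * w n) = (\<Sum>n\<in>?D. norm (a (F n)) powr p * w n)"
      using p_pos zero by (intro sum.mono_neutral_right) auto
    also have "\<dots> \<le> (\<Sum>n\<in>?D. \<alpha> powr p * w n)"
    proof (intro sum_mono mult_right_mono powr_mono2)
      fix n assume "n \<in> ?D"
      then show "norm (a (F n)) \<le> \<alpha>" using le[of "F n"] by simp
    qed (use p_pos w_nonneg in auto)
    also have "\<dots> = \<alpha> powr p * (\<Sum>n\<in>?D. w n)"
      by (simp add: sum_distrib_left)
    also have "\<dots> \<le> \<alpha> powr p * W_sum w (card ?D)"
      by (intro mult_left_mono sum_w_le_W) auto
    also have "\<dots> \<le> \<alpha> powr p * W_sum w (card S)"
    proof (intro mult_left_mono W_mono)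
      have "inj_on F ?D" using F by (auto simp: inj_on_def)
      then show "card ?D \<le> card S"
        using S by (intro card_inj_on_le[of F]) auto
    qed auto
    finally show ?thesis using C by simp
  qed
  then show "a \<in> X" "nm a powr p \<le> \<alpha> powr p * W_sum w (card S)"
    using lorentzI[of a C] C powr_mono2[of p "nm a" C] p_pos nm_nonneg[of a] by auto
qed

lemma nm_powr_ge_on_set:
  fixes a :: "nat \<Rightarrow> 'a::{real_normed_field,real_inner}"
  assumes a: "a \<in> X" and S: "finite S" "0 \<le> \<alpha>" and ge: "\<And>j. j \<in> S \<Longrightarrow> \<alpha> \<le> norm (a j)"
  shows "\<alpha> powr p * W_sum w (card S) \<le> nm a powr p"
proof -
  obtain F where F: "bij_betw F {..<card S} S"
    using ex_bij_betw_nat_finite[OF S(1)] by (auto simp: atLeast0LessThan)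
  have "\<alpha> powr p * W_sum w (card S) = (\<Sum>n<card S. \<alpha> powr p * w n)"
    by (simp add: W_sum_def sum_distrib_left)
  also have "\<dots> \<le> (\<Sum>n<card S. norm (a (F n)) powr p * w n)"
  proof (intro sum_mono mult_right_mono powr_mono2)
    fix n assume "n \<in> {..<card S}"
    then have "F n \<in> S" using F by (auto simp: bij_betw_def)
    then show "\<alpha> \<le> norm (a (F n))" by (rule ge)
  qed (use p_pos w_nonneg S in auto)
  also have "\<dots> \<le> nm a powr p"
    by (rule rearranged_sum_le[OF a]) (use F in \<open>auto simp: bij_betw_def\<close>)
  finally show ?thesis .
qed

lemma unit_seq_in_X: "(unit_seq n :: nat \<Rightarrow> 'a::{real_normed_field,real_inner}) \<in> X"
  by (rule flat_in_X(1)[of "{n}" 1]) (auto simp: unit_seq_def)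

lemma finite_large_entries:
  fixes a :: "nat \<Rightarrow> 'a::{real_normed_field,real_inner}"
  assumes a: "a \<in> X" and "0 < \<delta>"
  shows "finite {j. \<delta> \<le> norm (a j)}"
proof (rule ccontr)
  assume inf: "infinite {j. \<delta> \<le> norm (a j)}"
  obtain k where k: "nm a powr p / \<delta> powr p < W_sum w k"
    using W_unbounded by blast
  obtain S where S: "finite S" "card S = k" "S \<subseteq> {j. \<delta> \<le> norm (a j)}"
    using infinite_arbitrarily_large[OF inf] by blast
  have "\<delta> powr p * W_sum w k \<le> nm a powr p"
    using nm_powr_ge_on_set[OF a S(1), of \<delta>] S \<open>0 < \<delta>\<close> by auto
  then show False
    using k \<open>0 < \<delta>\<close> by (simp add: field_simps)
qed

lemma rearranged_sum_close:
  fixes a :: "nat \<Rightarrow> 'a::{real_normed_field,real_inner}"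
  assumes "0 < \<eta>"
  obtains q F where "inj_on F {..<q}" "nm a powr p - \<eta> < (\<Sum>n<q. norm (a (F n)) powr p * w n)"
proof (cases "nm a powr p < \<eta>")
  case True
  then show ?thesis by (intro that[of id 0]) auto
next
  case False
  define C where "C = (nm a powr p - \<eta>) powr (1 / p)"
  have "C powr p = nm a powr p - \<eta>"
    using False p_pos by (simp add: C_def powr_powr)
  moreover have "C < nm a"
  proof (rule ccontr)
    assume "\<not> C < nm a"
    then have "nm a powr p \<le> C powr p"
      using p_pos nm_nonneg[of a] by (intro powr_mono2) auto
    then show False using calculation \<open>0 < \<eta>\<close> by simp
  qed
  moreover have "0 \<le> C" by (simp add: C_def)
  ultimately show ?thesis
    using rearranged_sum_approx[of C a] that by metis
qed

definition tail :: "nat \<Rightarrow> (nat \<Rightarrow> 'a::zero) \<Rightarrow> nat \<Rightarrow> 'a" where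
  "tail r a = (\<lambda>j. if j < r then 0 else a j)"

text \<open>The first \<open>q\<close> places of a rearrangement that nearly attains the norm of \<open>a\<close> use finitely many
  entries.  Far out, a tail cannot contribute more than \<open>\<eta>\<close> at the places from \<open>q\<close> on, as it
  could be appended to these entries; and at the first \<open>q\<close> places it is small because
  \<open>a\<close> tends to \<open>0\<close>.\<close>

lemma tail_small:
  fixes a :: "nat \<Rightarrow> 'a::{real_normed_field,real_inner}"
  assumes a: "a \<in> X" and "0 < e"
  shows "\<exists>r0. \<forall>r\<ge>r0. tail r a \<in> X \<and> nm (tail r a) \<le> e"
proof -
  define \<eta> where "\<eta> = e powr p / 2"
  have \<eta>: "0 < \<eta>" using \<open>0 < e\<close> by (simp add: \<eta>_def)
  obtain q F where F: "inj_on F {..<q}" "nm a powr p - \<eta> < (\<Sum>n<q. norm (a (F n)) powr p * w n)"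
    using rearranged_sum_close[OF \<eta>] by blast
  define \<delta> where "\<delta> = (\<eta> / (q + 1)) powr (1 / p)"
  have \<delta>: "0 < \<delta>" "\<delta> powr p = \<eta> / (q + 1)"
    using \<eta> p_pos by (auto simp: \<delta>_def powr_powr)
  obtain r1 where r1: "\<And>n. n < q \<Longrightarrow> F n < r1"
    using finite_nat_set_iff_bounded[of "F ` {..<q}"] by auto
  obtain r2 where r2: "\<And>j. r2 \<le> j \<Longrightarrow> norm (a j) < \<delta>"
    using finite_nat_set_iff_bounded[of "{j. \<delta> \<le> norm (a j)}"] finite_large_entries[OF a \<delta>(1)]
    by (meson linorder_not_le mem_Collect_eq)
  show ?thesis
  proof (intro exI allI impI)
    fix r assume r: "max r1 r2 \<le> r"
    have "(\<Sum>n<m. norm (tail r a (G n)) powr p * w n) \<le> e powr p" if G: "inj_on G {..<m}" for m G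
    proof -
      let ?t = "\<lambda>n. norm (tail r a (G n)) powr p * w n"
      let ?E = "{n\<in>{q..<m}. r \<le> G n}"
      have "(\<Sum>n<m. ?t n) = (\<Sum>n\<in>{..<m} \<inter> {..<q}. ?t n) + (\<Sum>n\<in>{..<m} - {..<q}. ?t n)"
        by (rule sum.Int_Diff) simp
      also have "(\<Sum>n\<in>{..<m} \<inter> {..<q}. ?t n) \<le> (\<Sum>n<q. \<eta> / (q + 1))"
      proof (rule order_trans[OF sum_mono2 sum_mono])
        fix n
        have "norm (tail r a (G n)) powr p \<le> \<delta> powr p"
          using r r2[of "G n"] \<delta>(1) p_pos by (intro powr_mono2) (auto simp: tail_def)
        then have "?t n \<le> \<delta> powr p * 1"
          by (intro mult_mono) (use w_le_1 w_nonneg in auto)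
        then show "?t n \<le> \<eta> / (q + 1)" using \<delta>(2) by simp
      qed (auto simp: w_nonneg)
      also have "\<dots> \<le> \<eta>"
        using \<eta> by (simp add: field_simps)
      also have "(\<Sum>n\<in>{..<m} - {..<q}. ?t n) = (\<Sum>n\<in>?E. norm (a (G n)) powr p * w n)"
        by (rule sum.mono_neutral_cong_right) (auto simp: tail_def)
      also have "\<dots> \<le> \<eta>"
      proof -
        define H where "H n = (if n < q then F n else G n)" for n
        have "inj_on H ({..<q} \<union> ?E)"
        proof (rule inj_onI)
          fix x y assume "x \<in> {..<q} \<union> ?E" "y \<in> {..<q} \<union> ?E" "H x = H y"
          then show "x = y"
            using r1[of x] r1[of y] r F(1) G by (auto simp: H_def inj_on_def split: if_splits)
        qed
        then have "(\<Sum>n\<in>{..<q} \<union> ?E. norm (a (H n)) powr p * w n) \<le> nm a powr p"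
          by (intro rearranged_sum_le[OF a]) auto
        also have "(\<Sum>n\<in>{..<q} \<union> ?E. norm (a (H n)) powr p * w n)
            = (\<Sum>n<q. norm (a (H n)) powr p * w n) + (\<Sum>n\<in>?E. norm (a (H n)) powr p * w n)"
          by (rule sum.union_disjoint) auto
        also have "(\<Sum>n<q. norm (a (H n)) powr p * w n) = (\<Sum>n<q. norm (a (F n)) powr p * w n)"
          by (simp add: H_def)
        also have "(\<Sum>n\<in>?E. norm (a (H n)) powr p * w n) = (\<Sum>n\<in>?E. norm (a (G n)) powr p * w n)"
          by (intro sum.cong) (auto simp: H_def)
        finally show ?thesis using F(2) by simp
      qed
      finally show ?thesis by (simp add: \<eta>_def)
    qed
    then show "tail r a \<in> X \<and> nm (tail r a) \<le> e"
      using lorentzI[of "tail r a" e] \<open>0 < e\<close> by auto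
  qed
qed

end

section \<open>Normed sequence spaces and their linear homeomorphisms\<close>

locale seq_norm =
  fixes V :: "(nat \<Rightarrow> 'a::{real_normed_field,real_inner}) set" and nrm :: "(nat \<Rightarrow> 'a) \<Rightarrow> real"
  assumes subspace: "seq.subspace V"
    and nonneg: "0 \<le> nrm x"
    and minus: "nrm (- x) = nrm x"
    and zero: "nrm 0 = 0"
    and eq_0: "x \<in> V \<Longrightarrow> nrm x = 0 \<Longrightarrow> x = 0"
    and triangle: "x \<in> V \<Longrightarrow> y \<in> V \<Longrightarrow> nrm (x + y) \<le> nrm x + nrm y"
    and scale: "x \<in> V \<Longrightarrow> nrm (seq_scale c x) = norm c * nrm x"
begin

lemma diff_mem: "x \<in> V \<Longrightarrow> y \<in> V \<Longrightarrow> x - y \<in> V"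
  using seq.subspace_diff[OF subspace] .

lemma metric: "Metric_space V (\<lambda>x y. nrm (x - y))"
proof
  fix x y z :: "nat \<Rightarrow> 'a"
  show "0 \<le> nrm (x - y)" by (rule nonneg)
  show "nrm (x - y) = nrm (y - x)"
    using minus[of "x - y"] by simp
  show "nrm (x - y) = 0 \<longleftrightarrow> x = y" if "x \<in> V" "y \<in> V"
    using eq_0[OF diff_mem[OF that]] zero by auto
  show "nrm (x - z) \<le> nrm (x - y) + nrm (y - z)" if "x \<in> V" "y \<in> V" "z \<in> V"
    using triangle[of "x - y" "y - z"] diff_mem that by simp
qed

lemma restrict: "seq.subspace U \<Longrightarrow> U \<subseteq> V \<Longrightarrow> seq_norm U nrm"
  by unfold_locales (auto intro: nonneg minus zero eq_0 triangle scale simp: minus scale zero subset_iff)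

lemma zero_mem: "0 \<in> V"
  by (rule seq.subspace_0[OF subspace])

end

lemma linear_on_zero:
  assumes "linear_on V T" "seq.subspace V"
  shows "T 0 = 0"
proof -
  have "T (0 + 0) = T 0 + T 0"
    using assms seq.subspace_0 unfolding linear_on_def by blast
  then show ?thesis by simp
qed

lemma linear_on_sum:
  fixes T :: "(nat \<Rightarrow> 'a::{real_normed_field,real_inner}) \<Rightarrow> nat \<Rightarrow> 'a" and I :: "'i set"
  assumes T: "linear_on V T" and V: "seq.subspace V" and "finite I" and y: "\<And>n. n \<in> I \<Longrightarrow> y n \<in> V"
  shows "T (\<Sum>n\<in>I. seq_scale (c n) (y n)) = (\<Sum>n\<in>I. seq_scale (c n) (T (y n)))"
  using \<open>finite I\<close> y
proof (induction I rule: finite_induct)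
  case empty
  then show ?case using linear_on_zero[OF T V] by (simp only: sum.empty)
next
  case (insert n I)
  have "(\<Sum>n\<in>I. seq_scale (c n) (y n)) \<in> V" "seq_scale (c n) (y n) \<in> V"
    by (intro seq.subspace_sum[OF V] seq.subspace_scale[OF V] insert.prems insertI1 insertI2; assumption)+
  then have "T (seq_scale (c n) (y n) + (\<Sum>n\<in>I. seq_scale (c n) (y n))) =
      seq_scale (c n) (T (y n)) + T (\<Sum>n\<in>I. seq_scale (c n) (y n))"
    using T insert.prems unfolding linear_on_def by auto
  moreover have "T (\<Sum>n\<in>I. seq_scale (c n) (y n)) = (\<Sum>n\<in>I. seq_scale (c n) (T (y n)))"
    using insert.IH insert.prems by blast
  ultimately show ?case
    by (simp only: sum.insert[OF insert.hyps])
qed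

text \<open>Rescaling.  Here \<open>f\<close> is the norm of the image under a linear map and \<open>g\<close> the norm of the argument;
  with the roles exchanged, the lemma bounds the inverse map.\<close>

lemma homogeneous_bound:
  fixes f g :: "(nat \<Rightarrow> 'a::{real_normed_field,real_inner}) \<Rightarrow> real"
  assumes V: "seq.subspace V" and "0 < \<delta>"
    and small: "\<And>x. x \<in> V \<Longrightarrow> g x < \<delta> \<Longrightarrow> f x < 1"
    and nonneg: "\<And>x. x \<in> V \<Longrightarrow> 0 \<le> g x"
    and f: "\<And>c x. x \<in> V \<Longrightarrow> f (seq_scale c x) = norm c * f x"
    and g: "\<And>c x. x \<in> V \<Longrightarrow> g (seq_scale c x) = norm c * g x"
    and x: "x \<in> V"
  shows "f x \<le> 2 / \<delta> * g x"
proof -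
  have main: "f x \<le> 2 / \<delta> * s" if s: "0 < s" "g x \<le> s" for s
  proof -
    define c where "c = of_real (\<delta> / (2 * s)) * (1::'a)"
    have c: "norm c = \<delta> / (2 * s)"
      using \<open>0 < \<delta>\<close> s by (simp add: c_def del: of_real_divide)
    have "\<delta> / (2 * s) * g x \<le> \<delta> / (2 * s) * s"
      using s \<open>0 < \<delta>\<close> by (intro mult_left_mono) auto
    also have "\<dots> < \<delta>" using s \<open>0 < \<delta>\<close> by simp
    finally have "g (seq_scale c x) < \<delta>" by (simp add: g[OF x] c)
    then have "f (seq_scale c x) < 1"
      using small seq.subspace_scale[OF V x] by blast
    then have "\<delta> / (2 * s) * f x < 1" by (simp add: f[OF x] c)
    then show ?thesis using s \<open>0 < \<delta>\<close> by (simp add: field_simps)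
  qed
  show ?thesis
  proof (rule field_le_epsilon)
    fix e :: real assume e: "0 < e"
    have "f x \<le> 2 / \<delta> * (g x + \<delta> * e / 2)"
      by (rule main) (use e \<open>0 < \<delta>\<close> nonneg[OF x] in \<open>auto intro: add_nonneg_pos\<close>)
    also have "\<dots> = 2 / \<delta> * g x + e"
      using \<open>0 < \<delta>\<close> by (simp add: field_simps)
    finally show "f x \<le> 2 / \<delta> * g x + e" .
  qed
qed

lemma linear_homeomorphism_bounds:
  fixes V W :: "(nat \<Rightarrow> 'a::{real_normed_field,real_inner}) set"
  assumes V: "seq_norm V nV" and W: "seq_norm W nW"
    and T: "linear_on V T" and hom: "homeomorphic_map (norm_topology V nV) (norm_topology W nW) T"
  obtains K where "0 < K" "bij_betw T V W" "\<And>x. x \<in> V \<Longrightarrow> nW (T x) \<le> K * nV x"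
    "\<And>x. x \<in> V \<Longrightarrow> nV x \<le> K * nW (T x)"
proof -
  interpret V: seq_norm V nV by fact
  interpret W: seq_norm W nW by fact
  interpret MV: Metric_space V "\<lambda>x y. nV (x - y)" by (rule V.metric)
  interpret MW: Metric_space W "\<lambda>x y. nW (x - y)" by (rule W.metric)
  have T0: "T 0 = 0" by (rule linear_on_zero[OF T V.subspace])
  obtain g where g: "homeomorphic_maps MV.mtopology MW.mtopology T g"
    using hom unfolding norm_topology_def homeomorphic_map_maps by blast
  have contT: "continuous_map MV.mtopology MW.mtopology T" and contg: "continuous_map MW.mtopology MV.mtopology g"
    and gT: "\<And>x. x \<in> V \<Longrightarrow> g (T x) = x" and Tg: "\<And>y. y \<in> W \<Longrightarrow> T (g y) = y"
    using g unfolding homeomorphic_maps_def by auto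
  have TW: "T ` V \<subseteq> W" and "\<exists>\<delta>>0. \<forall>x. x \<in> V \<and> nV (0 - x) < \<delta> \<longrightarrow> nW (T 0 - T x) < 1"
    using contT V.zero_mem unfolding MV.metric_continuous_map[OF W.metric] by auto
  then obtain d1 where d1: "0 < d1" "\<And>x. x \<in> V \<Longrightarrow> nV x < d1 \<Longrightarrow> nW (T x) < 1"
    by (auto simp: T0 V.minus W.minus)
  have gV: "g ` W \<subseteq> V" and "\<exists>\<delta>>0. \<forall>y. y \<in> W \<and> nW (0 - y) < \<delta> \<longrightarrow> nV (g 0 - g y) < 1"
    using contg W.zero_mem unfolding MW.metric_continuous_map[OF V.metric] by auto
  moreover have "g 0 = 0" using gT[OF V.zero_mem] T0 by simp
  ultimately obtain d2 where d2: "0 < d2" "\<And>y. y \<in> W \<Longrightarrow> nW y < d2 \<Longrightarrow> nV (g y) < 1"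
    by (auto simp: V.minus W.minus)
  have Ts: "T (seq_scale c x) = seq_scale c (T x)" if "x \<in> V" for c x
    using T that unfolding linear_on_def by blast
  have hs: "nW (T (seq_scale c x)) = norm c * nW (T x)" if "x \<in> V" for c x
    using Ts[OF that] W.scale TW that by auto
  have b1: "nW (T x) \<le> 2 / d1 * nV x" if "x \<in> V" for x
    using homogeneous_bound[OF V.subspace d1(1), of nV "\<lambda>x. nW (T x)" x] d1(2) hs V.scale V.nonneg that by blast
  have small2: "nV x < 1" if "x \<in> V" "nW (T x) < d2" for x
    using d2(2)[of "T x"] TW gT that by auto
  have b2: "nV x \<le> 2 / d2 * nW (T x)" if "x \<in> V" for x
    using homogeneous_bound[OF V.subspace d2(1), of "\<lambda>x. nW (T x)" nV x] small2 hs V.scale W.nonneg that by blast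
  show ?thesis
  proof
    show "0 < max (2 / d1) (2 / d2)" using d1(1) by (simp add: less_max_iff_disj)
    show "bij_betw T V W"
      using TW gV gT Tg by (intro bij_betwI[of T V W g]) auto
    show "nW (T x) \<le> max (2 / d1) (2 / d2) * nV x" if "x \<in> V" for x
      using b1[OF that] mult_right_mono[OF max.cobounded1, of "nV x" "2 / d1" "2 / d2"] V.nonneg[of x] by linarith
    show "nV x \<le> max (2 / d1) (2 / d2) * nW (T x)" if "x \<in> V" for x
      using b2[OF that] mult_right_mono[OF max.cobounded2, of "nW (T x)" "2 / d2" "2 / d1"] W.nonneg[of "T x"] by linarith
  qed
qed

lemma (in lorentz) seq_norm_X: "seq_norm (X :: (nat \<Rightarrow> 'a::{real_normed_field,real_inner}) set) nm"
  by unfold_locales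
    (use subspace_X nm_nonneg nm_minus nm_zero nm_eq_0 add_in_X(2) scale_in_X(2) in auto)

section \<open>The partition of the indices into blocks\<close>

lemma sum_fun_apply: "(\<Sum>i\<in>A. f i) x = (\<Sum>i\<in>A. f i x)"
  for f :: "'b \<Rightarrow> 'c \<Rightarrow> 'd::comm_monoid_add"
  by (induction A rule: infinite_finite_induct) auto

lemma add_mod_left_cancel:
  fixes t x y k :: nat
  assumes "(t + x) mod k = (t + y) mod k" "x < k" "y < k"
  shows "x = y"
proof -
  have *: "u = v" if "(t + u) mod k = (t + v) mod k" "v < k" "u \<le> v" for u v
  proof -
    have "k dvd (t + v) - (t + u)"
      using that by (subst mod_eq_dvd_iff_nat[symmetric]) auto
    then have "k dvd v - u" by simp
    then have "v - u = 0" using that(2) by (meson dvd_imp_le gr0I less_imp_diff_less not_le)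
    then show ?thesis using that by simp
  qed
  show ?thesis
    using *[of x y] *[of y x] assms by (cases "x \<le> y") auto
qed

lemma sum_lessThan_add: "(\<Sum>j<a + b. f j) = (\<Sum>j<a. f j) + (\<Sum>j<b. f (a + j))"
  for f :: "nat \<Rightarrow> 'c::comm_monoid_add"
  by (induction b) (auto simp: add.assoc)

lemma sum_over_periods:
  fixes g :: "nat \<Rightarrow> real"
  assumes "0 < k"
  shows "(\<Sum>j<q * k. g ((t + j) mod k)) = q * (\<Sum>i<k. g i)"
proof (induction q)
  case (Suc q)
  have inj: "inj_on (\<lambda>j. (t + j) mod k) {..<k}"
    using add_mod_left_cancel by (intro inj_onI) blast
  moreover have "(\<lambda>j. (t + j) mod k) ` {..<k} = {..<k}"
    by (rule endo_inj_surj[OF _ _ inj]) (use assms in auto)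
  ultimately have bij: "bij_betw (\<lambda>j. (t + j) mod k) {..<k} {..<k}"
    by (simp add: bij_betw_def)
  have "(\<Sum>j<Suc q * k. g ((t + j) mod k)) = (\<Sum>j<q * k. g ((t + j) mod k)) + (\<Sum>j<k. g ((t + (q * k + j)) mod k))"
    using sum_lessThan_add[of "\<lambda>j. g ((t + j) mod k)" "q * k" k] by (simp add: add.commute[of k])
  also have "(\<Sum>j<k. g ((t + (q * k + j)) mod k)) = (\<Sum>j<k. g ((t + j) mod k))"
  proof (rule sum.cong[OF refl])
    fix j
    have "t + (q * k + j) = (t + j) + q * k" by simp
    then show "g ((t + (q * k + j)) mod k) = g ((t + j) mod k)"
      by (simp only: mod_mult_self1)
  qed
  also have "\<dots> = (\<Sum>i<k. g i)"
    using sum.reindex_bij_betw[OF bij, of g] by simp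
  finally show ?case
    using Suc by (simp add: algebra_simps)
qed simp

locale blocks = lorentz +
  fixes N :: "nat \<Rightarrow> nat"
  assumes N_pos: "1 \<le> k \<Longrightarrow> 0 < N k"
begin

abbreviation M :: "nat \<Rightarrow> nat" where "M \<equiv> M_sum N"

lemma M_0: "M 0 = 0"
  by (simp add: M_sum_def)

lemma M_step: "1 \<le> k \<Longrightarrow> M k = M (k - 1) + k * N k"
  by (cases k) (auto simp: M_sum_def)

lemma M_mono: "k \<le> l \<Longrightarrow> M k \<le> M l"
  unfolding M_sum_def by (intro sum_mono2) auto

lemma le_M: "k \<le> M k"
proof (induction k)
  case (Suc k)
  show ?case using Suc M_step[of "Suc k"] N_pos[of "Suc k"] by (cases "N (Suc k)") auto
qed simp

text \<open>The index \<open>n\<close> lies in a block of length \<open>len n\<close> that begins at \<open>start n\<close>: the numbers \<open>M k\<close>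
  separate the blocks of length \<open>k\<close> from the longer ones.  The \<open>i\<close>-th block of length \<open>k\<close> begins at
  \<open>first k i\<close>, with \<open>i \<ge> 1\<close>.\<close>

definition len :: "nat \<Rightarrow> nat" where
  "len n = (LEAST k. n < M k)"

definition start :: "nat \<Rightarrow> nat" where
  "start n = M (len n - 1) + (n - M (len n - 1)) div len n * len n"

definition first :: "nat \<Rightarrow> nat \<Rightarrow> nat" where
  "first k i = M (k - 1) + (i - 1) * k"

lemma less_M_len: "n < M (len n)"
  unfolding len_def using le_M[of "Suc n"] by (intro LeastI[of "\<lambda>k. n < M k" "Suc n"]) simp

lemma len_ge_1: "1 \<le> len n"
  using less_M_len[of n] M_0 by (cases "len n") auto

lemma len_pos: "0 < len n"
  using len_ge_1[of n] by simp

lemma M_len_le: "M (len n - 1) \<le> n"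
proof -
  have "\<not> n < M (len n - 1)"
    using len_ge_1[of n] not_less_Least[of "len n - 1" "\<lambda>k. n < M k"] by (simp add: len_def)
  then show ?thesis by simp
qed

lemma len_eqI:
  assumes "M (k - 1) \<le> n" "n < M k"
  shows "len n = k"
proof (rule linorder_cases)
  assume "len n < k"
  then have "M (len n) \<le> M (k - 1)" by (intro M_mono) simp
  then show ?thesis using assms less_M_len[of n] by simp
next
  assume "k < len n"
  then have "M k \<le> M (len n - 1)" by (intro M_mono) simp
  then show ?thesis using assms M_len_le[of n] by simp
qed simp

lemma start_le: "start n \<le> n"
proof -
  have "(n - M (len n - 1)) div len n * len n \<le> n - M (len n - 1)" by simp
  then show ?thesis
    using M_len_le[of n] unfolding start_def by linarith
qed

lemma less_start_len: "n < start n + len n"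
  using M_len_le[of n] div_mod_decomp[of "n - M (len n - 1)" "len n"]
    mod_less_divisor[OF len_pos, of "n - M (len n - 1)" n] unfolding start_def by linarith

lemma block_end_le: "1 \<le> k \<Longrightarrow> 1 \<le> i \<Longrightarrow> i \<le> N k \<Longrightarrow> first k i + k \<le> M k"
proof -
  assume *: "1 \<le> k" "1 \<le> i" "i \<le> N k"
  then have "first k i + k = M (k - 1) + i * k"
    by (cases i) (auto simp: first_def)
  also have "i * k \<le> k * N k" using * by (simp add: mult.commute)
  finally show ?thesis using M_step[of k] * by simp
qed

lemma in_block_iff:
  assumes ki: "1 \<le> k" "1 \<le> i" "i \<le> N k"
  shows "n \<in> {first k i..<first k i + k} \<longleftrightarrow> len n = k \<and> start n = first k i"
proof
  assume n: "n \<in> {first k i..<first k i + k}"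
  have len: "len n = k"
  proof (rule len_eqI)
    show "M (k - 1) \<le> n" using n by (simp add: first_def)
    show "n < M k" using n block_end_le[OF ki] by simp
  qed
  have "n - M (k - 1) = (i - 1) * k + (n - first k i)" "n - first k i < k"
    using n by (auto simp: first_def)
  then have "(n - M (k - 1)) div k = i - 1"
    using ki by simp
  then show "len n = k \<and> start n = first k i"
    using len by (simp add: start_def first_def)
next
  assume "len n = k \<and> start n = first k i"
  then show "n \<in> {first k i..<first k i + k}"
    using start_le[of n] less_start_len[of n] by auto
qed

lemma start_is_first:
  obtains i where "1 \<le> i" "i \<le> N (len n)" "start n = first (len n) i"
proof (rule that)
  let ?k = "len n" and ?i = "(n - M (len n - 1)) div len n"
  show "start n = first ?k (Suc ?i)" by (simp add: start_def first_def)
  have "n - M (?k - 1) < ?k * N ?k"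
    using less_M_len[of n] M_step[OF len_ge_1, of n] M_len_le[of n] by linarith
  then show "Suc ?i \<le> N ?k"
    by (simp add: less_mult_imp_div_less mult.commute Suc_le_eq)
qed simp

lemma same_block:
  assumes "m \<in> {start n..<start n + len n}"
  shows "len m = len n" "start m = start n"
proof -
  obtain i where i: "1 \<le> i" "i \<le> N (len n)" "start n = first (len n) i"
    by (rule start_is_first)
  show "len m = len n" "start m = start n"
    using assms in_block_iff[OF len_ge_1 i(1,2), of m] unfolding i(3) by auto
qed

lemma start_add: "i < len n \<Longrightarrow> start (start n + i) = start n" "i < len n \<Longrightarrow> len (start n + i) = len n"
  using same_block[of "start n + i" n] by auto

section \<open>Averaging over the blocks\<close>

definition average :: "(nat \<Rightarrow> 'a::{real_normed_field,real_inner}) \<Rightarrow> nat \<Rightarrow> 'a" where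
  "average a n = (\<Sum>i<len n. a (start n + i)) / of_nat (len n)"

definition shift :: "nat \<Rightarrow> nat \<Rightarrow> nat" where
  "shift j n = start n + (n - start n + j) mod len n"

lemma inj_shift: "inj (shift j)"
proof (rule injI)
  fix m n assume eq: "shift j m = shift j n"
  have "len (shift j l) = len l \<and> start (shift j l) = start l" for l
    using len_pos[of l] by (simp add: shift_def start_add)
  then have len: "len m = len n" and start: "start m = start n"
    using eq by metis+
  have "(j + (m - start n)) mod len n = (j + (n - start n)) mod len n"
    using eq len start by (simp add: shift_def add.commute)
  then have "m - start n = n - start n"
    by (rule add_mod_left_cancel)
      (use less_start_len[of m] less_start_len[of n] start_le[of m] start_le[of n] len start in auto)
  then show "m = n"
    using start_le[of m] start_le[of n] start by simp
qed

lemma sum_shift: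
  fixes c :: "nat \<Rightarrow> real"
  assumes "len n dvd J"
  shows "(\<Sum>j<J. c (shift j n)) = J / len n * (\<Sum>i<len n. c (start n + i))"
proof -
  obtain q where q: "J = q * len n"
    using assms by (auto simp: dvd_def mult.commute)
  show ?thesis
    using sum_over_periods[OF len_pos[of n], where q = q and t = "n - start n" and g = "\<lambda>i. c (start n + i)"] len_pos[of n]
    by (simp add: q shift_def)
qed

text \<open>The mean over one block is a mean over cyclic shifts of that block.  Shifting all blocks
  simultaneously by \<open>j\<close>, and letting \<open>j\<close> run over a common multiple of the block lengths met, all
  these means become one mean over injective rearrangements, each of which is bounded by the norm.\<close>

lemma average_contraction:
  fixes a :: "nat \<Rightarrow> 'a::{real_normed_field,real_inner}"
  assumes a: "a \<in> X"
  shows "average a \<in> X" "nm (average a) \<le> nm a"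
proof -
  have "(\<Sum>n<q. norm (average a (F n)) powr p * w n) \<le> nm a powr p" if F: "inj_on F {..<q}" for q F
  proof -
    define J where "J = (\<Prod>n<q. len (F n))"
    have J: "0 < J" using len_pos by (simp add: J_def)
    let ?c = "\<lambda>j. norm (a j) powr p"
    have "norm (average a (F n)) powr p * w n \<le> (\<Sum>j<J. ?c (shift j (F n)) * w n) / J" if n: "n < q" for n
    proof -
      let ?m = "F n"
      have "norm (average a ?m) \<le> (\<Sum>i<len ?m. norm (a (start ?m + i))) / len ?m"
        by (simp add: average_def norm_divide norm_sum divide_right_mono)
      then have "norm (average a ?m) powr p \<le> ((\<Sum>i<len ?m. norm (a (start ?m + i))) / card {..<len ?m}) powr p"
        using p_pos by (intro powr_mono2) auto
      also have "\<dots> \<le> (\<Sum>i<len ?m. ?c (start ?m + i)) / card {..<len ?m}"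
        by (rule mean_powr_le) (use p len_pos[of ?m] in auto)
      also have "\<dots> = (\<Sum>j<J. ?c (shift j ?m)) / J"
      proof -
        have "len ?m dvd J" unfolding J_def by (rule dvd_prodI) (use n in auto)
        from sum_shift[OF this, of ?c] show ?thesis using J by simp
      qed
      finally have "norm (average a ?m) powr p * w n \<le> (\<Sum>j<J. ?c (shift j ?m)) / J * w n"
        by (intro mult_right_mono w_nonneg)
      then show ?thesis by (simp add: sum_distrib_right)
    qed
    then have "(\<Sum>n<q. norm (average a (F n)) powr p * w n) \<le> (\<Sum>n<q. (\<Sum>j<J. ?c (shift j (F n)) * w n) / J)"
      by (intro sum_mono) auto
    also have "\<dots> = (\<Sum>j<J. (\<Sum>n<q. ?c (shift j (F n)) * w n)) / J"
      by (subst sum.swap) (simp add: sum_divide_distrib)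
    also have "\<dots> \<le> (\<Sum>j<J. nm a powr p) / J"
    proof (intro divide_right_mono sum_mono)
      fix j
      have "inj_on (shift j \<circ> F) {..<q}"
        by (rule comp_inj_on[OF F]) (use inj_shift inj_on_subset in blast)
      then show "(\<Sum>n<q. ?c (shift j (F n)) * w n) \<le> nm a powr p"
        using rearranged_sum_le[OF a, of "{..<q}" "shift j \<circ> F"] by simp
    qed simp
    also have "\<dots> = nm a powr p" using J by simp
    finally show ?thesis .
  qed
  then show "average a \<in> X" "nm (average a) \<le> nm a"
    using lorentzI[of "average a" "nm a"] nm_nonneg by blast+
qed

lemma average_add: "average (a + b) = average a + average b"
  by (simp add: average_def fun_eq_iff sum.distrib add_divide_distrib)

lemma average_scale: "average (seq_scale c a) = seq_scale c (average a)"
  by (simp add: average_def seq_scale_def fun_eq_iff sum_distrib_left)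

lemma average_diff: "average (a - b) = average a - average b"
  by (simp add: average_def fun_eq_iff sum_subtractf diff_divide_distrib)

lemma average_start: "average a n = average a (start n)"
  using start_add[of 0 n] len_pos[of n] by (simp add: average_def)

lemma average_eq_iff: "average a = a \<longleftrightarrow> (\<forall>n. a n = a (start n))"
proof
  assume "average a = a"
  then show "\<forall>n. a n = a (start n)" using average_start by metis
next
  assume c: "\<forall>n. a n = a (start n)"
  have "a (start n + i) = a n" if "i < len n" for n i
    using c start_add(1)[OF that] by metis
  then show "average a = a"
    using len_pos by (simp add: average_def fun_eq_iff)
qed

section \<open>The block subspace\<close>

abbreviation blk :: "nat \<Rightarrow> nat \<Rightarrow> nat \<Rightarrow> 'a::{real_normed_field,real_inner}" where
  "blk \<equiv> block w p N"

definition Y :: "(nat \<Rightarrow> 'a::{real_normed_field,real_inner}) set" where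
  "Y = {x \<in> X. average x = x}"

lemma blk_apply:
  assumes "1 \<le> i"
  shows "(blk k i :: nat \<Rightarrow> 'a::{real_normed_field,real_inner}) n =
    (if n \<in> {first k i..<first k i + k} then of_real (1 / W_sum w k powr (1 / p)) else 0)"
proof -
  have e: "M (k - 1) + i * k = first k i + k"
    using assms by (cases i) (auto simp: first_def)
  have "blk k i n = (of_real (1 / W_sum w k powr (1 / p)) :: 'a) * (\<Sum>m\<in>{first k i..<first k i + k}. of_bool (n = m))"
    unfolding block_def seq_scale_def e by (simp add: sum_fun_apply first_def unit_seq_def del: of_real_divide)
  then show ?thesis by (simp add: of_bool_def sum.delta del: of_real_divide)
qed

lemma blk_in_Y:
  assumes ki: "1 \<le> k" "1 \<le> i" "i \<le> N k"
  shows "blk k i \<in> (Y :: (nat \<Rightarrow> 'a::{real_normed_field,real_inner}) set)"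
proof -
  have "(blk k i :: nat \<Rightarrow> 'a) \<in> X"
    by (rule flat_in_X(1)[of "{first k i..<first k i + k}" "1 / W_sum w k powr (1 / p)"])
      (auto simp: blk_apply[OF ki(2)] norm_divide)
  moreover have "len (start n) = len n" "start (start n) = start n" for n
    using start_add[of 0 n] len_pos[of n] by auto
  then have "(blk k i :: nat \<Rightarrow> 'a) n = blk k i (start n)" for n
    unfolding blk_apply[OF ki(2)] in_block_iff[OF ki] by simp
  ultimately show ?thesis
    by (simp add: Y_def average_eq_iff)
qed

lemma subspace_Y: "seq.subspace (Y :: (nat \<Rightarrow> 'a::{real_normed_field,real_inner}) set)"
proof -
  have "average (0 :: nat \<Rightarrow> 'a) = 0" by (simp add: average_def fun_eq_iff)
  then show ?thesis
    unfolding seq.subspace_def Y_def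
    using zero_in_X add_in_X scale_in_X by (auto simp: average_add average_scale)
qed

lemma initial_part_in_span:
  fixes x :: "nat \<Rightarrow> 'a::{real_normed_field,real_inner}"
  assumes x: "\<And>n. x n = x (start n)"
  shows "x - tail (M K) x \<in> seq.span {blk k i | k i. 1 \<le> k \<and> 1 \<le> i \<and> i \<le> N k}"
proof -
  let ?Q = "SIGMA k:{1..K}. {1..N k}"
  let ?c = "\<lambda>k i. x (first k i) * of_real (W_sum w k powr (1 / p))"
  let ?t = "\<lambda>(k, i). seq_scale (?c k i) (blk k i)"
  have "x - tail (M K) x = (\<Sum>ki\<in>?Q. ?t ki)"
  proof
    fix n
    show "(x - tail (M K) x) n = (\<Sum>ki\<in>?Q. ?t ki) n"
    proof (cases "n < M K")
      case True
      have lenK: "len n \<le> K"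
        unfolding len_def by (rule Least_le) (rule True)
      obtain i where i: "1 \<le> i" "i \<le> N (len n)" "start n = first (len n) i"
        by (rule start_is_first)
      have "?t ki n = 0" if "ki \<in> ?Q - {(len n, i)}" for ki
      proof -
        obtain k' i' where ki: "ki = (k', i')" by fastforce
        have ge: "1 \<le> k'" "1 \<le> i'" "i' \<le> N k'" using that ki by auto
        have "\<not> (len n = k' \<and> start n = first k' i')"
        proof
          assume "len n = k' \<and> start n = first k' i'"
          then have "k' = len n" "(i - 1) * len n = (i' - 1) * len n" using i by (auto simp: first_def)
          then have "k' = len n" "i = i'" using len_pos[of n] i ge by auto
          then show False using that ki by simp
        qed
        then have "n \<notin> {first k' i'..<first k' i' + k'}"
          by (simp only: in_block_iff[OF ge] not_False_eq_True)
        then have "(blk k' i' :: nat \<Rightarrow> 'a) n = 0"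
          by (simp only: blk_apply[OF ge(2)] if_False)
        then show ?thesis
          by (simp add: ki seq_scale_def)
      qed
      then have "(\<Sum>ki\<in>?Q. ?t ki n) = (\<Sum>ki\<in>{(len n, i)}. ?t ki n)"
        using lenK len_ge_1[of n] i by (intro sum.mono_neutral_right) auto
      also have "\<dots> = x (first (len n) i)"
      proof -
        have "n \<in> {first (len n) i..<first (len n) i + len n}"
          using i(3) by (simp only: in_block_iff[OF len_ge_1 i(1,2)])
        then have "(blk (len n) i :: nat \<Rightarrow> 'a) n = of_real (1 / W_sum w (len n) powr (1 / p))"
          by (simp only: blk_apply[OF i(1)] if_True)
        then show ?thesis
          using W_pos[OF len_ge_1[of n]] by (simp add: seq_scale_def)
      qed
      also have "\<dots> = x n" using x[of n] i by simp
      finally show ?thesis using True by (simp add: tail_def sum_fun_apply)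
    next
      case False
      have "?t ki n = 0" if "ki \<in> ?Q" for ki
      proof -
        obtain k' i' where ki: "ki = (k', i')" by fastforce
        have ge: "1 \<le> k'" "1 \<le> i'" "i' \<le> N k'" "k' \<le> K" using that ki by auto
        have "first k' i' + k' \<le> M K"
          using block_end_le[OF ge(1-3)] M_mono[OF ge(4)] by simp
        then have "n \<notin> {first k' i'..<first k' i' + k'}"
          using False by simp
        then have "(blk k' i' :: nat \<Rightarrow> 'a) n = 0"
          by (simp only: blk_apply[OF ge(2)] if_False)
        then show ?thesis
          by (simp add: ki seq_scale_def)
      qed
      then have "(\<Sum>ki\<in>?Q. ?t ki n) = 0" by (intro sum.neutral) blast
      then show ?thesis using False by (simp add: tail_def sum_fun_apply)
    qed
  qed
  also have "\<dots> \<in> seq.span {blk k i | k i. 1 \<le> k \<and> 1 \<le> i \<and> i \<le> N k}"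
  proof (rule seq.span_sum)
    fix ki assume "ki \<in> ?Q"
    then obtain k i where ki: "ki = (k, i)" "1 \<le> k" "1 \<le> i" "i \<le> N k" by auto
    then have "blk k i \<in> {blk k i :: nat \<Rightarrow> 'a | k i. 1 \<le> k \<and> 1 \<le> i \<and> i \<le> N k}" by blast
    then show "?t ki \<in> seq.span {blk k i | k i. 1 \<le> k \<and> 1 \<le> i \<and> i \<le> N k}"
      unfolding ki by (simp only: prod.case) (intro seq.span_scale seq.span_base)
  qed
  finally show ?thesis .
qed

text \<open>The fixed points of the averaging form a closed set, as averaging is a contraction; and a
  sequence that is constant on the blocks is the limit of its initial parts, as its tails tend
  to \<open>0\<close>.\<close>

lemma block_subspace_eq_Y: "block_subspace w p N = (Y :: (nat \<Rightarrow> 'a::{real_normed_field,real_inner}) set)"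
proof -
  define S :: "(nat \<Rightarrow> 'a) set" where "S = seq.span {blk k i | k i. 1 \<le> k \<and> 1 \<le> i \<and> i \<le> N k}"
  interpret X: seq_norm "X :: (nat \<Rightarrow> 'a) set" nm by (rule seq_norm_X)
  interpret MX: Metric_space "X :: (nat \<Rightarrow> 'a) set" "\<lambda>x y. nm (x - y)" by (rule X.metric)
  have SY: "S \<subseteq> Y"
    unfolding S_def by (rule seq.span_minimal[OF _ subspace_Y]) (use blk_in_Y in auto)
  have SX: "S \<subseteq> X" using SY by (auto simp: Y_def)
  have "block_subspace w p N = {x \<in> X. \<forall>r>0. \<exists>y\<in>S. y \<in> MX.mball x r}"
    unfolding block_subspace_def norm_topology_def S_def by (rule MX.metric_closure_of)
  then have cl: "block_subspace w p N = {x \<in> X. \<forall>r>0. \<exists>y\<in>S. nm (x - y) < r}"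
    using SX unfolding MX.in_mball by blast
  show ?thesis
  proof (intro subset_antisym subsetI)
    fix x :: "nat \<Rightarrow> 'a" assume "x \<in> block_subspace w p N"
    then have x: "x \<in> X" "\<And>r. 0 < r \<Longrightarrow> \<exists>y\<in>S. nm (x - y) < r"
      unfolding cl by blast+
    have "nm (average x - x) \<le> 0 + e" if "0 < e" for e :: real
    proof -
      obtain y where y: "y \<in> S" "nm (x - y) < e / 2"
        using x(2)[of "e / 2"] \<open>0 < e\<close> by (meson half_gt_zero)
      have yY: "y \<in> X" "average y = y" using y SY by (auto simp: Y_def)
      have d: "x - y \<in> X" by (rule diff_in_X(1)[OF x(1) yY(1)])
      have "average x - x = average (x - y) - (x - y)"
        by (simp add: average_diff yY)
      then have "nm (average x - x) \<le> nm (average (x - y)) + nm (x - y)"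
        using diff_in_X(2)[OF average_contraction(1)[OF d] d] by metis
      then show ?thesis
        using average_contraction(2)[OF d] y by simp
    qed
    then have "nm (average x - x) \<le> 0" by (rule field_le_epsilon)
    then have "nm (average x - x) = 0" using nm_nonneg[of "average x - x"] by simp
    then have "average x - x = 0"
      by (rule nm_eq_0[OF diff_in_X(1)[OF average_contraction(1)[OF x(1)] x(1)]])
    then show "x \<in> Y" using x by (simp add: Y_def)
  next
    fix x :: "nat \<Rightarrow> 'a" assume "x \<in> Y"
    then have x: "x \<in> X" "\<And>n. x n = x (start n)"
      by (auto simp: Y_def average_eq_iff)
    have "\<exists>y\<in>S. nm (x - y) < r" if "0 < r" for r
    proof -
      obtain r0 where r0: "\<And>s. r0 \<le> s \<Longrightarrow> tail s x \<in> X \<and> nm (tail s x) \<le> r / 2"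
        using tail_small[OF x(1), of "r / 2"] \<open>0 < r\<close> by (meson half_gt_zero)
      let ?y = "x - tail (M r0) x"
      have "?y \<in> S" unfolding S_def by (rule initial_part_in_span) (rule x(2))
      moreover have "nm (x - ?y) < r"
        using r0[OF le_M] that by simp
      ultimately show ?thesis by blast
    qed
    then show "x \<in> block_subspace w p N" unfolding cl using x by blast
  qed
qed

lemma Y_subset_X: "(Y :: (nat \<Rightarrow> 'a::{real_normed_field,real_inner}) set) \<subseteq> X"
  by (auto simp: Y_def)

lemma average_in_Y: "a \<in> X \<Longrightarrow> average a \<in> Y"
  using average_contraction(1)[of a] average_start[of a] by (auto simp: Y_def average_eq_iff)

lemma Y_one_complemented: "one_complemented X nm (Y :: (nat \<Rightarrow> 'a::{real_normed_field,real_inner}) set)"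
proof -
  define u where "u = (unit_seq 0 :: nat \<Rightarrow> 'a)"
  have blk1: "u = blk 1 1"
    by (auto simp: fun_eq_iff blk_apply first_def M_0 u_def unit_seq_def W_sum_def w_0)
  then have uY: "u \<in> Y" using blk_in_Y[of 1 1] N_pos[of 1] by simp
  then have u: "u \<in> X" "average u = u" by (auto simp: Y_def)
  have "nm u powr p \<le> 1 powr p"
    using flat_in_X(2)[of "{0}" 1 u] W_1 by (simp add: u_def unit_seq_def)
  then have "nm u \<le> 1"
    by (rule powr_le_powr_imp_le[OF _ p_pos]) simp
  moreover have "1 \<le> nm u"
    using norm_le_nm[OF u(1), of 0] by (simp add: u_def unit_seq_def)
  ultimately have nmu: "nm u = 1" by simp
  have le1: "nm (average x) \<le> 1" if "x \<in> {x\<in>X. nm x \<le> 1}" for x :: "nat \<Rightarrow> 'a"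
    using average_contraction(2)[of x] that by auto
  have "op_norm_on X nm (average :: (nat \<Rightarrow> 'a) \<Rightarrow> _) = 1"
    unfolding op_norm_on_def
  proof (rule antisym)
    show "(SUP x\<in>{x\<in>X. nm x \<le> 1}. nm (average (x :: nat \<Rightarrow> 'a))) \<le> 1"
      by (rule cSUP_least[OF _ le1]) (use u nmu in auto)
    have "bdd_above ((\<lambda>x. nm (average (x :: nat \<Rightarrow> 'a))) ` {x\<in>X. nm x \<le> 1})"
      by (rule bdd_aboveI[of _ 1]) (use le1 in auto)
    then have "nm (average u) \<le> (SUP x\<in>{x\<in>X. nm x \<le> 1}. nm (average (x :: nat \<Rightarrow> 'a)))"
      by (intro cSUP_upper) (use u nmu in auto)
    then show "1 \<le> (SUP x\<in>{x\<in>X. nm x \<le> 1}. nm (average (x :: nat \<Rightarrow> 'a)))"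
      using u nmu by simp
  qed
  moreover have "bounded_on X nm (average :: (nat \<Rightarrow> 'a) \<Rightarrow> _)"
    unfolding bounded_on_def by (rule exI[of _ 1]) (use average_contraction(2) in auto)
  moreover have "average (average a) = average a" for a :: "nat \<Rightarrow> 'a"
    using average_start[of a] by (auto simp: average_eq_iff)
  moreover have "average ` X = (Y :: (nat \<Rightarrow> 'a) set)"
    using average_in_Y by (auto simp: Y_def image_iff) (metis)
  ultimately show ?thesis
    unfolding one_complemented_def
    by (intro exI[of _ average]) (auto simp: linear_on_def average_add average_scale average_contraction(1))
qed

lemma seq_norm_Y: "seq_norm (Y :: (nat \<Rightarrow> 'a::{real_normed_field,real_inner}) set) nm"
  by (rule seq_norm.restrict[OF seq_norm_X subspace_Y Y_subset_X])

end

section \<open>No isomorph of the Lorentz space\<close>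

context lorentz
begin

lemma W_sublinear: "0 < e \<Longrightarrow> \<exists>n0. \<forall>n\<ge>n0. W_sum w n \<le> e * real n" for e :: real
  unfolding W_sum_def by (rule mean_of_null_sequence_small) (use w in \<open>auto simp: weights_def\<close>)

text \<open>If the \<open>j\<close>-th entries stayed away from \<open>0\<close>, unimodular coefficients would align them, and the
  sums of \<open>m\<close> vectors would have norm at least \<open>\<delta> m\<close>.\<close>

lemma coordinates_vanish:
  fixes y :: "nat \<Rightarrow> nat \<Rightarrow> 'a::{real_normed_field,real_inner}"
  assumes yX: "\<And>n. y n \<in> X" and "0 \<le> K"
    and upper: "\<And>I c. finite I \<Longrightarrow> (\<And>n. norm (c n) \<le> 1) \<Longrightarrow>
      nm (\<Sum>n\<in>I. seq_scale (c n) (y n)) powr p \<le> K * W_sum w (card I)"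
    and "0 < \<delta>"
  shows "finite {n. \<delta> \<le> norm (y n j)}"
proof (rule ccontr)
  assume inf: "infinite {n. \<delta> \<le> norm (y n j)}"
  define e where "e = \<delta> powr p / (2 * (K + 1))"
  have e: "0 < e" using \<open>0 < \<delta>\<close> \<open>0 \<le> K\<close> by (simp add: e_def)
  obtain n0 where n0: "\<And>n. n0 \<le> n \<Longrightarrow> W_sum w n \<le> e * n"
    using W_sublinear[OF e] by blast
  define m where "m = Suc n0"
  obtain I where I: "finite I" "card I = m" "I \<subseteq> {n. \<delta> \<le> norm (y n j)}"
    using infinite_arbitrarily_large[OF inf] by blast
  define c where "c n = (if y n j = 0 then 0 else of_real (norm (y n j)) / y n j)" for n
  have c: "norm (c n) \<le> 1" "c n * y n j = of_real (norm (y n j))" for n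
    by (auto simp: c_def norm_divide)
  let ?s = "\<Sum>n\<in>I. seq_scale (c n) (y n)"
  have sX: "?s \<in> X"
    by (rule seq.subspace_sum[OF subspace_X]) (use scale_in_X(1)[OF yX] in blast)
  have "?s j = of_real (\<Sum>n\<in>I. norm (y n j))"
    by (simp add: sum_fun_apply seq_scale_def c)
  then have "norm (?s j) = (\<Sum>n\<in>I. norm (y n j))"
    by (simp only: norm_of_real) (simp add: sum_nonneg)
  moreover have "(\<Sum>n\<in>I. \<delta>) \<le> (\<Sum>n\<in>I. norm (y n j))"
    by (rule sum_mono) (use I in auto)
  ultimately have "\<delta> * m \<le> nm ?s"
    using norm_le_nm[OF sX, of j] I by (simp add: mult.commute)
  then have "(\<delta> * m) powr p \<le> nm ?s powr p"
    using \<open>0 < \<delta>\<close> p_pos by (intro powr_mono2) auto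
  also have "\<dots> \<le> K * W_sum w m"
    using upper[OF I(1) c(1)] I by simp
  also have "\<dots> \<le> K * (e * m)"
    by (intro mult_left_mono n0) (use \<open>0 \<le> K\<close> in \<open>auto simp: m_def\<close>)
  also have "\<dots> < (K + 1) * (e * m)"
    using e by (simp add: m_def)
  also have "\<dots> = \<delta> powr p * m / 2"
    using \<open>0 \<le> K\<close> by (simp add: e_def field_simps)
  also have "\<dots> \<le> \<delta> powr p * m powr p"
  proof -
    have "real m \<le> real m powr p"
      using powr_mono[of 1 p "real m"] p by (simp add: m_def)
    then have "\<delta> powr p * real m \<le> \<delta> powr p * real m powr p"
      by (intro mult_left_mono) auto
    moreover have "0 \<le> \<delta> powr p * real m" by simp
    ultimately show ?thesis by linarith
  qed
  finally have "(\<delta> * real m) powr p < \<delta> powr p * real m powr p" .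
  then show False by (simp only: powr_mult less_irrefl)
qed

end

context blocks
begin

text \<open>A vector of \<open>Y\<close> repeats each entry \<open>k\<close> times on a block of length \<open>k\<close>, and far out all blocks
  are long.\<close>

lemma entries_uniformly_small:
  assumes "0 < \<eta>" "0 \<le> K"
  shows "\<exists>r. \<forall>j\<ge>r. \<forall>x\<in>(Y :: (nat \<Rightarrow> 'a::{real_normed_field,real_inner}) set). nm x powr p \<le> K \<longrightarrow> norm (x j) powr p \<le> \<eta>"
proof -
  obtain k where k: "\<And>n. k \<le> n \<Longrightarrow> K / \<eta> < W_sum w n"
    using W_unbounded by blast
  show ?thesis
  proof (intro exI allI ballI impI)
    fix j and x :: "nat \<Rightarrow> 'a"
    assume j: "M k \<le> j" and x: "x \<in> Y" "nm x powr p \<le> K"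
    have "k \<le> len j"
      using j less_M_len[of j] M_mono[of "len j" k] by linarith
    have xX: "x \<in> X" and cst: "\<And>n. x n = x (start n)"
      using x by (auto simp: Y_def average_eq_iff)
    have "norm (x j) powr p * W_sum w (card {start j..<start j + len j}) \<le> nm x powr p"
    proof (rule nm_powr_ge_on_set[OF xX])
      fix i assume "i \<in> {start j..<start j + len j}"
      then show "norm (x j) \<le> norm (x i)"
        using same_block(2)[of i j] cst[of i] cst[of j] by simp
    qed auto
    then have "norm (x j) powr p * W_sum w (len j) \<le> K" using x by simp
    moreover have "K < \<eta> * W_sum w (len j)"
      using k[OF \<open>k \<le> len j\<close>] \<open>0 < \<eta>\<close> by (simp add: field_simps)
    ultimately have "norm (x j) powr p * W_sum w (len j) \<le> \<eta> * W_sum w (len j)" by linarith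
    then show "norm (x j) powr p \<le> \<eta>"
      using W_pos[OF len_ge_1[of j]] by simp
  qed
qed

text \<open>A gliding hump.  Each new hump lies beyond the previous ones, where the entries are so small
  that its contribution at the places \<open>n < q\<close> of a rearrangement, which the previous humps use,
  is negligible.  So it contributes a fixed amount at the places from \<open>q\<close> on, and one
  rearrangement collects this amount \<open>m\<close> times.\<close>

lemma disjoint_humps:
  fixes y :: "nat \<Rightarrow> nat \<Rightarrow> 'a::{real_normed_field,real_inner}"
  assumes yY: "\<And>n. y n \<in> Y" and "0 \<le> K" and bdd: "\<And>n. nm (y n) powr p \<le> K"
    and low: "\<And>n. \<kappa> \<le> nm (y n)"
    and coords: "\<And>j \<delta>. 0 < \<delta> \<Longrightarrow> finite {n. \<delta> \<le> norm (y n j)}"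
    and eps: "0 < \<epsilon>" "2 * \<epsilon> \<le> \<kappa>"
  shows "\<exists>I z r F D q. finite I \<and> card I = m \<and> z \<in> X \<and> nm ((\<Sum>n\<in>I. y n) - z) \<le> m * \<epsilon> \<and>
     (\<forall>j\<ge>r. z j = 0) \<and> D \<subseteq> {..<q} \<and> inj_on F D \<and> F ` D \<subseteq> {..<r} \<and>
     m * ((\<kappa> / 2) powr p / 2) \<le> (\<Sum>n\<in>D. norm (z (F n)) powr p * w n)"
proof (induction m)
  case 0
  show ?case
    by (rule exI[of _ "{}"], rule exI[of _ 0], rule exI[of _ 0], rule exI[of _ id], rule exI[of _ "{}"])
      (use zero_in_X[where 'a = 'a] nm_zero[where 'a = 'a] in \<open>simp add: zero_fun_def\<close>)
next
  case (Suc m)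
  define c where "c = (\<kappa> / 2) powr p / 2"
  have c: "0 < c" using eps by (simp add: c_def)
  obtain I z r F D q where H: "finite I \<and> card I = m \<and> z \<in> X \<and> nm ((\<Sum>n\<in>I. y n) - z) \<le> m * \<epsilon> \<and>
     (\<forall>j\<ge>r. z j = 0) \<and> D \<subseteq> {..<q} \<and> inj_on F D \<and> F ` D \<subseteq> {..<r} \<and>
     m * ((\<kappa> / 2) powr p / 2) \<le> (\<Sum>n\<in>D. norm (z (F n)) powr p * w n)"
    using Suc by (elim exE)
  then have I: "finite I" "card I = m" and z: "z \<in> X" "nm ((\<Sum>n\<in>I. y n) - z) \<le> m * \<epsilon>"
    and zr: "\<And>j. r \<le> j \<Longrightarrow> z j = 0" and D: "D \<subseteq> {..<q}" "inj_on F D" "F ` D \<subseteq> {..<r}"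
    and sum: "m * c \<le> (\<Sum>n\<in>D. norm (z (F n)) powr p * w n)"
    unfolding c_def by simp_all
  have yX: "y n \<in> X" for n using yY Y_subset_X by blast
  \<comment> \<open>At the \<open>q\<close> occupied places the new hump may lose at most \<open>q \<eta> \<le> c/2\<close>.\<close>
  define \<eta> where "\<eta> = c / (2 * (q + 1))"
  have \<eta>: "0 < \<eta>" using c by (simp add: \<eta>_def)
  obtain r1 where r1: "\<And>j n. r1 \<le> j \<Longrightarrow> norm (y n j) powr p \<le> \<eta>"
    using entries_uniformly_small[where 'a = 'a, OF \<eta> \<open>0 \<le> K\<close>] yY bdd by blast
  define r' where "r' = max r r1"
  define \<alpha> where "\<alpha> = \<epsilon> / (2 * (r' + 1))"
  have \<alpha>: "0 < \<alpha>" using eps by (simp add: \<alpha>_def)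
  have "finite (I \<union> (\<Union>j<r'. {n. \<alpha> \<le> norm (y n j)}))"
    using I coords[OF \<alpha>] by simp
  then obtain n where "n \<notin> I \<union> (\<Union>j<r'. {n. \<alpha> \<le> norm (y n j)})"
    using ex_new_if_finite[OF infinite_UNIV_nat] by blast
  then have n: "n \<notin> I" "\<And>j. j < r' \<Longrightarrow> norm (y n j) \<le> \<alpha>"
    by (auto simp: not_le intro: less_imp_le)
  define h where "h j = (if j < r' then y n j else 0)" for j
  have h: "h \<in> X" "nm h \<le> \<epsilon> / 2"
  proof -
    have le: "norm (h j) \<le> (if j \<in> {..<r'} then \<alpha> else 0)" for j
      using n(2) by (simp add: h_def)
    show "h \<in> X" by (rule flat_in_X(1)[OF _ _ le]) (use \<alpha> in auto)
    have "nm h powr p \<le> \<alpha> powr p * W_sum w r'"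
      using flat_in_X(2)[OF _ _ le] \<alpha> by simp
    also have "\<dots> \<le> \<alpha> powr p * real (r' + 1) powr p"
    proof (rule mult_left_mono)
      have "W_sum w r' \<le> (\<Sum>i<r'. 1)"
        unfolding W_sum_def by (rule sum_mono) (rule w_le_1)
      also have "\<dots> \<le> real (r' + 1) powr 1" by simp
      also have "\<dots> \<le> real (r' + 1) powr p" by (rule powr_mono) (use p in auto)
      finally show "W_sum w r' \<le> real (r' + 1) powr p" .
    qed simp
    also have "\<dots> = (\<epsilon> / 2) powr p"
    proof -
      have "\<alpha> * real (r' + 1) = \<epsilon> / 2" by (simp add: \<alpha>_def field_simps)
      then show ?thesis by (metis powr_mult)
    qed
    finally show "nm h \<le> \<epsilon> / 2"
      by (rule powr_le_powr_imp_le[OF _ p_pos]) (use eps in simp)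
  qed
  obtain r0 where r0: "\<And>s. r0 \<le> s \<Longrightarrow> tail s (y n) \<in> X \<and> nm (tail s (y n)) \<le> \<epsilon> / 2"
    using tail_small[OF yX, of "\<epsilon> / 2" n] eps(1) by (meson half_gt_zero)
  define s where "s = max r0 r'"
  define z' where "z' j = (if r' \<le> j \<and> j < s then y n j else 0)" for j
  have z'X: "z' \<in> X"
    by (rule lorentz_mono(1)[OF yX[of n]]) (simp add: z'_def)
  have t: "tail s (y n) \<in> X" "nm (tail s (y n)) \<le> \<epsilon> / 2"
    using r0[of s] by (simp_all add: s_def)
  have split: "y n - z' = h + tail s (y n)"
    by (auto simp: fun_eq_iff z'_def h_def tail_def s_def)
  have err: "nm (y n - z') \<le> \<epsilon>"
    unfolding split using add_in_X(2)[OF h(1) t(1)] h(2) t(2) by simp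
  have "y n = (y n - z') + z'" by simp
  then have "nm (y n) \<le> nm (y n - z') + nm z'"
    using add_in_X(2)[OF diff_in_X(1)[OF yX z'X] z'X, of n] by metis
  then have "\<kappa> / 2 \<le> nm z'"
    using low[of n] err eps by simp
  then have nmz': "2 * c \<le> nm z' powr p"
    using powr_mono2[of p "\<kappa> / 2" "nm z'"] p_pos eps by (simp add: c_def)
  have "0 < c / 2" using c by simp
  then obtain q0 f where f: "inj_on f {..<q0}" "nm z' powr p - c / 2 < (\<Sum>n<q0. norm (z' (f n)) powr p * w n)"
    by (rule rearranged_sum_close)
  \<comment> \<open>The first \<open>q\<close> places are left to the earlier humps.\<close>
  define D' where "D' = {n\<in>{q..<q0}. r' \<le> f n \<and> f n < s}"
  let ?t = "\<lambda>n. norm (z' (f n)) powr p * w n"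
  have D'sum: "c \<le> (\<Sum>n\<in>D'. ?t n)"
  proof -
    have "(\<Sum>n<q0. ?t n) = (\<Sum>n\<in>{..<q0} \<inter> {..<q}. ?t n) + (\<Sum>n\<in>{..<q0} - {..<q}. ?t n)"
      by (rule sum.Int_Diff) simp
    also have "(\<Sum>n\<in>{..<q0} - {..<q}. ?t n) = (\<Sum>n\<in>D'. ?t n)"
      by (rule sum.mono_neutral_right) (auto simp: D'_def z'_def)
    also have "(\<Sum>n\<in>{..<q0} \<inter> {..<q}. ?t n) \<le> (\<Sum>n<q. \<eta>)"
    proof (rule order_trans[OF sum_mono2 sum_mono])
      fix k
      have "norm (z' (f k)) powr p \<le> \<eta>"
        using r1[of "f k" n] \<eta> p_pos by (auto simp: z'_def r'_def)
      then have "?t k \<le> \<eta> * 1"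
        by (intro mult_mono) (use w_le_1 w_nonneg \<eta> in auto)
      then show "?t k \<le> \<eta>" by simp
    qed (auto simp: w_nonneg)
    also have "(\<Sum>n<q. \<eta>) \<le> c / 2"
      using c by (simp add: \<eta>_def field_simps)
    finally show ?thesis using f(2) nmz' by linarith
  qed
  define G where "G k = (if k < q then F k else f k)" for k
  have finD: "finite D" "finite D'" using D(1) finite_subset by (auto simp: D'_def)
  have GD: "G k = F k" if "k \<in> D" for k using that D(1) by (auto simp: G_def)
  have GD': "G k = f k" if "k \<in> D'" for k using that by (auto simp: G_def D'_def)
  have FD: "F k < r'" if "k \<in> D" for k using that D(3) by (auto simp: r'_def)
  have fD': "r' \<le> f k" "f k < s" if "k \<in> D'" for k using that by (auto simp: D'_def)
  have injG: "inj_on G (D \<union> D')"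
  proof -
    have "inj_on G D" using D(2) GD by (simp cong: inj_on_cong)
    moreover have "inj_on f D'" using f(1) by (rule inj_on_subset) (auto simp: D'_def)
    then have "inj_on G D'" using GD' by (simp cong: inj_on_cong)
    moreover have "G ` (D - D') \<inter> G ` (D' - D) = {}"
      using GD GD' FD fD' by fastforce
    ultimately show ?thesis by (simp add: inj_on_Un)
  qed
  let ?u = "\<lambda>k. norm ((z + z') (G k)) powr p * w k"
  have "(\<Sum>k\<in>D \<union> D'. ?u k) = (\<Sum>k\<in>D. ?u k) + (\<Sum>k\<in>D'. ?u k)"
    by (rule sum.union_disjoint) (use finD D(1) in \<open>auto simp: D'_def\<close>)
  also have "(\<Sum>k\<in>D. ?u k) = (\<Sum>k\<in>D. norm (z (F k)) powr p * w k)"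
  proof (rule sum.cong[OF refl])
    fix k assume k: "k \<in> D"
    have "z' (F k) = 0" using FD[OF k] by (simp add: z'_def)
    then show "?u k = norm (z (F k)) powr p * w k" by (simp add: GD[OF k])
  qed
  also have "(\<Sum>k\<in>D'. ?u k) = (\<Sum>k\<in>D'. ?t k)"
  proof (rule sum.cong[OF refl])
    fix k assume k: "k \<in> D'"
    have "z (f k) = 0" using fD'(1)[OF k] by (intro zr) (simp add: r'_def)
    then show "?u k = ?t k" by (simp add: GD'[OF k])
  qed
  finally have total: "real (Suc m) * c \<le> (\<Sum>k\<in>D \<union> D'. ?u k)"
    using sum D'sum by (simp add: algebra_simps)
  have "(\<Sum>n\<in>insert n I. y n) - (z + z') = ((\<Sum>n\<in>I. y n) - z) + (y n - z')"
    using I n by (simp add: algebra_simps)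
  moreover have "(\<Sum>n\<in>I. y n) \<in> X"
    by (rule seq.subspace_sum[OF subspace_X]) (use yX in blast)
  ultimately have "nm ((\<Sum>n\<in>insert n I. y n) - (z + z')) \<le> nm ((\<Sum>n\<in>I. y n) - z) + nm (y n - z')"
    using add_in_X(2)[OF diff_in_X(1) diff_in_X(1)] z(1) z'X yX by metis
  also have "\<dots> \<le> real (Suc m) * \<epsilon>"
    using z(2) err by (simp add: algebra_simps)
  finally have err': "nm ((\<Sum>n\<in>insert n I. y n) - (z + z')) \<le> real (Suc m) * \<epsilon>" .
  have "finite (insert n I)" "card (insert n I) = Suc m"
    using I n by auto
  moreover have "\<forall>j\<ge>s. (z + z') j = 0"
    using zr by (auto simp: z'_def s_def r'_def)
  moreover have "D \<union> D' \<subseteq> {..<max q q0}"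
    using D(1) by (auto simp: D'_def)
  moreover have "G ` (D \<union> D') \<subseteq> {..<s}"
    using GD GD' FD fD' by (fastforce simp: s_def)
  moreover have "z + z' \<in> X"
    by (rule add_in_X(1)[OF z(1) z'X])
  moreover have "real (Suc m) * ((\<kappa> / 2) powr p / 2) \<le> (\<Sum>k\<in>D \<union> D'. ?u k)"
    using total unfolding c_def .
  ultimately have "finite (insert n I) \<and> card (insert n I) = Suc m \<and> z + z' \<in> X \<and>
     nm ((\<Sum>n\<in>insert n I. y n) - (z + z')) \<le> real (Suc m) * \<epsilon> \<and>
     (\<forall>j\<ge>s. (z + z') j = 0) \<and> D \<union> D' \<subseteq> {..<max q q0} \<and> inj_on G (D \<union> D') \<and> G ` (D \<union> D') \<subseteq> {..<s} \<and>
     real (Suc m) * ((\<kappa> / 2) powr p / 2) \<le> (\<Sum>k\<in>D \<union> D'. ?u k)"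
    using err' injG by (intro conjI)
  then show ?case by (intro exI)
qed

text \<open>The images \<open>y\<^sub>n\<close> of the unit vectors under an isomorphism would have sums of norm at most
  \<open>K W\<^sub>m\<^sup>1\<^sup>/\<^sup>p\<close>, which is \<open>o(m\<^sup>1\<^sup>/\<^sup>p)\<close>, while humps add up like in \<open>\<ell>\<^sub>p\<close>.\<close>

lemma no_unit_basis_in_Y:
  fixes y :: "nat \<Rightarrow> nat \<Rightarrow> 'a::{real_normed_field,real_inner}"
  assumes yY: "\<And>n. y n \<in> Y" and "0 < \<kappa>" and low: "\<And>n. \<kappa> \<le> nm (y n)" and "0 \<le> K"
    and upper: "\<And>I c. finite I \<Longrightarrow> (\<And>n. norm (c n) \<le> 1) \<Longrightarrow>
      nm (\<Sum>n\<in>I. seq_scale (c n) (y n)) powr p \<le> K * W_sum w (card I)"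
  shows False
proof -
  have yX: "y n \<in> X" for n using yY Y_subset_X by blast
  have one: "seq_scale 1 x = x" for x :: "nat \<Rightarrow> 'a" by (simp add: seq_scale_def)
  have bdd: "nm (y n) powr p \<le> K" for n
    using upper[of "{n}" "\<lambda>_. 1"] by (simp add: one W_sum_def w_0)
  define c where "c = (\<kappa> / 2) powr p / 2"
  have c: "0 < c" using \<open>0 < \<kappa>\<close> by (simp add: c_def)
  define e where "e = c / (3 powr p * (K + 1))"
  have e: "0 < e" using c \<open>0 \<le> K\<close> by (simp add: e_def)
  obtain n0 where n0: "\<And>n. n0 \<le> n \<Longrightarrow> W_sum w n \<le> e * n"
    using W_sublinear[OF e] by blast
  obtain n1 :: nat where n1: "3 powr p / c \<le> n1"
    using real_arch_simple by blast
  define m where "m = Suc (max n0 n1)"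
  define \<epsilon> where "\<epsilon> = min (\<kappa> / 2) (1 / m)"
  have \<epsilon>: "0 < \<epsilon>" "2 * \<epsilon> \<le> \<kappa>" using \<open>0 < \<kappa>\<close> by (auto simp: \<epsilon>_def m_def)
  have m\<epsilon>: "m * \<epsilon> \<le> 1"
  proof -
    have "m * \<epsilon> \<le> m * (1 / m)" by (intro mult_left_mono) (auto simp: \<epsilon>_def)
    then show ?thesis by (simp add: m_def)
  qed
  have "\<exists>I z r F D q. finite I \<and> card I = m \<and> z \<in> X \<and> nm ((\<Sum>n\<in>I. y n) - z) \<le> m * \<epsilon> \<and>
     (\<forall>j\<ge>r. z j = 0) \<and> D \<subseteq> {..<q} \<and> inj_on F D \<and> F ` D \<subseteq> {..<r} \<and>
     m * ((\<kappa> / 2) powr p / 2) \<le> (\<Sum>n\<in>D. norm (z (F n)) powr p * w n)"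
    by (rule disjoint_humps[OF yY \<open>0 \<le> K\<close> bdd low coordinates_vanish[OF yX \<open>0 \<le> K\<close> upper] \<epsilon>])
  then obtain I z r F D q where "finite I \<and> card I = m \<and> z \<in> X \<and> nm ((\<Sum>n\<in>I. y n) - z) \<le> m * \<epsilon> \<and>
     (\<forall>j\<ge>r. z j = 0) \<and> D \<subseteq> {..<q} \<and> inj_on F D \<and> F ` D \<subseteq> {..<r} \<and>
     m * ((\<kappa> / 2) powr p / 2) \<le> (\<Sum>n\<in>D. norm (z (F n)) powr p * w n)"
    by (elim exE)
  then have I: "finite I" "card I = m" and z: "z \<in> X" "nm ((\<Sum>n\<in>I. y n) - z) \<le> m * \<epsilon>"
    and D: "D \<subseteq> {..<q}" "inj_on F D" and sum: "m * c \<le> (\<Sum>n\<in>D. norm (z (F n)) powr p * w n)"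
    unfolding c_def by simp_all
  define s where "s = (m * c) powr (1 / p)"
  have s: "0 \<le> s" "s powr p = m * c"
    using c p_pos by (auto simp: s_def powr_powr)
  have "finite D" using D(1) finite_subset by auto
  then have "m * c \<le> nm z powr p"
    using sum rearranged_sum_le[OF z(1) _ D(2)] by linarith
  then have "s \<le> nm z"
    using powr_le_powr_imp_le[of s p "nm z"] s p_pos nm_nonneg by auto
  let ?S = "\<Sum>n\<in>I. y n"
  have SX: "?S \<in> X" by (rule seq.subspace_sum[OF subspace_X]) (use yX in blast)
  have "nm z \<le> nm ?S + nm (?S - z)"
    using diff_in_X(2)[OF SX diff_in_X(1)[OF SX z(1)]] by simp
  also have "nm (?S - z) \<le> 1" using z m\<epsilon> by simp
  also have "1 \<le> s / 3"
  proof (rule powr_le_powr_imp_le[OF _ p_pos])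
    have "3 powr p \<le> n1 * c" using n1 c by (simp add: field_simps)
    also have "\<dots> \<le> m * c" using c by (simp add: m_def)
    finally have "1 \<le> m * c / 3 powr p" by simp
    then show "1 powr p \<le> (s / 3) powr p" using s by (simp add: powr_divide)
  qed (use s in simp)
  also have "nm ?S \<le> s / 3"
  proof (rule powr_le_powr_imp_le[OF _ p_pos])
    have "nm ?S powr p \<le> K * W_sum w m"
      using upper[of I "\<lambda>_. 1"] I by (simp add: one)
    also have "\<dots> \<le> (K + 1) * (e * m)"
      by (intro mult_mono n0) (use \<open>0 \<le> K\<close> W_nonneg in \<open>auto simp: m_def\<close>)
    also have "\<dots> = m * c / 3 powr p" using \<open>0 \<le> K\<close> by (simp add: e_def)
    finally show "nm ?S powr p \<le> (s / 3) powr p" using s by (simp add: powr_divide)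
  qed (use s in simp)
  finally have "s \<le> 2 * s / 3"
    using \<open>s \<le> nm z\<close> by simp
  moreover have "0 < s" using c by (simp add: s_def m_def)
  ultimately show False by simp
qed

lemma unit_combination_bound:
  fixes c :: "nat \<Rightarrow> 'a::{real_normed_field,real_inner}"
  assumes "finite I" "\<And>n. norm (c n) \<le> 1"
  shows "nm (\<Sum>n\<in>I. seq_scale (c n) (unit_seq n)) powr p \<le> W_sum w (card I)"
proof -
  have "(\<Sum>n\<in>I. seq_scale (c n) (unit_seq n)) j = (if j \<in> I then c j else 0)" for j
    using assms(1) by (simp add: sum_fun_apply seq_scale_def unit_seq_def of_bool_def if_distrib sum.delta cong: if_cong)
  then show ?thesis
    using flat_in_X(2)[of I 1 "\<Sum>n\<in>I. seq_scale (c n) (unit_seq n)"] assms by simp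
qed

theorem Y_contains_no_isomorph:
  "\<not> contains_isomorph Y nm (X :: (nat \<Rightarrow> 'a::{real_normed_field,real_inner}) set) nm"
proof
  assume "contains_isomorph Y nm (X :: (nat \<Rightarrow> 'a) set) nm"
  then obtain Z :: "(nat \<Rightarrow> 'a) set" and T where Z: "Z \<subseteq> Y" "seq.subspace Z" and T: "linear_on Z T"
    and hom: "homeomorphic_map (norm_topology Z nm) (norm_topology X nm) T"
    unfolding contains_isomorph_def linearly_homeomorphic_def by blast
  have nZ: "seq_norm Z nm" by (rule seq_norm.restrict[OF seq_norm_Y Z(2,1)])
  obtain K where K: "0 < K" "bij_betw T Z X" "\<And>x. x \<in> Z \<Longrightarrow> nm (T x) \<le> K * nm x"
    "\<And>x. x \<in> Z \<Longrightarrow> nm x \<le> K * nm (T x)"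
    using linear_homeomorphism_bounds[OF nZ seq_norm_X T hom] by blast
  have "\<exists>x\<in>Z. T x = unit_seq n" for n
    using K(2) unit_seq_in_X[of n] unfolding bij_betw_def by (metis imageE)
  then obtain y where y: "\<And>n. y n \<in> Z" "\<And>n. T (y n) = unit_seq n"
    by metis
  show False
  proof (rule no_unit_basis_in_Y)
    show "y n \<in> Y" for n using y Z by blast
    show "0 < 1 / K" using K by simp
    show "1 / K \<le> nm (y n)" for n
    proof -
      have "1 \<le> nm (unit_seq n :: nat \<Rightarrow> 'a)"
        using norm_le_nm[OF unit_seq_in_X, of n n] by (simp add: unit_seq_def)
      also have "\<dots> \<le> K * nm (y n)" using K(3)[OF y(1), of n] y by simp
      finally show ?thesis using K(1) by (simp add: field_simps)
    qed
    show "0 \<le> K powr p" by simp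
    fix I :: "nat set" and c :: "nat \<Rightarrow> 'a" assume I: "finite I" "\<And>n. norm (c n) \<le> 1"
    let ?s = "\<Sum>n\<in>I. seq_scale (c n) (y n)"
    have "?s \<in> Z"
      by (intro seq.subspace_sum[OF Z(2)] seq.subspace_scale[OF Z(2)] y)
    then have "nm ?s \<le> K * nm (T ?s)" by (rule K(4))
    also have "T ?s = (\<Sum>n\<in>I. seq_scale (c n) (unit_seq n))"
      using linear_on_sum[OF T Z(2) I(1), of y c] y by simp
    finally have "nm ?s powr p \<le> (K * nm (\<Sum>n\<in>I. seq_scale (c n) (unit_seq n))) powr p"
      by (intro powr_mono2) (use p_pos nm_nonneg in auto)
    also have "\<dots> = K powr p * nm (\<Sum>n\<in>I. seq_scale (c n) (unit_seq n)) powr p"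
      using K(1) nm_nonneg by (simp add: powr_mult)
    also have "\<dots> \<le> K powr p * W_sum w (card I)"
      by (intro mult_left_mono unit_combination_bound I) auto
    finally show "nm ?s powr p \<le> K powr p * W_sum w (card I)" .
  qed
qed

end

section \<open>Averages over signs\<close>

text \<open>A choice of signs is given by the set \<open>S\<close> of the indices with sign \<open>1\<close>, so that a mean over the
  signs on \<open>A\<close> is a sum over \<open>Pow A\<close>, divided by \<open>2\<close> to the cardinality of \<open>A\<close>.\<close>

definition sign_at :: "'i set \<Rightarrow> 'i \<Rightarrow> real" where
  "sign_at S i = (if i \<in> S then 1 else - 1)"

definition signed_sum :: "'i set \<Rightarrow> ('i \<Rightarrow> 'a::real_vector) \<Rightarrow> 'i set \<Rightarrow> 'a" where
  "signed_sum A x S = (\<Sum>i\<in>A. sign_at S i *\<^sub>R x i)"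

lemma abs_sign_at [simp]: "\<bar>sign_at S i\<bar> = 1"
  by (simp add: sign_at_def)

lemma sum_Pow_insert:
  assumes "finite A" "a \<notin> A"
  shows "(\<Sum>S\<in>Pow (insert a A). f S) = (\<Sum>S\<in>Pow A. f S + f (insert a S))"
proof -
  have inj: "inj_on (insert a) (Pow A)"
    using assms(2) by (auto simp: inj_on_def dest: insert_ident[THEN iffD1, rotated 2])
  have disj: "Pow A \<inter> insert a ` Pow A = {}"
    using assms(2) by auto
  have "(\<Sum>S\<in>Pow (insert a A). f S) = (\<Sum>S\<in>Pow A. f S) + (\<Sum>S\<in>insert a ` Pow A. f S)"
    unfolding Pow_insert by (rule sum.union_disjoint[OF _ _ disj]) (use assms(1) in auto)
  then show ?thesis
    by (simp add: sum.reindex[OF inj] sum.distrib)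
qed

lemma signed_sum_insert:
  assumes "finite A" "a \<notin> A" "S \<subseteq> A"
  shows "signed_sum (insert a A) x S = signed_sum A x S - x a"
    "signed_sum (insert a A) x (insert a S) = signed_sum A x S + x a"
proof -
  have "a \<notin> S" using assms by blast
  moreover have "(\<Sum>i\<in>A. sign_at (insert a S) i *\<^sub>R x i) = (\<Sum>i\<in>A. sign_at S i *\<^sub>R x i)"
    using assms(2) by (intro sum.cong) (auto simp: sign_at_def)
  ultimately show "signed_sum (insert a A) x S = signed_sum A x S - x a"
    "signed_sum (insert a A) x (insert a S) = signed_sum A x S + x a"
    using assms(1,2) by (auto simp: signed_sum_def sign_at_def)
qed

lemma sign_at_insert: "i \<noteq> a \<Longrightarrow> sign_at (insert a S) i = sign_at S i"
  by (simp add: sign_at_def)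

lemma mean_sign_at_signed_sum:
  fixes x :: "'i \<Rightarrow> 'a::real_vector"
  assumes "finite A" "l \<in> A"
  shows "(\<Sum>S\<in>Pow A. sign_at S l *\<^sub>R signed_sum A x S) = 2 ^ card A *\<^sub>R x l"
  using assms
proof (induction A rule: finite_induct)
  case (insert a A)
  have "(\<Sum>S\<in>Pow (insert a A). sign_at S l *\<^sub>R signed_sum (insert a A) x S)
     = (\<Sum>S\<in>Pow A. sign_at S l *\<^sub>R (signed_sum A x S - x a) + sign_at (insert a S) l *\<^sub>R (signed_sum A x S + x a))"
    unfolding sum_Pow_insert[OF insert.hyps]
    by (intro sum.cong) (use insert.hyps in \<open>auto simp: signed_sum_insert\<close>)
  also have "\<dots> = 2 ^ card (insert a A) *\<^sub>R x l"
  proof (cases "l = a")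
    case True
    have "sign_at S l *\<^sub>R (signed_sum A x S - x a) + sign_at (insert a S) l *\<^sub>R (signed_sum A x S + x a) = 2 *\<^sub>R x a"
      if "S \<in> Pow A" for S
    proof -
      have "sign_at S a = - 1" "sign_at (insert a S) a = 1"
        using that insert.hyps by (auto simp: sign_at_def)
      then show ?thesis by (simp add: True scaleR_2)
    qed
    then have "(\<Sum>S\<in>Pow A. sign_at S l *\<^sub>R (signed_sum A x S - x a) + sign_at (insert a S) l *\<^sub>R (signed_sum A x S + x a))
      = (\<Sum>S\<in>Pow A. 2 *\<^sub>R x a)"
      by (rule sum.cong[OF refl])
    then show ?thesis
      using insert.hyps True by (simp add: sum_constant_scaleR card_Pow mult.commute)
  next
    case False
    have double: "c *\<^sub>R (y - z) + c *\<^sub>R (y + z) = 2 *\<^sub>R (c *\<^sub>R y)" for c and y z :: 'a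
    proof -
      have "c *\<^sub>R (y - z) + c *\<^sub>R (y + z) = c *\<^sub>R y + c *\<^sub>R y"
        by (simp add: scaleR_diff_right scaleR_add_right)
      then show ?thesis by (simp only: scaleR_2)
    qed
    have "(\<Sum>S\<in>Pow A. sign_at S l *\<^sub>R (signed_sum A x S - x a) + sign_at (insert a S) l *\<^sub>R (signed_sum A x S + x a))
      = (\<Sum>S\<in>Pow A. 2 *\<^sub>R (sign_at S l *\<^sub>R signed_sum A x S))"
      by (rule sum.cong[OF refl]) (simp only: sign_at_insert[OF False] double)
    also have "\<dots> = 2 *\<^sub>R (\<Sum>S\<in>Pow A. sign_at S l *\<^sub>R signed_sum A x S)"
      by (simp only: scaleR_sum_right)
    also have "\<dots> = 2 *\<^sub>R (2 ^ card A *\<^sub>R x l)"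
      using insert.IH insert.prems False by simp
    finally show ?thesis using insert.hyps by simp
  qed
  finally show ?case .
qed simp

lemma mean_signed_sum_square:
  fixes x :: "'i \<Rightarrow> 'a::real_inner"
  assumes "finite A"
  shows "(\<Sum>S\<in>Pow A. (norm (signed_sum A x S))\<^sup>2) = 2 ^ card A * (\<Sum>i\<in>A. (norm (x i))\<^sup>2)"
  using assms
proof (induction A rule: finite_induct)
  case empty
  then show ?case by (simp add: signed_sum_def)
next
  case (insert a A)
  have par: "(norm (X - a))\<^sup>2 + (norm (X + a))\<^sup>2 = 2 * (norm X)\<^sup>2 + 2 * (norm a)\<^sup>2" for X a :: 'a
    by (simp add: power2_norm_eq_inner inner_add inner_diff inner_commute)
  have "(\<Sum>S\<in>Pow (insert a A). (norm (signed_sum (insert a A) x S))\<^sup>2)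
     = (\<Sum>S\<in>Pow A. 2 * (norm (signed_sum A x S))\<^sup>2 + 2 * (norm (x a))\<^sup>2)"
    unfolding sum_Pow_insert[OF insert.hyps]
    by (intro sum.cong) (use insert.hyps in \<open>auto simp: signed_sum_insert par\<close>)
  also have "\<dots> = 2 * (\<Sum>S\<in>Pow A. (norm (signed_sum A x S))\<^sup>2) + 2 ^ card A * (2 * (norm (x a))\<^sup>2)"
    using insert.hyps by (simp add: sum.distrib card_Pow sum_distrib_left)
  also have "\<dots> = 2 ^ card (insert a A) * (\<Sum>i\<in>insert a A. (norm (x i))\<^sup>2)"
    unfolding insert.IH using insert.hyps by (simp add: algebra_simps)
  finally show ?case .
qed

text \<open>Adding the summand \<open>\<plusminus>a\<close> to \<open>X\<close> doubles the sum of the fourth powers and adds at most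
  \<open>12 \<bar>a\<bar>\<^sup>2 \<bar>X\<bar>\<^sup>2 + 2 \<bar>a\<bar>\<^sup>4\<close>, which stays within the expansion of \<open>3 (\<bar>X\<bar>\<^sup>2 + \<bar>a\<bar>\<^sup>2)\<^sup>2\<close>.\<close>

lemma mean_signed_sum_fourth:
  fixes x :: "'i \<Rightarrow> 'a::real_inner"
  assumes "finite A"
  shows "(\<Sum>S\<in>Pow A. (norm (signed_sum A x S)) ^ 4) \<le> 3 * 2 ^ card A * (\<Sum>i\<in>A. (norm (x i))\<^sup>2)\<^sup>2"
  using assms
proof (induction A rule: finite_induct)
  case empty
  then show ?case by (simp add: signed_sum_def)
next
  case (insert a A)
  have four: "(norm (X - a)) ^ 4 + (norm (X + a)) ^ 4 \<le> 2 * (norm X) ^ 4 + 12 * ((norm a)\<^sup>2 * (norm X)\<^sup>2) + 2 * (norm a) ^ 4" for X a :: 'a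
  proof -
    have sq: "(norm (X - a))\<^sup>2 = ((norm X)\<^sup>2 + (norm a)\<^sup>2) - 2 * (X \<bullet> a)" "(norm (X + a))\<^sup>2 = ((norm X)\<^sup>2 + (norm a)\<^sup>2) + 2 * (X \<bullet> a)"
      by (simp_all add: power2_norm_eq_inner inner_add inner_diff inner_commute)
    have "(X \<bullet> a)\<^sup>2 \<le> (norm X)\<^sup>2 * (norm a)\<^sup>2"
      using Cauchy_Schwarz_ineq[of X a] by (simp add: power2_norm_eq_inner)
    moreover have "(norm (X - a)) ^ 4 + (norm (X + a)) ^ 4 = ((norm (X - a))\<^sup>2)\<^sup>2 + ((norm (X + a))\<^sup>2)\<^sup>2"
      by simp
    then have "(norm (X - a)) ^ 4 + (norm (X + a)) ^ 4 = 2 * ((norm X)\<^sup>2 + (norm a)\<^sup>2)\<^sup>2 + 8 * (X \<bullet> a)\<^sup>2"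
      unfolding sq by (simp add: power2_eq_square algebra_simps)
    moreover have "2 * ((norm X)\<^sup>2 + (norm a)\<^sup>2)\<^sup>2 = 2 * (norm X) ^ 4 + 4 * ((norm a)\<^sup>2 * (norm X)\<^sup>2) + 2 * (norm a) ^ 4"
      by (simp add: power2_eq_square power4_eq_xxxx algebra_simps)
    ultimately show ?thesis by (simp add: mult.commute)
  qed
  let ?s = "\<Sum>i\<in>A. (norm (x i))\<^sup>2" and ?b = "(norm (x a))\<^sup>2"
  have "(\<Sum>S\<in>Pow (insert a A). (norm (signed_sum (insert a A) x S)) ^ 4)
     \<le> (\<Sum>S\<in>Pow A. 2 * (norm (signed_sum A x S)) ^ 4 + 12 * (?b * (norm (signed_sum A x S))\<^sup>2) + 2 * (norm (x a)) ^ 4)"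
    unfolding sum_Pow_insert[OF insert.hyps]
  proof (rule sum_mono)
    fix S assume "S \<in> Pow A"
    then show "(norm (signed_sum (insert a A) x S)) ^ 4 + (norm (signed_sum (insert a A) x (insert a S))) ^ 4
      \<le> 2 * (norm (signed_sum A x S)) ^ 4 + 12 * (?b * (norm (signed_sum A x S))\<^sup>2) + 2 * (norm (x a)) ^ 4"
      using insert.hyps by (simp add: signed_sum_insert four)
  qed
  also have "\<dots> = 2 * (\<Sum>S\<in>Pow A. (norm (signed_sum A x S)) ^ 4) + 12 * (?b * (2 ^ card A * ?s)) + 2 ^ card A * (2 * (norm (x a)) ^ 4)"
    using insert.hyps by (simp add: sum.distrib card_Pow flip: sum_distrib_left mean_signed_sum_square)
  also have "\<dots> \<le> 2 * (3 * 2 ^ card A * ?s\<^sup>2) + 12 * (?b * (2 ^ card A * ?s)) + 2 ^ card A * (2 * ?b\<^sup>2)"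
    using insert.IH by simp
  also have "\<dots> \<le> 3 * 2 ^ card (insert a A) * (?s + ?b)\<^sup>2"
    using insert.hyps by (simp add: power2_eq_square algebra_simps)
  finally show ?case
    using insert.hyps by (simp add: add.commute)
qed

text \<open>Multiplying by the \<open>l\<close>-th sign and averaging leaves only the \<open>l\<close>-th summand, so each summand is
  a mean of signed sums.\<close>

lemma norm_powr_le_mean:
  fixes x :: "'i \<Rightarrow> 'a::real_normed_vector"
  assumes A: "finite A" "l \<in> A" and p: "1 \<le> p"
  shows "norm (x l) powr p \<le> (\<Sum>S\<in>Pow A. norm (signed_sum A x S) powr p) / 2 ^ card A"
proof -
  have "2 ^ card A * norm (x l) = norm (\<Sum>S\<in>Pow A. sign_at S l *\<^sub>R signed_sum A x S)"
    unfolding mean_sign_at_signed_sum[OF A] by simp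
  also have "\<dots> \<le> (\<Sum>S\<in>Pow A. norm (signed_sum A x S))"
    by (rule order_trans[OF norm_sum]) simp
  finally have "norm (x l) \<le> (\<Sum>S\<in>Pow A. norm (signed_sum A x S)) / card (Pow A)"
    using A by (simp add: card_Pow field_simps)
  then have "norm (x l) powr p \<le> ((\<Sum>S\<in>Pow A. norm (signed_sum A x S)) / card (Pow A)) powr p"
    using p by (intro powr_mono2) auto
  also have "\<dots> \<le> (\<Sum>S\<in>Pow A. norm (signed_sum A x S) powr p) / card (Pow A)"
    by (rule mean_powr_le) (use A p in auto)
  finally show ?thesis using A by (simp add: card_Pow)
qed

lemma norm_powr_half: "norm x powr p = ((norm x)\<^sup>2) powr (p / 2)"
  by (simp add: powr_powr flip: powr_numeral)

lemma mean_le_square_function: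
  fixes x :: "'i \<Rightarrow> 'a::real_inner"
  assumes A: "finite A" and p: "0 < p" "p \<le> 2"
  shows "(\<Sum>S\<in>Pow A. norm (signed_sum A x S) powr p) / 2 ^ card A \<le> (\<Sum>i\<in>A. (norm (x i))\<^sup>2) powr (p / 2)"
proof -
  have "(\<Sum>S\<in>Pow A. ((norm (signed_sum A x S))\<^sup>2) powr (p / 2)) / card (Pow A)
     \<le> ((\<Sum>S\<in>Pow A. (norm (signed_sum A x S))\<^sup>2) / card (Pow A)) powr (p / 2)"
    by (rule mean_powr_ge) (use A p in auto)
  then show ?thesis
    using A by (simp add: card_Pow mean_signed_sum_square norm_powr_half[of _ p])
qed

lemma sum_powr_le_powr_sum:
  fixes t :: "'i \<Rightarrow> real"
  assumes "finite A" "1 \<le> q" "\<And>i. i \<in> A \<Longrightarrow> 0 \<le> t i"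
  shows "(\<Sum>i\<in>A. t i powr q) \<le> (\<Sum>i\<in>A. t i) powr q"
proof -
  define s where "s = (\<Sum>i\<in>A. t i)"
  have s: "0 \<le> s" using assms by (auto simp: s_def intro: sum_nonneg)
  have split: "y powr q = y * y powr (q - 1)" if "0 \<le> y" for y :: real
    using that powr_mult_base[of y "q - 1"] by simp
  have "(\<Sum>i\<in>A. t i powr q) \<le> (\<Sum>i\<in>A. t i * s powr (q - 1))"
  proof (rule sum_mono)
    fix i assume i: "i \<in> A"
    have "t i \<le> s" unfolding s_def by (rule member_le_sum) (use assms i in auto)
    then have "t i powr (q - 1) \<le> s powr (q - 1)"
      using assms i by (intro powr_mono2) auto
    then show "t i powr q \<le> t i * s powr (q - 1)"
      using assms(3)[OF i] by (simp add: split mult_left_mono)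
  qed
  also have "\<dots> = s powr q"
    using split[OF s] by (simp add: s_def sum_distrib_right)
  finally show ?thesis by (simp add: s_def)
qed

lemma mean_ge_power_sum:
  fixes x :: "'i \<Rightarrow> 'a::real_inner"
  assumes A: "finite A" and p: "2 \<le> p"
  shows "(\<Sum>i\<in>A. norm (x i) powr p) \<le> (\<Sum>S\<in>Pow A. norm (signed_sum A x S) powr p) / 2 ^ card A"
proof -
  have "(\<Sum>i\<in>A. norm (x i) powr p) \<le> (\<Sum>i\<in>A. (norm (x i))\<^sup>2) powr (p / 2)"
    unfolding norm_powr_half[of _ p] by (rule sum_powr_le_powr_sum) (use A p in auto)
  also have "\<dots> = ((\<Sum>S\<in>Pow A. (norm (signed_sum A x S))\<^sup>2) / card (Pow A)) powr (p / 2)"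
    using A by (simp add: card_Pow mean_signed_sum_square)
  also have "\<dots> \<le> (\<Sum>S\<in>Pow A. ((norm (signed_sum A x S))\<^sup>2) powr (p / 2)) / card (Pow A)"
    by (rule mean_powr_le) (use A p in auto)
  finally show ?thesis
    using A by (simp add: card_Pow norm_powr_half[of _ p])
qed

text \<open>Khintchine's lower estimate from the fourth moment: with \<open>u = t/\<sigma>\<close>, the difference of both
  sides of the pointwise inequality \<open>t \<ge> t\<^sup>2/\<sigma> - (4/27) t\<^sup>4/\<sigma>\<^sup>3\<close> is \<open>\<sigma> u (1 - 2u/3)\<^sup>2 (1 + u/3)\<close>.\<close>

lemma mean_ge_square_function:
  fixes x :: "'i \<Rightarrow> 'a::real_inner"
  assumes A: "finite A" and p: "1 \<le> p"
  shows "(1 / 2) powr p * (\<Sum>i\<in>A. (norm (x i))\<^sup>2) powr (p / 2)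
    \<le> (\<Sum>S\<in>Pow A. norm (signed_sum A x S) powr p) / 2 ^ card A"
proof -
  define \<sigma> where "\<sigma> = sqrt (\<Sum>i\<in>A. (norm (x i))\<^sup>2)"
  have \<sigma>: "0 \<le> \<sigma>" "\<sigma>\<^sup>2 = (\<Sum>i\<in>A. (norm (x i))\<^sup>2)"
    by (auto simp: \<sigma>_def sum_nonneg)
  let ?t = "\<lambda>S. norm (signed_sum A x S)" and ?n = "2 ^ card A :: real"
  have "\<sigma> / 2 \<le> (\<Sum>S\<in>Pow A. ?t S) / ?n"
  proof (cases "\<sigma> = 0")
    case False
    then have pos: "0 < \<sigma>" using \<sigma> by simp
    have "\<sigma>\<^sup>2 * (?t S)\<^sup>2 - 4 / 27 * (?t S) ^ 4 \<le> \<sigma> ^ 3 * ?t S" for S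
    proof -
      have "\<sigma> ^ 3 * t - (\<sigma>\<^sup>2 * t\<^sup>2 - 4 / 27 * t ^ 4) = t * (\<sigma> - 2 / 3 * t)\<^sup>2 * (\<sigma> + t / 3)" for t
        by (simp add: power2_eq_square power3_eq_cube power4_eq_xxxx field_simps)
      moreover have "0 \<le> ?t S * (\<sigma> - 2 / 3 * ?t S)\<^sup>2 * (\<sigma> + ?t S / 3)"
        using \<sigma> by simp
      ultimately show ?thesis by (metis diff_ge_0_iff_ge)
    qed
    then have "(\<Sum>S\<in>Pow A. \<sigma>\<^sup>2 * (?t S)\<^sup>2 - 4 / 27 * (?t S) ^ 4) \<le> (\<Sum>S\<in>Pow A. \<sigma> ^ 3 * ?t S)"
      by (intro sum_mono)
    then have f1: "\<sigma>\<^sup>2 * (\<Sum>S\<in>Pow A. (?t S)\<^sup>2) - 4 / 27 * (\<Sum>S\<in>Pow A. (?t S) ^ 4) \<le> \<sigma> ^ 3 * (\<Sum>S\<in>Pow A. ?t S)"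
      by (simp add: sum_subtractf sum_distrib_left)
    have f2: "(\<Sum>S\<in>Pow A. (?t S) ^ 4) \<le> 3 * ?n * \<sigma> ^ 4"
      using mean_signed_sum_fourth[OF A, of x] by (simp flip: \<sigma>(2))
    have f3: "(\<Sum>S\<in>Pow A. (?t S)\<^sup>2) = ?n * \<sigma>\<^sup>2"
      by (simp add: mean_signed_sum_square[OF A] \<sigma>)
    have "\<sigma>\<^sup>2 * (?n * \<sigma>\<^sup>2) - 4 / 27 * (3 * ?n * \<sigma> ^ 4) \<le> \<sigma> ^ 3 * (\<Sum>S\<in>Pow A. ?t S)"
      using f1[unfolded f3] f2 by linarith
    moreover have "\<sigma>\<^sup>2 * (?n * \<sigma>\<^sup>2) - 4 / 27 * (3 * ?n * \<sigma> ^ 4) = 5 / 9 * (\<sigma> ^ 3 * (\<sigma> * ?n))"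
      by (simp add: power2_eq_square power3_eq_cube power4_eq_xxxx algebra_simps)
    ultimately have "5 / 9 * (\<sigma> ^ 3 * (\<sigma> * ?n)) \<le> \<sigma> ^ 3 * (\<Sum>S\<in>Pow A. ?t S)" by linarith
    moreover have "1 / 2 * (\<sigma> ^ 3 * (\<sigma> * ?n)) \<le> 5 / 9 * (\<sigma> ^ 3 * (\<sigma> * ?n))"
      using pos by (intro mult_right_mono) auto
    moreover have "\<sigma> ^ 3 * (1 / 2 * (\<sigma> * ?n)) = 1 / 2 * (\<sigma> ^ 3 * (\<sigma> * ?n))"
      by (rule mult.left_commute)
    ultimately have "\<sigma> ^ 3 * (1 / 2 * (\<sigma> * ?n)) \<le> \<sigma> ^ 3 * (\<Sum>S\<in>Pow A. ?t S)" by linarith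
    then have "1 / 2 * (\<sigma> * ?n) \<le> (\<Sum>S\<in>Pow A. ?t S)"
      using pos mult_le_cancel_left_pos[of "\<sigma> ^ 3" "1 / 2 * (\<sigma> * ?n)" "\<Sum>S\<in>Pow A. ?t S"] by simp
    then show ?thesis by (simp add: field_simps)
  qed (simp add: sum_nonneg)
  then have "(\<sigma> / 2) powr p \<le> ((\<Sum>S\<in>Pow A. ?t S) / card (Pow A)) powr p"
    using \<sigma> p A by (intro powr_mono2) (auto simp: card_Pow)
  also have "\<dots> \<le> (\<Sum>S\<in>Pow A. ?t S powr p) / card (Pow A)"
    by (rule mean_powr_le) (use A p in auto)
  finally have "(\<sigma> / 2) powr p \<le> (\<Sum>S\<in>Pow A. ?t S powr p) / ?n"
    using A by (simp add: card_Pow)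
  moreover have "(\<sigma> / 2) powr p = (1 / 2) powr p * (\<sigma>\<^sup>2) powr (p / 2)"
    using \<sigma>(1) norm_powr_half[of \<sigma> p] by (simp add: powr_divide)
  ultimately show ?thesis by (simp add: \<sigma>(2))
qed

section \<open>The space \<open>\<ell>\<^sub>p\<close>\<close>

text \<open>The \<open>p\<close>-th power of the norm is additive over the coordinates and so commutes with means over
  signs, which the norm does not.\<close>

definition ell_mass :: "real \<Rightarrow> (nat \<Rightarrow> 'a::real_normed_field) \<Rightarrow> real" where
  "ell_mass p x = (\<Sum>j. norm (x j) powr p)"

lemma ell_summable: "x \<in> ell_space p \<Longrightarrow> summable (\<lambda>j. norm (x j) powr p)"
  by (simp add: ell_space_def)


lemma ell_mass_nonneg: "x \<in> ell_space p \<Longrightarrow> 0 \<le> ell_mass p x"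
  unfolding ell_mass_def by (rule suminf_nonneg) (auto simp: ell_summable)

lemma ell_norm_nonneg: "0 \<le> ell_norm p x"
  by (simp add: ell_norm_def)

lemma ell_norm_powr: "0 < p \<Longrightarrow> x \<in> ell_space p \<Longrightarrow> ell_norm p x powr p = ell_mass p x"
  using ell_mass_nonneg[of x p] by (simp add: ell_norm_def ell_mass_def powr_powr)

lemma ell_dominated:
  assumes "0 < p" "y \<in> ell_space p" "\<And>j. norm (x j) \<le> norm (y j)"
  shows "x \<in> ell_space p"
proof -
  have "norm (x j) powr p \<le> norm (y j) powr p" for j
    using assms by (intro powr_mono2) auto
  then show ?thesis
    using summable_comparison_test'[OF ell_summable[OF assms(2)], of 0 "\<lambda>j. norm (x j) powr p"]
    by (simp add: ell_space_def)
qed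

lemma ell_add_weighted:
  fixes x y :: "nat \<Rightarrow> 'a::real_normed_field"
  assumes p: "1 \<le> p" and x: "x \<in> ell_space p" and y: "y \<in> ell_space p" and ab: "0 < a" "0 < b"
  shows "x + y \<in> ell_space p"
    "ell_mass p (x + y) \<le> (a + b) powr p * (a / (a + b) * (ell_mass p x / a powr p) + b / (a + b) * (ell_mass p y / b powr p))"
proof -
  let ?g = "\<lambda>j. (a + b) powr p * (a / (a + b) * (norm (x j) powr p / a powr p) + b / (a + b) * (norm (y j) powr p / b powr p))"
  have le: "norm ((x + y) j) powr p \<le> ?g j" for j
  proof -
    have "norm ((x + y) j) powr p \<le> (norm (x j) + norm (y j)) powr p"
      using p by (intro powr_mono2) (auto intro: norm_triangle_ineq)
    also have "\<dots> \<le> ?g j"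
      by (rule powr_add_le_weighted[OF p]) (use ab in auto)
    finally show ?thesis .
  qed
  have sg: "?g sums ((a + b) powr p * (a / (a + b) * (ell_mass p x / a powr p) + b / (a + b) * (ell_mass p y / b powr p)))"
    unfolding ell_mass_def
    by (intro sums_mult sums_add sums_divide summable_sums ell_summable x y)
  have s: "summable (\<lambda>j. norm ((x + y) j) powr p)"
    by (rule summable_comparison_test'[OF sums_summable[OF sg], of 0]) (use le in auto)
  then show "x + y \<in> ell_space p" by (simp add: ell_space_def)
  have "ell_mass p (x + y) \<le> suminf ?g"
    unfolding ell_mass_def by (rule suminf_le[OF le s sums_summable[OF sg]])
  then show "ell_mass p (x + y) \<le> (a + b) powr p * (a / (a + b) * (ell_mass p x / a powr p) + b / (a + b) * (ell_mass p y / b powr p))"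
    using sums_unique[OF sg] by simp
qed

lemma ell_scale:
  assumes "x \<in> ell_space p"
  shows "seq_scale c x \<in> ell_space p" "ell_mass p (seq_scale c x) = norm c powr p * ell_mass p x"
proof -
  have e: "(\<lambda>j. norm (seq_scale c x j) powr p) = (\<lambda>j. norm c powr p * norm (x j) powr p)"
    by (simp add: seq_scale_def norm_mult powr_mult)
  show "seq_scale c x \<in> ell_space p" "ell_mass p (seq_scale c x) = norm c powr p * ell_mass p x"
    using ell_summable[OF assms] unfolding ell_space_def ell_mass_def mem_Collect_eq e
    by (simp_all add: summable_mult suminf_mult)
qed

lemma ell_zero: "0 \<in> ell_space p"
  by (simp add: ell_space_def)

lemma subspace_ell:
  assumes p: "1 \<le> p"
  shows "seq.subspace (ell_space p :: (nat \<Rightarrow> 'a::real_normed_field) set)"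
proof (rule seq.subspaceI)
  show "x + y \<in> ell_space p" if "x \<in> ell_space p" "y \<in> ell_space p" for x y :: "nat \<Rightarrow> 'a"
    by (rule ell_add_weighted(1)[OF p that zero_less_one zero_less_one])
qed (simp_all only: ell_zero ell_scale(1))

lemma seq_norm_ell:
  assumes p: "1 \<le> p"
  shows "seq_norm (ell_space p :: (nat \<Rightarrow> 'a::{real_normed_field,real_inner}) set) (ell_norm p)"
proof
  have p0: "0 < p" using p by simp
  show "seq.subspace (ell_space p :: (nat \<Rightarrow> 'a) set)" by (rule subspace_ell[OF p])
  show "ell_norm p (0 :: nat \<Rightarrow> 'a) = 0" by (simp add: ell_norm_def)
  fix x y :: "nat \<Rightarrow> 'a" and c :: 'a
  show "0 \<le> ell_norm p x" by (rule ell_norm_nonneg)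
  show "ell_norm p (- x) = ell_norm p x" by (simp add: ell_norm_def)
  show "x = 0" if x: "x \<in> ell_space p" and "ell_norm p x = 0"
  proof -
    have "(\<Sum>j. norm (x j) powr p) = 0"
      using ell_norm_powr[OF p0 x] that p0 by (simp add: ell_mass_def)
    then have "\<forall>j. norm (x j) powr p = 0"
      using suminf_eq_zero_iff[OF ell_summable[OF x]] by simp
    then show ?thesis by (auto simp: fun_eq_iff)
  qed
  show "ell_norm p (seq_scale c x) = norm c * ell_norm p x" if x: "x \<in> ell_space p"
    using ell_scale(2)[OF x, of c] p0 ell_mass_nonneg[OF x]
    by (simp add: ell_norm_def ell_mass_def powr_mult powr_powr)
  show "ell_norm p (x + y) \<le> ell_norm p x + ell_norm p y" if x: "x \<in> ell_space p" and y: "y \<in> ell_space p"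
  proof (rule field_le_epsilon)
    fix e :: real assume e: "0 < e"
    define a where "a = ell_norm p x + e / 2"
    define b where "b = ell_norm p y + e / 2"
    have ab: "0 < a" "0 < b" "ell_norm p x \<le> a" "ell_norm p y \<le> b"
      using e ell_norm_nonneg[of p x] ell_norm_nonneg[of p y] by (auto simp: a_def b_def)
    have "ell_mass p x \<le> a powr p" "ell_mass p y \<le> b powr p"
      using powr_mono2[OF _ _ ab(3), of p] powr_mono2[OF _ _ ab(4), of p] p0
      by (auto simp: ell_norm_powr[OF p0 x, symmetric] ell_norm_powr[OF p0 y, symmetric] ell_norm_nonneg)
    then have "(a + b) powr p * (a / (a + b) * (ell_mass p x / a powr p) + b / (a + b) * (ell_mass p y / b powr p))
      \<le> (a + b) powr p * (a / (a + b) * 1 + b / (a + b) * 1)"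
      using ab by (intro mult_left_mono add_mono) auto
    also have "\<dots> = (a + b) powr p"
      using ab by (simp flip: add_divide_distrib)
    finally have "ell_norm p (x + y) powr p \<le> (a + b) powr p"
      using ell_add_weighted[OF p x y ab(1,2)] by (simp add: ell_norm_powr[OF p0])
    then have "ell_norm p (x + y) \<le> a + b"
      by (rule powr_le_powr_imp_le[OF _ p0]) (use ab in simp)
    then show "ell_norm p (x + y) \<le> ell_norm p x + ell_norm p y + e"
      by (simp add: a_def b_def)
  qed
qed

section \<open>Lines in a grid\<close>

text \<open>The index \<open>i = g q + s\<close> is the point of a grid with column \<open>g < n\<close> and height \<open>s < q\<close>.
  For a prime \<open>q \<ge> n\<close> two points lie on at most one of the \<open>q\<^sup>2\<close> lines, while each point lies on
  \<open>q\<close> of them; so the lines serve as a family of sets of size \<open>n\<close> that is random enough.\<close>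

definition line :: "nat \<Rightarrow> nat \<Rightarrow> nat \<Rightarrow> nat \<Rightarrow> nat set" where
  "line n q a c = (\<lambda>g. g * q + (a * g + c) mod q) ` {..<n}"

lemma in_line_iff:
  assumes "0 < q"
  shows "i \<in> line n q a c \<longleftrightarrow> i div q < n \<and> (a * (i div q) + c) mod q = i mod q"
proof
  assume "i \<in> line n q a c"
  then obtain g where g: "g < n" "i = g * q + (a * g + c) mod q"
    by (auto simp: line_def)
  moreover have "(a * g + c) mod q < q" using assms by simp
  ultimately have "i div q = g" "i mod q = (a * g + c) mod q" by auto
  then show "i div q < n \<and> (a * (i div q) + c) mod q = i mod q" using g by simp
next
  assume *: "i div q < n \<and> (a * (i div q) + c) mod q = i mod q"
  then have "i = (i div q) * q + (a * (i div q) + c) mod q" by simp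
  then show "i \<in> line n q a c" using * unfolding line_def by blast
qed

lemma card_line:
  assumes "0 < q"
  shows "finite (line n q a c)" "card (line n q a c) = n"
proof -
  have "inj_on (\<lambda>g. g * q + (a * g + c) mod q) {..<n}"
  proof (rule inj_onI)
    fix x y assume "x * q + (a * x + c) mod q = y * q + (a * y + c) mod q"
    then have "(x * q + (a * x + c) mod q) div q = (y * q + (a * y + c) mod q) div q" by simp
    then show "x = y" using assms by simp
  qed
  then show "finite (line n q a c)" "card (line n q a c) = n"
    by (simp_all add: line_def card_image)
qed

lemma line_subset:
  assumes "0 < q"
  shows "line n q a c \<subseteq> {..<n * q}"
  using assms by (auto simp: in_line_iff less_mult_imp_div_less div_less_iff_less_mult)

lemma lines_through_point:
  assumes "0 < q" "i < n * q"
  shows "q \<le> card {x \<in> {..<q} \<times> {..<q}. i \<in> line n q (fst x) (snd x)}"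
proof -
  define f where "f a = (a, (i mod q + (q - (a * (i div q)) mod q)) mod q)" for a
  have g: "i div q < n"
    using assms by (simp add: less_mult_imp_div_less)
  have "f ` {..<q} \<subseteq> {x \<in> {..<q} \<times> {..<q}. i \<in> line n q (fst x) (snd x)}"
  proof
    fix x assume "x \<in> f ` {..<q}"
    then obtain a where a: "a < q" "x = f a" by auto
    let ?r = "(a * (i div q)) mod q"
    have "?r \<le> q" using assms by (simp add: less_imp_le)
    have "(a * (i div q) + (i mod q + (q - ?r)) mod q) mod q = (a * (i div q) + (i mod q + (q - ?r))) mod q"
      by (rule mod_add_right_eq)
    also have "\<dots> = (?r + (i mod q + (q - ?r))) mod q"
      by (rule mod_add_left_eq[symmetric])
    also have "?r + (i mod q + (q - ?r)) = i mod q + q"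
      using \<open>?r \<le> q\<close> by linarith
    also have "(i mod q + q) mod q = i mod q"
      by (simp only: mod_add_self2 mod_mod_trivial)
    finally have "(a * (i div q) + (i mod q + (q - ?r)) mod q) mod q = i mod q" .
    then show "x \<in> {x \<in> {..<q} \<times> {..<q}. i \<in> line n q (fst x) (snd x)}"
      using a g assms by (simp add: f_def in_line_iff)
  qed
  moreover have "inj_on f {..<q}" by (auto simp: f_def inj_on_def)
  ultimately have "card {..<q} \<le> card {x \<in> {..<q} \<times> {..<q}. i \<in> line n q (fst x) (snd x)}"
    by (intro card_inj_on_le) auto
  then show ?thesis by simp
qed

lemma lines_through_two_points:
  assumes q: "prime q" and "n \<le> q" and i: "i < n * q" "j < n * q" "i \<noteq> j"
  shows "card {x \<in> {..<q} \<times> {..<q}. i \<in> line n q (fst x) (snd x) \<and> j \<in> line n q (fst x) (snd x)} \<le> 1"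
proof -
  have q0: "0 < q" using q by (simp add: prime_gt_0_nat)
  have unique: "a = b \<and> c = d"
    if lt: "a < q" "c < q" "b < q" "d < q" and on: "i \<in> line n q a c" "j \<in> line n q a c" "i \<in> line n q b d" "j \<in> line n q b d"
    for a b c d
  proof -
    define g where "g = i div q"
    define h where "h = j div q"
    have gh: "g < q" "h < q"
      using on \<open>n \<le> q\<close> by (auto simp: in_line_iff[OF q0] g_def h_def)
    have e: "(a * g + c) mod q = (b * g + d) mod q" "(a * h + c) mod q = (b * h + d) mod q"
      using on by (simp_all add: in_line_iff[OF q0] g_def h_def)
    have "g \<noteq> h"
    proof
      assume "g = h"
      then have "i mod q = j mod q" "i div q = j div q"
        using on by (auto simp: in_line_iff[OF q0] g_def h_def)
      then show False using i by (metis div_mult_mod_eq)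
    qed
    have dvd: "int q dvd (int a - int b) * int x + (int c - int d)" if "(a * x + c) mod q = (b * x + d) mod q" for x
    proof -
      have "int (a * x + c) mod int q = int (b * x + d) mod int q"
        using that by (metis of_nat_mod)
      then have "int q dvd int (a * x + c) - int (b * x + d)"
        by (simp only: mod_eq_dvd_iff)
      then show ?thesis by (simp add: algebra_simps)
    qed
    have "int q dvd ((int a - int b) * int g + (int c - int d)) - ((int a - int b) * int h + (int c - int d))"
      by (rule dvd_diff[OF dvd[OF e(1)] dvd[OF e(2)]])
    then have "int q dvd (int a - int b) * (int g - int h)"
      by (simp add: algebra_simps)
    then have "int q dvd int a - int b \<or> int q dvd int g - int h"
      using q prime_dvd_mult_iff[of "int q"] by simp
    moreover have small: "x = y" if "int q dvd int x - int y" "x < q" "y < q" for x y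
    proof -
      have "int x mod int q = int y mod int q"
        using that(1) by (simp only: mod_eq_dvd_iff)
      then show ?thesis using that by simp
    qed
    ultimately have "a = b" using \<open>g \<noteq> h\<close> gh lt by blast
    then have "int q dvd int c - int d" using dvd[OF e(1)] by simp
    then show ?thesis using small lt \<open>a = b\<close> by blast
  qed
  show ?thesis
    by (subst One_nat_def, rule card_le_Suc0_iff_eq[THEN iffD2]) (use unique in \<open>auto split: prod.splits\<close>)
qed

text \<open>If \<open>L\<close> has at most \<open>q/2\<close> points, then through each point of \<open>L\<close> there are at least \<open>q/2\<close> lines
  that meet \<open>L\<close> in this point only.\<close>

lemma sum_over_sparse_set_le_lines:
  fixes y :: "nat \<Rightarrow> real" and T :: "nat \<times> nat \<Rightarrow> real"
  assumes q: "prime q" and "n \<le> q" and y: "\<And>i. 0 \<le> y i" and T: "\<And>x. 0 \<le> T x"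
    and le: "\<And>a c i. i \<in> line n q a c \<Longrightarrow> y i \<le> T (a, c)"
    and L: "L \<subseteq> {..<n * q}" "2 * card L \<le> q"
  shows "q * (\<Sum>i\<in>L. y i) \<le> 2 * (\<Sum>x\<in>{..<q} \<times> {..<q}. T x)"
proof -
  have q0: "0 < q" using q by (simp add: prime_gt_0_nat)
  have finL: "finite L" using L(1) finite_subset by auto
  define P where "P = {..<q} \<times> {..<q}"
  define on where "on i = {x \<in> P. i \<in> line n q (fst x) (snd x)}" for i
  define G where "G i = on i - (\<Union>j\<in>L - {i}. on j)" for i
  have fin: "finite P" "finite (on i)" "finite (G i)" for i by (auto simp: P_def on_def G_def)
  have half: "real q / 2 \<le> card (G i)" if i: "i \<in> L" for i
  proof -
    have "card (on i \<inter> (\<Union>j\<in>L - {i}. on j)) \<le> (\<Sum>j\<in>L - {i}. card (on i \<inter> on j))"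
      unfolding Int_UN_distrib by (rule card_UN_le) (use finL in simp)
    also have "\<dots> \<le> (\<Sum>j\<in>L - {i}. 1)"
    proof (rule sum_mono)
      fix j assume j: "j \<in> L - {i}"
      have "on i \<inter> on j = {x \<in> {..<q} \<times> {..<q}. i \<in> line n q (fst x) (snd x) \<and> j \<in> line n q (fst x) (snd x)}"
        by (auto simp: on_def P_def)
      then show "card (on i \<inter> on j) \<le> 1"
        using lines_through_two_points[OF q \<open>n \<le> q\<close>, of i j] i j L(1) by auto
    qed
    also have "\<dots> = card L - 1" using i finL by simp
    finally have "card (on i \<inter> (\<Union>j\<in>L - {i}. on j)) \<le> card L - 1" .
    moreover have "q \<le> card (on i)"
      using lines_through_point[OF q0, of i n] i L(1) unfolding on_def P_def by blast
    moreover have "card (G i) = card (on i) - card (on i \<inter> (\<Union>j\<in>L - {i}. on j))"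
      unfolding G_def by (rule card_Diff_subset_Int) (use fin finL in auto)
    ultimately have "q \<le> 2 * card (G i)" using L(2) by linarith
    then show ?thesis by linarith
  qed
  have "q * (\<Sum>i\<in>L. y i) = 2 * (\<Sum>i\<in>L. real q / 2 * y i)"
    by (simp add: sum_distrib_left)
  also have "(\<Sum>i\<in>L. real q / 2 * y i) \<le> (\<Sum>i\<in>L. \<Sum>x\<in>G i. T x)"
  proof (rule sum_mono)
    fix i assume i: "i \<in> L"
    have "real q / 2 * y i \<le> card (G i) * y i"
      using half[OF i] y[of i] by (rule mult_right_mono)
    also have "\<dots> = (\<Sum>x\<in>G i. y i)" by simp
    also have "\<dots> \<le> (\<Sum>x\<in>G i. T x)"
      by (rule sum_mono) (auto simp: G_def on_def intro: le)
    finally show "real q / 2 * y i \<le> (\<Sum>x\<in>G i. T x)" .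
  qed
  also have "(\<Sum>i\<in>L. \<Sum>x\<in>G i. T x) = (\<Sum>x\<in>(\<Union>i\<in>L. G i). T x)"
    by (rule sum.UNION_disjoint[symmetric]) (use finL fin in \<open>auto simp: G_def\<close>)
  also have "\<dots> \<le> (\<Sum>x\<in>P. T x)"
    by (rule sum_mono2) (use fin T in \<open>auto simp: G_def on_def\<close>)
  finally show ?thesis by (simp add: P_def)
qed

section \<open>Finite biorthogonal systems in \<open>\<ell>\<^sub>p\<close>\<close>

text \<open>In the application \<open>u\<^sub>i\<close> are the images of the basis vectors of a Lorentz space with weights \<open>v\<close>
  under an isomorphism into \<open>\<ell>\<^sub>p\<close>, \<open>\<phi>\<^sub>i\<close> are coordinate functionals of the inverse, composed with a projection
  onto the image, and \<open>C\<close> is the \<open>p\<close>-th power of a bound for both maps.  The two estimates come from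
  the Lorentz norm of signed indicators and from the rearranged sums below a Lorentz norm.\<close>

locale ell_system =
  fixes p C :: real and v :: "nat \<Rightarrow> real" and m :: nat
    and u :: "nat \<Rightarrow> nat \<Rightarrow> 'a::{real_normed_field,real_inner}" and \<phi> :: "nat \<Rightarrow> (nat \<Rightarrow> 'a) \<Rightarrow> 'a"
  assumes p: "1 \<le> p" and C: "0 < C" and v_0: "v 0 = 1" and v_nonneg: "0 \<le> v i"
    and u: "i < m \<Longrightarrow> u i \<in> ell_space p"
    and \<phi>_add: "i < m \<Longrightarrow> x \<in> ell_space p \<Longrightarrow> y \<in> ell_space p \<Longrightarrow> \<phi> i (x + y) = \<phi> i x + \<phi> i y"
    and \<phi>_scale: "i < m \<Longrightarrow> x \<in> ell_space p \<Longrightarrow> \<phi> i (seq_scale c x) = c * \<phi> i x"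
    and biorthogonal: "i < m \<Longrightarrow> j < m \<Longrightarrow> \<phi> i (u j) = of_bool (i = j)"
    and upper: "A \<subseteq> {..<m} \<Longrightarrow> ell_mass p (\<lambda>j. signed_sum A (\<lambda>i. u i j) S) \<le> C * (\<Sum>i<card A. v i)"
    and lower: "y \<in> ell_space p \<Longrightarrow> inj_on \<iota> {..<n} \<Longrightarrow> \<iota> ` {..<n} \<subseteq> {..<m} \<Longrightarrow>
      (\<Sum>l<n. norm (\<phi> (\<iota> l) y) powr p * v l) \<le> C * ell_mass p y"
begin

lemma p_pos: "0 < p"
  using p by simp

lemma signed_sum_eq: "(\<lambda>j. signed_sum A (\<lambda>i. x i j) S) = (\<Sum>i\<in>A. seq_scale (of_real (sign_at S i)) (x i))"
  for x :: "'i \<Rightarrow> nat \<Rightarrow> 'a"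
  by (simp add: fun_eq_iff signed_sum_def sum_fun_apply seq_scale_def scaleR_conv_of_real)

lemma signed_sum_in_ell:
  assumes "\<And>i. i \<in> A \<Longrightarrow> x i \<in> ell_space p"
  shows "(\<lambda>j. signed_sum A (\<lambda>i. x i j) S) \<in> (ell_space p :: (nat \<Rightarrow> 'a) set)"
  unfolding signed_sum_eq
  by (rule seq.subspace_sum[OF subspace_ell[OF p]]) (rule ell_scale(1)[OF assms])

lemma \<phi>_signed_sum:
  assumes "k < m" "finite A" "\<And>i. i \<in> A \<Longrightarrow> x i \<in> ell_space p"
  shows "\<phi> k (\<lambda>j. signed_sum A (\<lambda>i. x i j) S) = signed_sum A (\<lambda>i. \<phi> k (x i)) S"
  unfolding signed_sum_eq using assms(2,3)
proof (induction A rule: finite_induct)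
  case empty
  have "\<phi> k (seq_scale 0 0) = 0"
    using \<phi>_scale[OF assms(1) ell_zero, of 0] by simp
  moreover have "seq_scale 0 0 = (0 :: nat \<Rightarrow> 'a)" by (simp add: seq_scale_def fun_eq_iff)
  ultimately show ?case by (simp only: sum.empty signed_sum_def)
next
  case (insert a A)
  let ?s = "\<Sum>i\<in>A. seq_scale (of_real (sign_at S i)) (x i)"
  have "?s \<in> ell_space p"
    by (rule seq.subspace_sum[OF subspace_ell[OF p]]) (rule ell_scale(1)[OF insert.prems], simp)
  then have "\<phi> k (seq_scale (of_real (sign_at S a)) (x a) + ?s) = of_real (sign_at S a) * \<phi> k (x a) + \<phi> k ?s"
    by (simp only: \<phi>_add[OF assms(1) ell_scale(1)[OF insert.prems[OF insertI1]]] \<phi>_scale[OF assms(1) insert.prems[OF insertI1]])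
  moreover have "\<phi> k ?s = signed_sum A (\<lambda>i. \<phi> k (x i)) S"
    using insert by blast
  moreover have "signed_sum (insert a A) (\<lambda>i. \<phi> k (x i)) S = of_real (sign_at S a) * \<phi> k (x a) + signed_sum A (\<lambda>i. \<phi> k (x i)) S"
    unfolding signed_sum_def sum.insert[OF insert.hyps] by (simp only: scaleR_conv_of_real)
  ultimately show ?case
    unfolding sum.insert[OF insert.hyps] by (simp only:)
qed

lemma sum_mass_signed_sums:
  assumes "finite A" "\<And>i. i \<in> A \<Longrightarrow> x i \<in> (ell_space p :: (nat \<Rightarrow> 'a) set)"
  shows "(\<lambda>j. (\<Sum>S\<in>Pow A. norm (signed_sum A (\<lambda>i. x i j) S) powr p) / 2 ^ card A) sums
    ((\<Sum>S\<in>Pow A. ell_mass p (\<lambda>j. signed_sum A (\<lambda>i. x i j) S)) / 2 ^ card A)"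
  unfolding ell_mass_def
  by (intro sums_divide sums_sum summable_sums ell_summable signed_sum_in_ell assms(2))

lemma mean_mass_le:
  assumes A: "A \<subseteq> {..<m}"
  shows "(\<Sum>S\<in>Pow A. ell_mass p (\<lambda>j. signed_sum A (\<lambda>i. u i j) S)) / 2 ^ card A \<le> C * (\<Sum>i<card A. v i)"
proof -
  have fin: "finite A" using A finite_subset by auto
  have "(\<Sum>S\<in>Pow A. ell_mass p (\<lambda>j. signed_sum A (\<lambda>i. u i j) S)) \<le> (\<Sum>S\<in>Pow A. C * (\<Sum>i<card A. v i))"
    by (intro sum_mono upper A)
  then show ?thesis
    using fin by (simp add: card_Pow field_simps)
qed

lemma \<phi>_bound:
  assumes "k < m" "y \<in> ell_space p"
  shows "norm (\<phi> k y) powr p \<le> C * ell_mass p y"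
proof -
  have "inj_on (\<lambda>_. k) {..<1::nat}" "(\<lambda>_. k) ` {..<1::nat} \<subseteq> {..<m}"
    using assms(1) by (auto simp: inj_on_def)
  from lower[OF assms(2) this] show ?thesis by (simp add: v_0)
qed

lemma mass_u_ge: "i < m \<Longrightarrow> 1 \<le> C * ell_mass p (u i)"
  using \<phi>_bound[of i "u i"] by (simp add: u biorthogonal)

lemma mass_u_le: "i < m \<Longrightarrow> ell_mass p (u i) \<le> C"
  using upper[of "{i}" "{i}"] by (simp add: signed_sum_def sign_at_def v_0)

lemma sum_mass: "A \<subseteq> {..<m} \<Longrightarrow> (\<lambda>j. \<Sum>i\<in>A. norm (u i j) powr p) sums (\<Sum>i\<in>A. ell_mass p (u i))"
  unfolding ell_mass_def by (intro sums_sum summable_sums ell_summable u) auto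

text \<open>For \<open>p \<ge> 2\<close> the space \<open>\<ell>\<^sub>p\<close> has cotype \<open>p\<close>.\<close>

lemma count_le_weights:
  assumes "2 \<le> p"
  shows "real m \<le> C\<^sup>2 * (\<Sum>i<m. v i)"
proof -
  have "real m = (\<Sum>i<m. 1)" by simp
  also have "\<dots> \<le> (\<Sum>i<m. C * ell_mass p (u i))"
    by (rule sum_mono) (use mass_u_ge in auto)
  also have "\<dots> = C * (\<Sum>i<m. ell_mass p (u i))"
    by (simp add: sum_distrib_left)
  also have "(\<Sum>i<m. ell_mass p (u i)) \<le> (\<Sum>S\<in>Pow {..<m}. ell_mass p (\<lambda>j. signed_sum {..<m} (\<lambda>i. u i j) S)) / 2 ^ card {..<m}"
    by (rule sums_le[OF mean_ge_power_sum[OF finite_lessThan assms] sum_mass sum_mass_signed_sums]) (use u in auto)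
  also have "\<dots> \<le> C * (\<Sum>i<m. v i)"
    using mean_mass_le[of "{..<m}"] by simp
  finally show ?thesis using C by (simp add: power2_eq_square mult.assoc)
qed

text \<open>For \<open>p \<le> 2\<close> it has cotype 2.\<close>

lemma square_root_growth:
  assumes "p \<le> 2" "n \<le> m" "1 \<le> n"
  shows "real n powr (p / 2) \<le> 2 powr p * C\<^sup>2 * (\<Sum>i<n. v i)"
proof -
  let ?A = "{..<n}"
  have A: "?A \<subseteq> {..<m}" using assms by auto
  let ?c = "(1 / 2) powr p * real n powr (p / 2)"
  have le: "?c * ((\<Sum>i<n. norm (u i j) powr p) / n) \<le> (\<Sum>S\<in>Pow ?A. norm (signed_sum ?A (\<lambda>i. u i j) S) powr p) / 2 ^ card ?A" for j
  proof -
    have "(\<Sum>i\<in>?A. ((norm (u i j))\<^sup>2) powr (p / 2)) / card ?A \<le> ((\<Sum>i\<in>?A. (norm (u i j))\<^sup>2) / card ?A) powr (p / 2)"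
      by (rule mean_powr_ge) (use assms p in \<open>auto simp: lessThan_empty_iff\<close>)
    then have "(\<Sum>i<n. norm (u i j) powr p) / n \<le> ((\<Sum>i<n. (norm (u i j))\<^sup>2) / n) powr (p / 2)"
      by (simp add: norm_powr_half[of _ p])
    then have "?c * ((\<Sum>i<n. norm (u i j) powr p) / n) \<le> ?c * ((\<Sum>i<n. (norm (u i j))\<^sup>2) / n) powr (p / 2)"
      by (intro mult_left_mono) auto
    also have "\<dots> = (1 / 2) powr p * (\<Sum>i\<in>?A. (norm (u i j))\<^sup>2) powr (p / 2)"
      using assms by (simp add: powr_divide)
    also have "\<dots> \<le> (\<Sum>S\<in>Pow ?A. norm (signed_sum ?A (\<lambda>i. u i j) S) powr p) / 2 ^ card ?A"
      by (rule mean_ge_square_function) (use p in auto)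
    finally show ?thesis .
  qed
  have "?c * ((\<Sum>i<n. ell_mass p (u i)) / n) \<le> (\<Sum>S\<in>Pow ?A. ell_mass p (\<lambda>j. signed_sum ?A (\<lambda>i. u i j) S)) / 2 ^ card ?A"
    by (rule sums_le[OF le sums_mult[OF sums_divide[OF sum_mass[OF A]]] sum_mass_signed_sums]) (use u A in auto)
  also have "\<dots> \<le> C * (\<Sum>i<n. v i)"
    using mean_mass_le[OF A] by simp
  finally have 1: "?c * ((\<Sum>i<n. ell_mass p (u i)) / n) \<le> C * (\<Sum>i<n. v i)" .
  have "(\<Sum>i<n. 1 / C) \<le> (\<Sum>i<n. ell_mass p (u i))"
  proof (rule sum_mono)
    fix i assume "i \<in> {..<n}"
    then show "1 / C \<le> ell_mass p (u i)"
      using mass_u_ge[of i] A C by (simp add: field_simps)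
  qed
  then have "1 / C \<le> (\<Sum>i<n. ell_mass p (u i)) / n"
    using assms C by (simp add: field_simps)
  then have "?c * (1 / C) \<le> C * (\<Sum>i<n. v i)"
    using 1 mult_left_mono[of "1 / C" "(\<Sum>i<n. ell_mass p (u i)) / n" ?c] by simp
  then have "2 powr p * C * (?c * (1 / C)) \<le> 2 powr p * C * (C * (\<Sum>i<n. v i))"
    using C by (intro mult_left_mono) auto
  moreover have "2 powr p * C * (?c * (1 / C)) = real n powr (p / 2)"
    using C by (simp add: powr_divide)
  ultimately show ?thesis by (simp add: power2_eq_square mult_ac)
qed

text \<open>Where \<open>\<bar>u\<^sub>i(j)\<bar>\<^sup>p\<close> exceeds \<open>2n\<close> times its mean over \<open>i\<close>, the vectors act as if disjoint: for
  every \<open>j\<close> these \<open>i\<close> are sparse, so most lines through such an \<open>i\<close> contain no other one, and on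
  each line the signed sums dominate every single term.\<close>

lemma mass_of_large_parts:
  assumes q: "prime q" and n: "n \<le> q" and m: "m = n * q"
    and big: "\<And>i j. i < m \<Longrightarrow> big i j = (if 2 * (\<Sum>k<m. norm (u k j) powr p) < q * norm (u i j) powr p then u i j else 0)"
  shows "(\<Sum>i<m. ell_mass p (big i)) \<le> 2 * real q * C * (\<Sum>i<n. v i)"
proof -
  have q0: "0 < q" using q by (simp add: prime_gt_0_nat)
  let ?P = "{..<q} \<times> {..<q}"
  define ln where "ln x = line n q (fst x) (snd x)" for x
  have ln: "finite (ln x)" "card (ln x) = n" "ln x \<subseteq> {..<m}" for x
    using card_line[OF q0] line_subset[OF q0] by (auto simp: ln_def m)
  define T where "T j x = (\<Sum>S\<in>Pow (ln x). norm (signed_sum (ln x) (\<lambda>i. u i j) S) powr p) / 2 ^ card (ln x)" for j x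
  have big_ell: "big i \<in> ell_space p" if "i < m" for i
    by (rule ell_dominated[OF p_pos u[OF that]]) (simp add: big[OF that])
  have pointwise: "q * (\<Sum>i<m. norm (big i j) powr p) \<le> 2 * (\<Sum>x\<in>?P. T j x)" for j
  proof -
    let ?y = "\<lambda>i. norm (u i j) powr p"
    define tot where "tot = (\<Sum>k<m. ?y k)"
    define L where "L = {i\<in>{..<m}. 2 * tot < q * ?y i}"
    have tot: "0 \<le> tot" by (simp add: tot_def sum_nonneg)
    have "2 * card L \<le> q"
    proof (cases "tot = 0")
      case True
      then have "\<forall>i\<in>{..<m}. ?y i = 0"
        unfolding tot_def by (subst (asm) sum_nonneg_eq_0_iff) auto
      then have "L = {}" using True by (auto simp: L_def)
      then show ?thesis by simp
    next
      case False
      have "real (card L) * (2 * tot) = (\<Sum>i\<in>L. 2 * tot)" by simp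
      also have "\<dots> \<le> (\<Sum>i\<in>L. q * ?y i)" by (rule sum_mono) (auto simp: L_def)
      also have "\<dots> = q * (\<Sum>i\<in>L. ?y i)" by (simp add: sum_distrib_left)
      also have "\<dots> \<le> q * tot"
        unfolding tot_def by (intro mult_left_mono sum_mono2) (auto simp: L_def)
      finally have "(2 * real (card L)) * tot \<le> real q * tot" by simp
      then have "2 * real (card L) \<le> real q"
        using False tot by simp
      then show ?thesis by linarith
    qed
    then have "q * (\<Sum>i\<in>L. ?y i) \<le> 2 * (\<Sum>x\<in>?P. T j x)"
    proof (intro sum_over_sparse_set_le_lines[OF q n])
      show "0 \<le> T j x" for x by (simp add: T_def sum_nonneg)
      show "?y i \<le> T j (a, c)" if "i \<in> line n q a c" for a c i
        unfolding T_def by (rule norm_powr_le_mean) (use ln that p in \<open>auto simp: ln_def\<close>)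
      show "L \<subseteq> {..<n * q}" by (auto simp: L_def m)
    qed auto
    moreover have "(\<Sum>i<m. norm (big i j) powr p) = (\<Sum>i\<in>L. ?y i)"
      by (rule sum.mono_neutral_cong_right) (auto simp: L_def tot_def big p_pos)
    ultimately show ?thesis by simp
  qed
  have "real q * (\<Sum>i<m. ell_mass p (big i)) \<le> 2 * (\<Sum>x\<in>?P. (\<Sum>S\<in>Pow (ln x). ell_mass p (\<lambda>j. signed_sum (ln x) (\<lambda>i. u i j) S)) / 2 ^ card (ln x))"
  proof (rule sums_le[OF pointwise])
    show "(\<lambda>j. real q * (\<Sum>i<m. norm (big i j) powr p)) sums (real q * (\<Sum>i<m. ell_mass p (big i)))"
      unfolding ell_mass_def by (intro sums_mult sums_sum summable_sums ell_summable big_ell) auto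
    show "(\<lambda>j. 2 * (\<Sum>x\<in>?P. T j x)) sums
      (2 * (\<Sum>x\<in>?P. (\<Sum>S\<in>Pow (ln x). ell_mass p (\<lambda>j. signed_sum (ln x) (\<lambda>i. u i j) S)) / 2 ^ card (ln x)))"
      unfolding T_def using ln(3) by (intro sums_mult sums_sum sum_mass_signed_sums ln(1) u) auto
  qed
  also have "\<dots> \<le> 2 * (\<Sum>x\<in>?P. C * (\<Sum>i<n. v i))"
    using mean_mass_le[OF ln(3)] by (intro mult_left_mono sum_mono) (simp_all add: ln(2))
  also have "\<dots> = real q * (2 * real q * C * (\<Sum>i<n. v i))"
    by simp
  finally show ?thesis
    using q0 by simp
qed

text \<open>Without the large parts the vectors are dominated by one function of \<open>\<ell>\<^sub>p\<close>, so that their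
  combinations obey an upper \<open>\<ell>\<^sub>2\<close> estimate.  Half of the functionals still see the remainders, and
  averaging over signs extracts the diagonal of their matrix.  The constant does not depend on
  \<open>q\<close>, that is, on the number of vectors.\<close>

lemma upper_square_estimate:
  fixes \<beta> :: "nat \<Rightarrow> real"
  assumes q: "prime q" and n: "n \<le> q" "1 \<le> n" and m: "m = n * q" and "p \<le> 2"
    and small: "4 * 2 powr p * C\<^sup>2 * (\<Sum>i<n. v i) \<le> n" and k: "2 * k \<le> q"
  shows "(\<Sum>l<k. v l * \<bar>\<beta> l\<bar> powr p) \<le> 2 powr p * C * (2 * real n * C) * (\<Sum>l<k. (\<beta> l)\<^sup>2) powr (p / 2)"
proof -
  have q0: "0 < q" using q by (simp add: prime_gt_0_nat)
  define large where "large i j \<longleftrightarrow> 2 * (\<Sum>k<m. norm (u k j) powr p) < q * norm (u i j) powr p" for i j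
  define big where "big i j = (if large i j then u i j else 0)" for i j
  define rest where "rest i j = (if large i j then 0 else u i j)" for i j
  have big_ell: "big i \<in> ell_space p" and rest_ell: "rest i \<in> ell_space p" if "i < m" for i
    using ell_dominated[OF p_pos u[OF that], of "big i"] ell_dominated[OF p_pos u[OF that], of "rest i"]
    by (auto simp: big_def rest_def)
  have mass: "(\<Sum>i<m. ell_mass p (big i)) \<le> 2 * real q * C * (\<Sum>i<n. v i)"
    by (rule mass_of_large_parts[OF q n(1) m]) (auto simp: big_def large_def)
  \<comment> \<open>The common bound for the remainders.\<close>
  define h where "h j = 2 / q * (\<Sum>k<m. norm (u k j) powr p)" for j
  have rest_h: "norm (rest i j) powr p \<le> h j" if "i < m" for i j
    using q0 p_pos by (auto simp: rest_def large_def h_def not_less field_simps sum_nonneg)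
  have h_sums: "h sums (2 / q * (\<Sum>k<m. ell_mass p (u k)))"
    unfolding h_def by (intro sums_mult sum_mass) simp
  have h_mass: "2 / q * (\<Sum>k<m. ell_mass p (u k)) \<le> 2 * real n * C"
  proof -
    have "(\<Sum>k<m. ell_mass p (u k)) \<le> (\<Sum>k<m. C)"
      by (rule sum_mono) (use mass_u_le in auto)
    then have "2 / q * (\<Sum>k<m. ell_mass p (u k)) \<le> 2 / q * (real m * C)"
      by (intro mult_left_mono) auto
    then show ?thesis using q0 by (simp add: m)
  qed
  \<comment> \<open>For these indices the functional is at most \<open>1/2\<close> at the large part, by \<open>\<phi>_bound\<close>.\<close>
  define G where "G = {i\<in>{..<m}. C * ell_mass p (big i) \<le> (1 / 2) powr p}"
  have "2 * k \<le> 2 * card G"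
  proof -
    let ?B = "{..<m} - G"
    have "card ?B * (1 / 2) powr p = (\<Sum>i\<in>?B. (1 / 2) powr p)" by simp
    also have "\<dots> \<le> (\<Sum>i\<in>?B. C * ell_mass p (big i))"
      by (rule sum_mono) (auto simp: G_def)
    also have "\<dots> \<le> (\<Sum>i<m. C * ell_mass p (big i))"
      by (rule sum_mono2) (auto intro!: mult_nonneg_nonneg ell_mass_nonneg big_ell less_imp_le[OF C])
    also have "\<dots> = C * (\<Sum>i<m. ell_mass p (big i))" by (simp add: sum_distrib_left)
    also have "\<dots> \<le> C * (2 * real q * C * (\<Sum>i<n. v i))"
      by (rule mult_left_mono[OF mass]) (use C in simp)
    finally have "card ?B * (1 / 2) powr p * (2 * 2 powr p) \<le> C * (2 * real q * C * (\<Sum>i<n. v i)) * (2 * 2 powr p)"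
      by (rule mult_right_mono) simp
    also have "\<dots> = q * (4 * 2 powr p * C\<^sup>2 * (\<Sum>i<n. v i))"
      by (simp add: power2_eq_square)
    also have "\<dots> \<le> q * real n"
      by (rule mult_left_mono[OF small]) simp
    finally have "card ?B * (1 / 2) powr p * (2 * 2 powr p) \<le> q * real n" .
    moreover have "(1 / 2) powr p * (2 powr p) = 1" by (simp add: powr_divide)
    then have "card ?B * (1 / 2) powr p * (2 * 2 powr p) = 2 * card ?B" by simp
    ultimately have "real (2 * card ?B) \<le> real (q * n)" by simp
    then have "2 * card ?B \<le> m" by (simp only: of_nat_le_iff m mult.commute)
    moreover have "card ?B = m - card G"
      by (subst card_Diff_subset) (auto simp: G_def)
    moreover have "q \<le> m" using n by (simp add: m)
    ultimately show ?thesis using k by linarith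
  qed
  then have "k \<le> card G" by simp
  moreover have "finite G" by (simp add: G_def)
  ultimately obtain G' where G': "G' \<subseteq> G" "card G' = k" "finite G'"
    using obtain_subset_with_card_n by metis
  then obtain \<iota> where \<iota>: "bij_betw \<iota> {..<k} G'"
    using ex_bij_betw_nat_finite[OF G'(3)] by (auto simp: atLeast0LessThan)
  have inj: "inj_on \<iota> {..<k}" and \<iota>G: "\<iota> l \<in> G" if "l < k" for l
    using \<iota> G' that by (auto simp: bij_betw_def)
  have \<iota>m: "\<iota> l < m" if "l < k" for l using \<iota>G[OF that] by (simp add: G_def)
  have half: "1 / 2 \<le> norm (\<phi> (\<iota> l) (rest (\<iota> l)))" if l: "l < k" for l
  proof -
    let ?i = "\<iota> l"
    have "norm (\<phi> ?i (big ?i)) powr p \<le> (1 / 2) powr p"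
      using \<phi>_bound[OF \<iota>m[OF l] big_ell[OF \<iota>m[OF l]]] \<iota>G[OF l] by (simp add: G_def)
    then have "norm (\<phi> ?i (big ?i)) \<le> 1 / 2"
      by (rule powr_le_powr_imp_le[OF _ p_pos]) simp
    moreover have "u ?i = big ?i + rest ?i" by (auto simp: fun_eq_iff big_def rest_def)
    then have "1 = \<phi> ?i (big ?i) + \<phi> ?i (rest ?i)"
      using biorthogonal[OF \<iota>m[OF l] \<iota>m[OF l]] \<phi>_add[OF \<iota>m[OF l] big_ell rest_ell, OF \<iota>m[OF l] \<iota>m[OF l]] by simp
    then have "1 \<le> norm (\<phi> ?i (big ?i)) + norm (\<phi> ?i (rest ?i))"
      by (metis norm_one norm_triangle_ineq)
    ultimately show ?thesis by linarith
  qed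
  define x where "x l = seq_scale (of_real (\<beta> l)) (rest (\<iota> l))" for l
  have x_ell: "x l \<in> ell_space p" if "l \<in> {..<k}" for l
    using ell_scale(1)[OF rest_ell[OF \<iota>m]] that by (simp add: x_def)
  let ?n = "2 ^ card {..<k} :: real"
  let ?y = "\<lambda>S j. signed_sum {..<k} (\<lambda>l. x l j) S"
  have y_ell: "?y S \<in> ell_space p" for S
    by (rule signed_sum_in_ell[OF x_ell])
  have diag: "v l * \<bar>\<beta> l\<bar> powr p * (1 / 2) powr p \<le> (\<Sum>S\<in>Pow {..<k}. norm (\<phi> (\<iota> l) (?y S)) powr p * v l) / ?n"
    if l: "l \<in> {..<k}" for l
  proof -
    have "\<bar>\<beta> l\<bar> * (1 / 2) \<le> norm (\<phi> (\<iota> l) (x l))"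
      using half[of l] l \<phi>_scale[OF \<iota>m rest_ell[OF \<iota>m], of l] mult_left_mono[of "1 / 2" "norm (\<phi> (\<iota> l) (rest (\<iota> l)))" "\<bar>\<beta> l\<bar>"]
      by (simp add: x_def norm_mult)
    then have "(\<bar>\<beta> l\<bar> * (1 / 2)) powr p \<le> norm (\<phi> (\<iota> l) (x l)) powr p"
      using p_pos by (intro powr_mono2) auto
    also have "\<dots> \<le> (\<Sum>S\<in>Pow {..<k}. norm (signed_sum {..<k} (\<lambda>i. \<phi> (\<iota> l) (x i)) S) powr p) / ?n"
      by (rule norm_powr_le_mean) (use l p in auto)
    also have "\<dots> = (\<Sum>S\<in>Pow {..<k}. norm (\<phi> (\<iota> l) (?y S)) powr p) / ?n"
    proof -
      have "\<phi> (\<iota> l) (?y S) = signed_sum {..<k} (\<lambda>i. \<phi> (\<iota> l) (x i)) S" for S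
        by (rule \<phi>_signed_sum[OF \<iota>m _ x_ell]) (use l in auto)
      then show ?thesis by (simp only:)
    qed
    finally have "v l * (\<bar>\<beta> l\<bar> * (1 / 2)) powr p \<le> v l * ((\<Sum>S\<in>Pow {..<k}. norm (\<phi> (\<iota> l) (?y S)) powr p) / ?n)"
      by (rule mult_left_mono[OF _ v_nonneg])
    moreover have "v l * ((\<Sum>S\<in>Pow {..<k}. norm (\<phi> (\<iota> l) (?y S)) powr p) / ?n)
        = (\<Sum>S\<in>Pow {..<k}. norm (\<phi> (\<iota> l) (?y S)) powr p * v l) / ?n"
      by (simp only: sum_distrib_right[symmetric] times_divide_eq_right mult.commute[of "v l"])
    moreover have "v l * (\<bar>\<beta> l\<bar> * (1 / 2)) powr p = v l * \<bar>\<beta> l\<bar> powr p * (1 / 2) powr p"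
      by (simp only: powr_mult mult.assoc)
    ultimately show ?thesis by (simp only:)
  qed
  have "(\<Sum>l<k. v l * \<bar>\<beta> l\<bar> powr p * (1 / 2) powr p) \<le> (\<Sum>l<k. (\<Sum>S\<in>Pow {..<k}. norm (\<phi> (\<iota> l) (?y S)) powr p * v l) / ?n)"
    by (rule sum_mono[OF diag])
  also have "\<dots> = (\<Sum>S\<in>Pow {..<k}. (\<Sum>l<k. norm (\<phi> (\<iota> l) (?y S)) powr p * v l)) / ?n"
    unfolding sum_divide_distrib[symmetric] by (subst sum.swap) simp
  also have "\<dots> \<le> (\<Sum>S\<in>Pow {..<k}. C * ell_mass p (?y S)) / ?n"
    by (intro divide_right_mono sum_mono lower y_ell) (use inj \<iota>m in \<open>auto simp: inj_on_def\<close>)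
  also have "\<dots> = C * ((\<Sum>S\<in>Pow {..<k}. ell_mass p (?y S)) / ?n)"
    by (simp add: sum_distrib_left)
  also have "\<dots> \<le> C * ((\<Sum>l<k. (\<beta> l)\<^sup>2) powr (p / 2) * (2 / q * (\<Sum>k<m. ell_mass p (u k))))"
  proof (rule mult_left_mono[OF sums_le])
    show "(\<lambda>j. (\<Sum>S\<in>Pow {..<k}. norm (?y S j) powr p) / ?n) sums ((\<Sum>S\<in>Pow {..<k}. ell_mass p (?y S)) / ?n)"
      by (rule sum_mass_signed_sums[OF _ x_ell]) auto
    show "(\<lambda>j. (\<Sum>l<k. (\<beta> l)\<^sup>2) powr (p / 2) * h j) sums ((\<Sum>l<k. (\<beta> l)\<^sup>2) powr (p / 2) * (2 / q * (\<Sum>k<m. ell_mass p (u k))))"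
      by (rule sums_mult[OF h_sums])
    fix j
    have h0: "0 \<le> h j" by (simp add: h_def sum_nonneg)
    have "(\<Sum>S\<in>Pow {..<k}. norm (?y S j) powr p) / ?n \<le> (\<Sum>l\<in>{..<k}. (norm (x l j))\<^sup>2) powr (p / 2)"
      by (rule mean_le_square_function) (use p_pos \<open>p \<le> 2\<close> in auto)
    also have "\<dots> \<le> (\<Sum>l\<in>{..<k}. (\<beta> l)\<^sup>2 * h j powr (2 / p)) powr (p / 2)"
    proof (intro powr_mono2 sum_mono)
      fix l assume l: "l \<in> {..<k}"
      have "(norm (rest (\<iota> l) j) powr p) powr (2 / p) \<le> h j powr (2 / p)"
        using rest_h[OF \<iota>m] l p_pos by (intro powr_mono2) auto
      then have "(norm (rest (\<iota> l) j))\<^sup>2 \<le> h j powr (2 / p)"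
        using p_pos by (simp add: powr_powr flip: powr_numeral)
      then have "(\<beta> l)\<^sup>2 * (norm (rest (\<iota> l) j))\<^sup>2 \<le> (\<beta> l)\<^sup>2 * h j powr (2 / p)"
        by (rule mult_left_mono) simp
      then show "(norm (x l j))\<^sup>2 \<le> (\<beta> l)\<^sup>2 * h j powr (2 / p)"
        by (simp add: x_def seq_scale_def norm_mult power_mult_distrib)
    qed (use p_pos in \<open>auto simp: sum_nonneg\<close>)
    also have "\<dots> = (\<Sum>l<k. (\<beta> l)\<^sup>2) powr (p / 2) * h j"
      using h0 p_pos by (simp add: powr_mult powr_powr flip: sum_distrib_right)
    finally show "(\<Sum>S\<in>Pow {..<k}. norm (?y S j) powr p) / ?n \<le> (\<Sum>l<k. (\<beta> l)\<^sup>2) powr (p / 2) * h j" .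
  qed (use C in simp)
  also have "\<dots> \<le> C * ((\<Sum>l<k. (\<beta> l)\<^sup>2) powr (p / 2) * (2 * real n * C))"
    using C h_mass by (intro mult_left_mono) auto
  finally have "(\<Sum>l<k. v l * \<bar>\<beta> l\<bar> powr p) * (1 / 2) powr p \<le> C * ((\<Sum>l<k. (\<beta> l)\<^sup>2) powr (p / 2) * (2 * real n * C))"
    by (simp only: sum_distrib_right)
  then have le: "(\<Sum>l<k. v l * \<bar>\<beta> l\<bar> powr p) * (1 / 2) powr p * 2 powr p \<le> C * ((\<Sum>l<k. (\<beta> l)\<^sup>2) powr (p / 2) * (2 * real n * C)) * 2 powr p"
    by (rule mult_right_mono) simp
  have "(1 / 2) powr p * (2 powr p) = (1::real)" by (simp add: powr_divide)
  then have "(\<Sum>l<k. v l * \<bar>\<beta> l\<bar> powr p) = (\<Sum>l<k. v l * \<bar>\<beta> l\<bar> powr p) * (1 / 2) powr p * 2 powr p"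
    by (simp only: mult.assoc mult_1_right)
  also note le
  also have "C * ((\<Sum>l<k. (\<beta> l)\<^sup>2) powr (p / 2) * (2 * real n * C)) * 2 powr p
      = 2 powr p * C * (2 * real n * C) * (\<Sum>l<k. (\<beta> l)\<^sup>2) powr (p / 2)"
    by (simp only: mult_ac)
  finally show ?thesis .
qed

end

section \<open>Large systems do not exist\<close>

lemma ell_system_mono:
  assumes "ell_system p C v m u \<phi>" "n \<le> m"
  shows "ell_system p C v n u \<phi>"
proof -
  interpret ell_system p C v m u \<phi> by fact
  have sub: "{..<n} \<subseteq> {..<m}" using \<open>n \<le> m\<close> by auto
  have less: "i < n \<Longrightarrow> i < m" for i using \<open>n \<le> m\<close> by simp
  show ?thesis
    by unfold_locales
      (use p C v_0 v_nonneg in \<open>blast intro: less u \<phi>_add \<phi>_scale upper[OF order_trans[OF _ sub]] lower[OF _ _ order_trans[OF _ sub]] biorthogonal\<close>)+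
qed

text \<open>For \<open>1 \<le> p < 2\<close>: the upper \<open>\<ell>\<^sub>2\<close> estimate at \<open>\<beta> = v\<^bsup>1/(2-p)\<^esup>\<close> gives \<open>v \<in> \<ell>\<^sub>r\<close> with
  \<open>r = 2/(2-p)\<close>; then Jensen's inequality makes the partial sums of \<open>v\<close> of smaller order than
  \<open>n\<^bsup>1-1/r\<^esup> = n\<^bsup>p/2\<^esup>\<close>, against the lower \<open>\<ell>\<^sub>2\<close> estimate.\<close>

lemma square_estimates_contradict:
  fixes v :: "nat \<Rightarrow> real" and p B D :: real
  assumes p: "1 \<le> p" "p < 2" and v: "\<And>i. 0 \<le> v i" and "0 < B" "0 \<le> D"
    and up: "\<And>k \<beta>. (\<Sum>l<k. v l * \<bar>\<beta> l\<bar> powr p) \<le> D * (\<Sum>l<k. (\<beta> l)\<^sup>2) powr (p / 2)"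
    and low: "\<And>k. 1 \<le> k \<Longrightarrow> real k powr (p / 2) \<le> B * (\<Sum>l<k. v l)"
  shows False
proof -
  define r where "r = 2 / (2 - p)"
  have r: "1 \<le> r" "1 / r = 1 - p / 2" "0 < r" "r * (1 - p / 2) = 1"
    using p by (auto simp: r_def field_simps)
  have S: "(\<Sum>l<k. v l powr r) \<le> D powr r" for k
  proof -
    define s where "s = (\<Sum>l<k. v l powr r)"
    define \<beta> where "\<beta> l = v l powr (1 / (2 - p))" for l
    have b2: "(\<beta> l)\<^sup>2 = v l powr r" for l
      by (simp add: \<beta>_def r_def powr_powr flip: powr_numeral)
    have "v l * \<bar>\<beta> l\<bar> powr p = v l powr r" for l
    proof -
      have "v l * \<bar>\<beta> l\<bar> powr p = v l powr (1 + p / (2 - p))"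
        using v[of l] by (simp add: \<beta>_def powr_powr powr_mult_base)
      moreover have "1 + p / (2 - p) = r" using p by (simp add: r_def field_simps)
      ultimately show ?thesis by simp
    qed
    then have le: "s \<le> D * s powr (p / 2)"
      using up[of \<beta> k] by (simp add: s_def b2)
    have "0 \<le> s" by (simp add: s_def sum_nonneg)
    show ?thesis
    proof (cases "s = 0")
      case False
      then have s: "0 < s" using \<open>0 \<le> s\<close> by simp
      have "s powr (1 - p / 2) * s powr (p / 2) = s"
        using s by (simp flip: powr_add)
      then have "s powr (1 - p / 2) * s powr (p / 2) \<le> D * s powr (p / 2)"
        using le by simp
      then have "s powr (1 - p / 2) \<le> D"
        by (rule mult_right_le_imp_le) (use s in simp)
      then have "(s powr (1 - p / 2)) powr r \<le> D powr r"
        using r by (intro powr_mono2) auto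
      then show ?thesis using s r by (simp add: powr_powr s_def mult.commute)
    qed (simp add: s_def[symmetric])
  qed
  then have sm: "summable (\<lambda>l. v l powr r)"
    by (intro summableI_nonneg_bounded[where x = "D powr r"]) auto
  define e where "e = (1 / (2 * B)) powr r"
  have e: "0 < e" "e powr (1 / r) = 1 / (2 * B)"
    using \<open>0 < B\<close> r by (auto simp: e_def powr_powr)
  obtain M where M: "\<And>m n. M \<le> m \<Longrightarrow> norm (\<Sum>l\<in>{m..<n}. v l powr r) < e"
    using sm e(1) unfolding summable_Cauchy by meson
  define A where "A = (\<Sum>l<M. v l)"
  have bound: "real k powr (p / 2) \<le> 2 * B * A" if k: "M < k" for k
  proof -
    let ?I = "{M..<k}"
    have I: "?I \<noteq> {}" "card ?I = k - M" using k by auto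
    have d: "0 < real (k - M)" using k by simp
    have "((\<Sum>l\<in>?I. v l) / card ?I) powr r \<le> (\<Sum>l\<in>?I. v l powr r) / card ?I"
      by (rule mean_powr_le) (use I r v in auto)
    also have "\<dots> \<le> e / card ?I"
      by (rule divide_right_mono) (use M[of M k] in auto)
    finally have "(((\<Sum>l\<in>?I. v l) / real (k - M)) powr r) powr (1 / r) \<le> (e / real (k - M)) powr (1 / r)"
      using r(3) I by (intro powr_mono2) (auto simp: v sum_nonneg)
    then have "(\<Sum>l\<in>?I. v l) / real (k - M) \<le> 1 / (2 * B) / real (k - M) powr (1 / r)"
      using r(1,3) v d e by (simp add: powr_powr powr_divide sum_nonneg)
    then have "(\<Sum>l\<in>?I. v l) \<le> 1 / (2 * B) / real (k - M) powr (1 / r) * real (k - M)"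
      using d by (simp only: pos_divide_le_eq)
    also have "\<dots> = 1 / (2 * B) * real (k - M) powr (p / 2)"
    proof -
      have "real (k - M) powr (p / 2) * real (k - M) powr (1 / r) = real (k - M)"
        unfolding r(2) using d by (simp flip: powr_add)
      then have "real (k - M) powr (p / 2) = real (k - M) / real (k - M) powr (1 / r)"
        using d by (simp add: eq_divide_eq)
      then show ?thesis by simp
    qed
    also have "\<dots> \<le> 1 / (2 * B) * real k powr (p / 2)"
      using \<open>0 < B\<close> p by (intro mult_left_mono powr_mono2) auto
    finally have tail: "(\<Sum>l\<in>?I. v l) \<le> 1 / (2 * B) * real k powr (p / 2)" .
    have "(\<Sum>l<k. v l) = A + (\<Sum>l\<in>?I. v l)"
      using k by (simp add: A_def lessThan_atLeast0 sum.atLeastLessThan_concat)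
    then have "B * (\<Sum>l<k. v l) \<le> B * (A + 1 / (2 * B) * real k powr (p / 2))"
      using tail \<open>0 < B\<close> by (intro mult_left_mono) auto
    moreover have "real k powr (p / 2) \<le> B * (\<Sum>l<k. v l)"
      by (rule low) (use k in simp)
    ultimately have "real k powr (p / 2) \<le> B * (A + 1 / (2 * B) * real k powr (p / 2))"
      by linarith
    also have "\<dots> = B * A + real k powr (p / 2) / 2"
      using \<open>0 < B\<close> by (simp add: field_simps)
    finally show ?thesis by simp
  qed
  have "0 \<le> A" by (simp add: A_def sum_nonneg v)
  obtain k0 :: nat where k0: "(2 * B * A) powr (2 / p) < k0"
    using reals_Archimedean2 by blast
  define k where "k = max k0 (Suc M)"
  have "(2 * B * A) powr (2 / p) < real k" using k0 by (simp add: k_def)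
  then have "((2 * B * A) powr (2 / p)) powr (p / 2) < real k powr (p / 2)"
    using p by (intro powr_less_mono2) auto
  then have "2 * B * A < real k powr (p / 2)"
    using p \<open>0 < B\<close> \<open>0 \<le> A\<close> by (simp add: powr_powr)
  moreover have "M < k" by (simp add: k_def)
  ultimately show False using bound[of k] by simp
qed

text \<open>The upper estimate is taken from systems of size \<open>n q\<close> with \<open>n\<close> fixed and \<open>q\<close> an arbitrarily large
  prime, so that it holds for all lengths with one constant.\<close>

lemma no_large_systems:
  fixes v :: "nat \<Rightarrow> real" and p C :: real
  assumes p: "1 \<le> p" and C: "0 < C" and v: "v \<longlonglongrightarrow> 0" "v 0 = 1" "\<And>i. 0 \<le> v i"
  shows "\<exists>m. \<not> (\<exists>(u :: nat \<Rightarrow> nat \<Rightarrow> 'a::{real_normed_field,real_inner}) \<phi>. ell_system p C v m u \<phi>)"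
proof (rule ccontr)
  assume "\<not> ?thesis"
  then have ex: "\<exists>(u :: nat \<Rightarrow> nat \<Rightarrow> 'a) \<phi>. ell_system p C v m u \<phi>" for m by blast
  show False
  proof (cases "2 \<le> p")
    case True
    obtain n0 where n0: "\<And>n. n0 \<le> n \<Longrightarrow> (\<Sum>i<n. v i) \<le> 1 / (2 * C\<^sup>2) * real n"
      using mean_of_null_sequence_small[OF v(1), of "1 / (2 * C\<^sup>2)"] C by auto
    define m where "m = Suc n0"
    obtain u :: "nat \<Rightarrow> nat \<Rightarrow> 'a" and \<phi> where "ell_system p C v m u \<phi>" using ex by blast
    then have "real m \<le> C\<^sup>2 * (\<Sum>i<m. v i)" by (rule ell_system.count_le_weights[OF _ True])
    also have "\<dots> \<le> C\<^sup>2 * (1 / (2 * C\<^sup>2) * real m)"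
      by (intro mult_left_mono n0) (auto simp: m_def)
    also have "\<dots> = real m / 2" using C by simp
    finally show False by (simp add: m_def)
  next
    case False
    define B where "B = 2 powr p * C\<^sup>2"
    have B: "0 < B" using C by (simp add: B_def)
    obtain n0 where n0: "\<And>n. n0 \<le> n \<Longrightarrow> (\<Sum>i<n. v i) \<le> 1 / (4 * B) * real n"
      using mean_of_null_sequence_small[OF v(1), of "1 / (4 * B)"] B by auto
    define n where "n = Suc n0"
    have "4 * B * (\<Sum>i<n. v i) \<le> 4 * B * (1 / (4 * B) * real n)"
      by (intro mult_left_mono n0) (use B in \<open>auto simp: n_def\<close>)
    then have small: "4 * 2 powr p * C\<^sup>2 * (\<Sum>i<n. v i) \<le> n"
      using C by (simp add: B_def mult.assoc)
    show False
    proof (rule square_estimates_contradict[OF p _ v(3) B])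
      show "p < 2" using False by simp
      show "0 \<le> 2 powr p * C * (2 * real n * C)" using C by simp
      fix k
      show "(\<Sum>l<k. v l * \<bar>\<beta> l\<bar> powr p) \<le> 2 powr p * C * (2 * real n * C) * (\<Sum>l<k. (\<beta> l)\<^sup>2) powr (p / 2)" for \<beta>
      proof -
        obtain q where q: "prime q" "n + 2 * k < q" using bigger_prime by blast
        obtain u :: "nat \<Rightarrow> nat \<Rightarrow> 'a" and \<phi> where "ell_system p C v (n * q) u \<phi>" using ex by blast
        then show ?thesis
          by (rule ell_system.upper_square_estimate) (use q small False in \<open>auto simp: n_def\<close>)
      qed
      show "real k powr (p / 2) \<le> B * (\<Sum>l<k. v l)" if "1 \<le> k"
      proof -
        obtain u :: "nat \<Rightarrow> nat \<Rightarrow> 'a" and \<phi> where "ell_system p C v k u \<phi>" using ex by blast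
        then show ?thesis
          unfolding B_def by (rule ell_system.square_root_growth) (use False that in auto)
      qed
    qed
  qed
qed

section \<open>The block subspace and \<open>\<ell>\<^sub>p\<close>\<close>

text \<open>The blocks of length \<open>k\<close> span a Lorentz space with these weights.\<close>

definition block_weight :: "(nat \<Rightarrow> real) \<Rightarrow> nat \<Rightarrow> nat \<Rightarrow> real" where
  "block_weight w k i = (\<Sum>t<k. w (i * k + t)) / W_sum w k"

lemma sum_div_mod:
  fixes f :: "nat \<Rightarrow> nat \<Rightarrow> real"
  assumes "0 < k"
  shows "(\<Sum>s<n * k. f (s div k) (s mod k)) = (\<Sum>l<n. \<Sum>t<k. f l t)"
proof (induction n)
  case (Suc n)
  have "(\<Sum>s<n * k + k. f (s div k) (s mod k)) = (\<Sum>s<n * k. f (s div k) (s mod k)) + (\<Sum>t<k. f ((n * k + t) div k) ((n * k + t) mod k))"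
    by (rule sum_lessThan_add)
  also have "(\<Sum>t<k. f ((n * k + t) div k) ((n * k + t) mod k)) = (\<Sum>t<k. f n t)"
    by (rule sum.cong) auto
  finally show ?case using Suc by (simp add: add.commute)
qed simp

context lorentz
begin

lemma sum_block_weight:
  assumes "1 \<le> k"
  shows "(\<Sum>i<n. block_weight w k i) = W_sum w (n * k) / W_sum w k"
proof -
  have "W_sum w (n * k) = (\<Sum>s<n * k. w (s div k * k + s mod k))"
    by (simp add: W_sum_def)
  also have "\<dots> = (\<Sum>l<n. \<Sum>t<k. w (l * k + t))"
    using sum_div_mod[of k "\<lambda>l t. w (l * k + t)" n] assms by simp
  finally show ?thesis by (simp add: block_weight_def sum_divide_distrib)
qed

lemma block_weight_0: "1 \<le> k \<Longrightarrow> block_weight w k 0 = 1"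
  using W_pos[of k] by (simp add: block_weight_def W_sum_def)

lemma block_weight_nonneg: "0 \<le> block_weight w k i"
  by (simp add: block_weight_def W_nonneg w_nonneg sum_nonneg)

lemma block_weight_tendsto_0:
  assumes "1 \<le> k"
  shows "block_weight w k \<longlonglongrightarrow> 0"
proof (rule tendsto_sandwich[of "\<lambda>_. 0"])
  have w0: "w \<longlonglongrightarrow> 0" using w by (simp add: weights_def)
  show "(\<lambda>i. k * w i / W_sum w k) \<longlonglongrightarrow> 0"
    using tendsto_divide[OF tendsto_mult[OF tendsto_const w0] tendsto_const, of "W_sum w k" "real k"] W_pos[OF assms] by simp
  have "block_weight w k i \<le> k * w i / W_sum w k" for i
  proof -
    have "(\<Sum>t<k. w (i * k + t)) \<le> (\<Sum>t<k. w i)"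
    proof (intro sum_mono w_antimono)
      fix t
      have "i \<le> i * k" using assms by (cases k) auto
      then show "i \<le> i * k + t" by linarith
    qed
    then show ?thesis by (simp add: block_weight_def divide_right_mono W_nonneg)
  qed
  then show "\<forall>\<^sub>F i in sequentially. block_weight w k i \<le> k * w i / W_sum w k" by simp
qed (simp_all add: block_weight_nonneg)

end

context blocks
begin

lemma first_in_block:
  assumes "1 \<le> k" "i < N k" "t < k"
  shows "len (first k (Suc i) + t) = k" "start (first k (Suc i) + t) = first k (Suc i)"
  using in_block_iff[of k "Suc i" "first k (Suc i) + t"] assms by auto

lemma first_inj: "1 \<le> k \<Longrightarrow> first k (Suc i) = first k (Suc j) \<Longrightarrow> i = j"
  by (simp add: first_def)

text \<open>An isomorphism of \<open>Y\<close> onto \<open>\<ell>\<^sub>p\<close> carries the \<open>N\<^sub>k\<close> blocks of length \<open>k\<close> and their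
  coordinate functionals to a biorthogonal system in \<open>\<ell>\<^sub>p\<close>.\<close>

lemma isomorphism_gives_ell_system:
  fixes T :: "(nat \<Rightarrow> 'a::{real_normed_field,real_inner}) \<Rightarrow> nat \<Rightarrow> 'a"
  assumes T: "linear_on Y T" "bij_betw T Y (ell_space p)" and K: "0 < K"
    and le: "\<And>x. x \<in> Y \<Longrightarrow> ell_norm p (T x) \<le> K * nm x"
    and ge: "\<And>x. x \<in> Y \<Longrightarrow> nm x \<le> K * ell_norm p (T x)"
    and k: "1 \<le> k"
  shows "\<exists>u \<phi>. ell_system p (K powr p) (block_weight w k) (N k) (u :: nat \<Rightarrow> nat \<Rightarrow> 'a) \<phi>"
proof -
  define u where "u i = T (blk k (Suc i))" for i
  define g where "g = inv_into Y T"
  define \<omega> where "\<omega> = W_sum w k powr (1 / p)"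
  have \<omega>: "0 < \<omega>" "\<omega> powr p = W_sum w k"
    using W_pos[OF k] p_pos by (auto simp: \<omega>_def powr_powr)
  define \<phi> where "\<phi> i y = g y (first k (Suc i)) * of_real \<omega>" for i y
  have k0: "0 < k" using k by simp
  have blk_entry: "(blk k (Suc i) :: nat \<Rightarrow> 'a) n = (if n \<in> {first k (Suc i)..<first k (Suc i) + k} then of_real (1 / \<omega>) else 0)" for i n
    unfolding \<omega>_def by (rule blk_apply) simp
  have bY: "blk k (Suc i) \<in> (Y :: (nat \<Rightarrow> 'a) set)" if "i < N k" for i
    by (rule blk_in_Y) (use k that in auto)
  have gY: "g y \<in> Y" "T (g y) = y" if "y \<in> ell_space p" for y
  proof -
    have "y \<in> T ` Y" using T(2) that by (simp add: bij_betw_def)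
    then show "g y \<in> Y" "T (g y) = y"
      unfolding g_def by (rule inv_into_into, rule f_inv_into_f)
  qed
  have gT: "g (T x) = x" if "x \<in> Y" for x
    using T(2) that unfolding g_def bij_betw_def by auto
  have Tadd: "T (x + y) = T x + T y" if "x \<in> Y" "y \<in> Y" for x y
    using T(1) that unfolding linear_on_def by blast
  have Tscale: "T (seq_scale c x) = seq_scale c (T x)" if "x \<in> Y" for c x
    using T(1) that unfolding linear_on_def by blast
  have gadd: "g (x + y) = g x + g y" if "x \<in> ell_space p" "y \<in> ell_space p" for x y
    using gT[OF seq.subspace_add[OF subspace_Y gY(1) gY(1), OF that]] Tadd[OF gY(1) gY(1), OF that] gY(2) that by simp
  have gscale: "g (seq_scale c x) = seq_scale c (g x)" if "x \<in> ell_space p" for c x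
    using gT[OF seq.subspace_scale[OF subspace_Y gY(1)[OF that]]] Tscale[OF gY(1)[OF that]] gY(2)[OF that] by simp
  have mass_le: "ell_mass p (T x) \<le> K powr p * nm x powr p" if "x \<in> Y" for x
  proof -
    have Tx: "T x \<in> ell_space p" using T(2) that by (auto simp: bij_betw_def)
    have "ell_mass p (T x) = ell_norm p (T x) powr p" by (simp add: ell_norm_powr[OF p_pos Tx])
    also have "\<dots> \<le> (K * nm x) powr p"
      using p_pos by (intro powr_mono2 le[OF that]) (auto simp: ell_norm_nonneg)
    finally show ?thesis by (simp add: powr_mult)
  qed
  have "ell_system p (K powr p) (block_weight w k) (N k) u \<phi>"
  proof
    show "1 \<le> p" by (rule p)
    show "0 < K powr p" using K by simp
    show "block_weight w k 0 = 1" by (rule block_weight_0[OF k])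
    show "0 \<le> block_weight w k i" for i by (rule block_weight_nonneg)
    show "u i \<in> ell_space p" if "i < N k" for i
      using T(2) bY[OF that] by (auto simp: bij_betw_def u_def)
    show "\<phi> i (x + y) = \<phi> i x + \<phi> i y" if "x \<in> ell_space p" "y \<in> ell_space p" for i x y
      by (simp add: \<phi>_def gadd[OF that] distrib_right)
    show "\<phi> i (seq_scale c x) = c * \<phi> i x" if "x \<in> ell_space p" for i x c
    proof -
      have "\<phi> i (seq_scale c x) = seq_scale c (g x) (first k (Suc i)) * of_real \<omega>"
        by (simp only: \<phi>_def gscale[OF that])
      then show ?thesis by (simp add: \<phi>_def seq_scale_def mult.assoc)
    qed
    show "\<phi> i (u j) = of_bool (i = j)" if ij: "i < N k" "j < N k" for i j
    proof -
      have "first k (Suc i) \<in> {first k (Suc j)..<first k (Suc j) + k} \<longleftrightarrow> first k (Suc i) = first k (Suc j)"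
        using in_block_iff[of k "Suc j" "first k (Suc i)"] first_in_block[of k i 0] k ij by auto
      also have "\<dots> \<longleftrightarrow> i = j" using first_inj[OF k] by blast
      finally have iff: "first k (Suc i) \<in> {first k (Suc j)..<first k (Suc j) + k} \<longleftrightarrow> i = j" .
      have "\<phi> i (u j) = (blk k (Suc j) :: nat \<Rightarrow> 'a) (first k (Suc i)) * of_real \<omega>"
        by (simp add: \<phi>_def u_def gT[OF bY[OF ij(2)]])
      also have "(blk k (Suc j) :: nat \<Rightarrow> 'a) (first k (Suc i)) = (if i = j then of_real (1 / \<omega>) else 0)"
        by (simp only: blk_entry iff)
      finally show ?thesis using \<omega> by (auto simp flip: of_real_mult)
    qed
    show "ell_mass p (\<lambda>j. signed_sum A (\<lambda>i. u i j) S) \<le> K powr p * (\<Sum>i<card A. block_weight w k i)"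
      if A: "A \<subseteq> {..<N k}" for A S
    proof -
      have finA: "finite A" using A finite_subset by auto
      define x where "x = (\<Sum>i\<in>A. seq_scale (of_real (sign_at S i)) (blk k (Suc i) :: nat \<Rightarrow> 'a))"
      have bYA: "blk k (Suc i) \<in> (Y :: (nat \<Rightarrow> 'a) set)" if "i \<in> A" for i
        using bY A that by auto
      have "x \<in> Y" unfolding x_def
        by (rule seq.subspace_sum[OF subspace_Y]) (rule seq.subspace_scale[OF subspace_Y bYA])
      have "T x = (\<Sum>i\<in>A. seq_scale (of_real (sign_at S i)) (u i))"
        unfolding x_def u_def by (rule linear_on_sum[OF T(1) subspace_Y finA bYA])
      then have Tx: "T x = (\<lambda>j. signed_sum A (\<lambda>i. u i j) S)"
        by (simp add: fun_eq_iff signed_sum_def sum_fun_apply seq_scale_def scaleR_conv_of_real)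
      let ?B = "\<lambda>i. {first k (Suc i)..<first k (Suc i) + k}"
      let ?U = "\<Union>i\<in>A. ?B i"
      have entry: "norm (x j) \<le> (if j \<in> ?U then 1 / \<omega> else 0)" for j
      proof -
        have xj: "x j = (\<Sum>i\<in>A. of_real (sign_at S i) * (if j \<in> ?B i then of_real (1 / \<omega>) else 0))"
          unfolding x_def sum_fun_apply seq_scale_def
          by (rule sum.cong[OF refl]) (simp only: blk_entry)
        show ?thesis
        proof (cases "j \<in> ?U")
          case True
          then obtain i0 where i0: "i0 \<in> A" "j \<in> ?B i0" by auto
          have "j \<notin> ?B i" if "i \<in> A - {i0}" for i
          proof
            assume j: "j \<in> ?B i"
            have "1 \<le> Suc i" "Suc i \<le> N k" "1 \<le> Suc i0" "Suc i0 \<le> N k"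
              using that i0 A by auto
            then have "first k (Suc i) = first k (Suc i0)"
              using in_block_iff[OF k, of "Suc i" j] in_block_iff[OF k, of "Suc i0" j] i0(2) j by metis
            then show False using first_inj[OF k] that by blast
          qed
          then have "x j = (\<Sum>i\<in>{i0}. of_real (sign_at S i) * (if j \<in> ?B i then of_real (1 / \<omega>) else 0))"
            unfolding xj using finA i0 by (intro sum.mono_neutral_right) auto
          also have "\<dots> = of_real (sign_at S i0 * (1 / \<omega>))" using i0(2) by simp
          finally have "norm (x j) = \<bar>sign_at S i0 * (1 / \<omega>)\<bar>"
            by (simp only: norm_of_real)
          then show ?thesis using True \<omega> by (simp add: abs_mult)
        next
          case False
          then have "x j = 0" unfolding xj by (intro sum.neutral) auto
          then show ?thesis using \<omega>(1) by simp
        qed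
      qed
      have finU: "finite ?U" using finA by simp
      have "card ?U \<le> (\<Sum>i\<in>A. card (?B i))" by (rule card_UN_le[OF finA])
      then have cardU: "card ?U \<le> card A * k" by simp
      have "nm x powr p \<le> (1 / \<omega>) powr p * W_sum w (card ?U)"
        by (rule flat_in_X(2)[OF finU _ entry]) (use \<omega> in simp)
      also have "\<dots> \<le> (1 / \<omega>) powr p * W_sum w (card A * k)"
        by (intro mult_left_mono W_mono cardU) simp
      also have "\<dots> = (\<Sum>i<card A. block_weight w k i)"
        using \<omega> by (simp add: sum_block_weight[OF k] powr_divide)
      finally have "K powr p * nm x powr p \<le> K powr p * (\<Sum>i<card A. block_weight w k i)"
        by (rule mult_left_mono) simp
      then show ?thesis using mass_le[OF \<open>x \<in> Y\<close>] unfolding Tx by simp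
    qed
    show "(\<Sum>l<n. norm (\<phi> (\<iota> l) y) powr p * block_weight w k l) \<le> K powr p * ell_mass p y"
      if y: "y \<in> ell_space p" and \<iota>: "inj_on \<iota> {..<n}" "\<iota> ` {..<n} \<subseteq> {..<N k}" for y \<iota> n
    proof -
      define x where "x = g y"
      have x: "x \<in> Y" "T x = y" using gY[OF y] by (auto simp: x_def)
      then have xX: "x \<in> X" and cst: "\<And>j. x j = x (start j)"
        by (auto simp: Y_def average_eq_iff)
      have \<iota>N: "\<iota> l < N k" if "l < n" for l using \<iota>(2) that by auto
      define F where "F s = first k (Suc (\<iota> (s div k))) + s mod k" for s
      have dm: "s div k < n" "s mod k < k" if "s < n * k" for s
        using that k0 by (auto simp: less_mult_imp_div_less)
      have injF: "inj_on F {..<n * k}"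
      proof (rule inj_onI)
        fix s t assume st: "s \<in> {..<n * k}" "t \<in> {..<n * k}" and eq: "F s = F t"
        have "first k (Suc (\<iota> (s div k))) = first k (Suc (\<iota> (t div k)))"
        proof -
          have "start (F s) = first k (Suc (\<iota> (s div k)))" "start (F t) = first k (Suc (\<iota> (t div k)))"
            using first_in_block(2)[OF k \<iota>N] dm st by (simp_all add: F_def)
          then show ?thesis using eq by simp
        qed
        then have "\<iota> (s div k) = \<iota> (t div k)" by (rule first_inj[OF k])
        then have "s div k = t div k"
          using \<iota>(1) dm(1) st by (auto dest: inj_onD)
        moreover from this have "s mod k = t mod k" using eq by (simp add: F_def)
        ultimately show "s = t" by (metis div_mult_mod_eq)
      qed
      have "(\<Sum>l<n. norm (\<phi> (\<iota> l) y) powr p * block_weight w k l)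
         = (\<Sum>l<n. \<Sum>t<k. norm (x (first k (Suc (\<iota> l)) + t)) powr p * w (l * k + t))"
      proof (rule sum.cong[OF refl])
        fix l assume "l \<in> {..<n}"
        then have l: "\<iota> l < N k" using \<iota>N by simp
        let ?a = "norm (x (first k (Suc (\<iota> l)))) powr p"
        have "norm (\<phi> (\<iota> l) y) powr p = ?a * W_sum w k"
          using \<omega> by (simp add: \<phi>_def x_def norm_mult powr_mult)
        then have "norm (\<phi> (\<iota> l) y) powr p * block_weight w k l = (\<Sum>t<k. ?a * w (l * k + t))"
          using W_pos[OF k] by (simp add: block_weight_def flip: sum_distrib_left)
        also have "\<dots> = (\<Sum>t<k. norm (x (first k (Suc (\<iota> l)) + t)) powr p * w (l * k + t))"
        proof (rule sum.cong[OF refl])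
          fix t assume "t \<in> {..<k}"
          then have "x (first k (Suc (\<iota> l)) + t) = x (first k (Suc (\<iota> l)))"
            using cst[of "first k (Suc (\<iota> l)) + t"] first_in_block(2)[OF k l] by simp
          then show "?a * w (l * k + t) = norm (x (first k (Suc (\<iota> l)) + t)) powr p * w (l * k + t)" by simp
        qed
        finally show "norm (\<phi> (\<iota> l) y) powr p * block_weight w k l = (\<Sum>t<k. norm (x (first k (Suc (\<iota> l)) + t)) powr p * w (l * k + t))" .
      qed
      also have "\<dots> = (\<Sum>s<n * k. norm (x (F s)) powr p * w s)"
        using sum_div_mod[OF k0, of "\<lambda>l t. norm (x (first k (Suc (\<iota> l)) + t)) powr p * w (l * k + t)" n]
        by (simp add: F_def)
      also have "\<dots> \<le> nm x powr p"
        by (rule rearranged_sum_le[OF xX _ injF]) simp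
      also have "\<dots> \<le> (K * ell_norm p y) powr p"
        using ge[OF x(1)] x(2) p_pos nm_nonneg by (intro powr_mono2) auto
      also have "\<dots> = K powr p * ell_mass p y"
        by (simp add: powr_mult ell_norm_powr[OF p_pos y])
      finally show ?thesis .
    qed
  qed
  then show ?thesis by blast
qed

text \<open>The length \<open>k\<close> of the blocks also serves as a bound for the isomorphism constant: every
  isomorphism is refuted by the blocks of some length \<open>k\<close> that exceeds its constant.\<close>

theorem Y_not_isomorphic_ell:
  assumes N: "\<And>k. 1 \<le> k \<Longrightarrow> \<not> (\<exists>(u :: nat \<Rightarrow> nat \<Rightarrow> 'a::{real_normed_field,real_inner}) \<phi>.
      ell_system p (real k powr p) (block_weight w k) (N k) u \<phi>)"
  shows "\<not> linearly_homeomorphic (Y :: (nat \<Rightarrow> 'a) set) nm (ell_space p) (ell_norm p)"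
proof
  assume "linearly_homeomorphic (Y :: (nat \<Rightarrow> 'a) set) nm (ell_space p) (ell_norm p)"
  then obtain T where T: "linear_on (Y :: (nat \<Rightarrow> 'a) set) T"
    and hom: "homeomorphic_map (norm_topology Y nm) (norm_topology (ell_space p) (ell_norm p)) T"
    unfolding linearly_homeomorphic_def by blast
  obtain K where K: "0 < K" "bij_betw T Y (ell_space p)" "\<And>x. x \<in> Y \<Longrightarrow> ell_norm p (T x) \<le> K * nm x"
    "\<And>x. x \<in> Y \<Longrightarrow> nm x \<le> K * ell_norm p (T x)"
    using linear_homeomorphism_bounds[OF seq_norm_Y seq_norm_ell[OF p] T hom] by blast
  obtain k0 :: nat where k0: "K \<le> k0" using real_arch_simple by blast
  define k where "k = Suc k0"
  have k: "1 \<le> k" "K \<le> k" using k0 by (auto simp: k_def)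
  have "\<exists>(u :: nat \<Rightarrow> nat \<Rightarrow> 'a) \<phi>. ell_system p (real k powr p) (block_weight w k) (N k) u \<phi>"
  proof (rule isomorphism_gives_ell_system[OF T K(2) _ _ _ k(1)])
    show "0 < real k" using k by simp
    fix x :: "nat \<Rightarrow> 'a" assume x: "x \<in> Y"
    show "ell_norm p (T x) \<le> real k * nm x"
      using K(3)[OF x] mult_right_mono[OF k(2) nm_nonneg[of x]] by linarith
    show "nm x \<le> real k * ell_norm p (T x)"
      using K(4)[OF x] mult_right_mono[OF k(2) ell_norm_nonneg[of p "T x"]] by linarith
  qed
  then show False using N[OF k(1)] by blast
qed

end

section \<open>The choice of the block numbers\<close>

lemma (in lorentz) good_block_numbers:
  "\<exists>N :: nat \<Rightarrow> nat. (\<forall>k\<ge>1. 0 < N k) \<and> strict_mono_on {1..} N \<and>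
     (let X = lorentz_space w p :: (nat \<Rightarrow> 'a::{real_normed_field,real_inner}) set;
          Y = block_subspace w p N :: (nat \<Rightarrow> 'a) set
      in one_complemented X (lorentz_norm w p) Y \<and>
         \<not> contains_isomorph Y (lorentz_norm w p) X (lorentz_norm w p) \<and>
         \<not> linearly_homeomorphic Y (lorentz_norm w p) (ell_space p) (ell_norm p))"
proof -
  have "\<exists>m. \<not> (\<exists>(u :: nat \<Rightarrow> nat \<Rightarrow> 'a) \<phi>. ell_system p (real k powr p) (block_weight w k) m u \<phi>)" if "1 \<le> k" for k
    by (rule no_large_systems[OF p _ block_weight_tendsto_0[OF that] block_weight_0[OF that] block_weight_nonneg])
      (use that in simp)
  then obtain m where m: "\<And>k. 1 \<le> k \<Longrightarrow> \<not> (\<exists>(u :: nat \<Rightarrow> nat \<Rightarrow> 'a) \<phi>. ell_system p (real k powr p) (block_weight w k) (m k) u \<phi>)"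
    by metis
  \<comment> \<open>Partial sums make the sequence increasing; larger systems restrict to smaller ones.\<close>
  define N where "N k = (\<Sum>j\<le>k. Suc (m j))" for k
  have Nm: "m k \<le> N k" "0 < N k" for k
    unfolding N_def using member_le_sum[of k "{..k}" "\<lambda>j. Suc (m j)"] by auto
  have mono: "strict_mono N"
    by (rule strict_mono_Suc_iff[THEN iffD2]) (simp add: N_def)
  interpret blocks w p N
    by unfold_locales (rule Nm(2))
  have "\<not> (\<exists>(u :: nat \<Rightarrow> nat \<Rightarrow> 'a) \<phi>. ell_system p (real k powr p) (block_weight w k) (N k) u \<phi>)" if "1 \<le> k" for k
    using m[OF that] ell_system_mono[OF _ Nm(1)[of k]] by blast
  then have "\<not> linearly_homeomorphic (Y :: (nat \<Rightarrow> 'a) set) nm (ell_space p) (ell_norm p)"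
    by (rule Y_not_isomorphic_ell)
  then show ?thesis
    using Nm(2) mono Y_one_complemented Y_contains_no_isomorph
    by (intro exI[of _ N]) (auto simp: Let_def block_subspace_eq_Y strict_mono_on_def strict_mono_def)
qed

theorem theorem2p3:
  fixes w :: "nat \<Rightarrow> real" and p :: real
  assumes "1 \<le> p" and "w \<in> weights"
  shows
    "(\<exists>N :: nat \<Rightarrow> nat.
        (\<forall>k\<ge>1. 0 < N k) \<and> strict_mono_on {1..} N \<and>
        (let X = lorentz_space w p :: (nat \<Rightarrow> real) set;
             Y = block_subspace w p N :: (nat \<Rightarrow> real) set
         in one_complemented X (lorentz_norm w p) Y \<and>
            \<not> contains_isomorph Y (lorentz_norm w p) X (lorentz_norm w p) \<and>
            \<not> linearly_homeomorphic Y (lorentz_norm w p) (ell_space p) (ell_norm p))) \<and>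
     (\<exists>N :: nat \<Rightarrow> nat.
        (\<forall>k\<ge>1. 0 < N k) \<and> strict_mono_on {1..} N \<and>
        (let X = lorentz_space w p :: (nat \<Rightarrow> complex) set;
             Y = block_subspace w p N :: (nat \<Rightarrow> complex) set
         in one_complemented X (lorentz_norm w p) Y \<and>
            \<not> contains_isomorph Y (lorentz_norm w p) X (lorentz_norm w p) \<and>
            \<not> linearly_homeomorphic Y (lorentz_norm w p) (ell_space p) (ell_norm p)))"
proof -
  interpret lorentz w p
    using assms by unfold_locales
  show ?thesis
    by (intro conjI good_block_numbers)
qed

end
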